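(* Let $\Omega$ be a bounded open subset of $\mathbb{R}^N$ and let $F\in C(\Omega\times\mathbb{R}\times\mathbb{R}^N\times\mathcal{S}(N))$ be proper. Assume that there exists $\gamma>0$ such that $$\gamma(r-s)\le F(x,r,p,X)-F(x,s,p,X)\quad\text{for } r\ge s,\ (x,p,X)\in\Omega\times\mathbb{R}^N\times\mathcal{S}(N),$$ and that there is a function $\omega:[0,\infty]\to[0,\infty]$ with $\omega(0+)=0$ such that $$F(y,r,\alpha(x-y),Y)-F(x,r,\alpha(x-y),X)\le\omega(\alpha|x-y|^2+|x-y|)$$ whenever $\alpha>0$, $x,y\in\Omega$, $r\in\mathbb{R}$, and $X,Y\in\mathcal{S}(N)$ satisfy $$-3\alpha\begin{pmatrix}I&0\\0&I\end{pmatrix}\le\begin{pmatrix}X&0\\0&-Y\end{pmatrix}\le 3\alpha\begin{pmatrix}I&-I\\-I&I\end{pmatrix}.$$ Let $u\in \mathrm{USC}(\overline\Omega)$ be a subsolution of $F=0$ in $\Omega$ and $v\in\mathrm{LSC}(\overline\Omega)$ be a supersolution of $F=0$ in $\Omega$, and let $u\le v$ on $\partial\Omega$. Then $u\le v$ in $\overline\Omega$.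
   Context: $\mathcal{S}(N)$ is the set of real symmetric $N\times N$ matrices with its usual order ($Y\le X$ iff $\langle Y\xi,\xi\rangle\le\langle X\xi,\xi\rangle$ for all $\xi$); the same order is used on $2N\times 2N$ symmetric matrices, and $I$ is the identity matrix. $\mathrm{USC}(\mathcal O)$ (resp. $\mathrm{LSC}(\mathcal O)$) is the set of real-valued upper (resp. lower) semicontinuous functions on $\mathcal O\subset\mathbb{R}^N$. $F$ is proper if $F(x,r,p,X)\le F(x,s,p,Y)$ whenever $r\le s$ and $Y\le X$. For $u:\mathcal O\to\mathbb{R}$ and $\hat x\in\mathcal O$, $J^{2,+}_{\mathcal O}u(\hat x)$ is the set of $(p,X)\in\mathbb{R}^N\times\mathcal S(N)$ such that $u(x)\le u(\hat x)+\langle p,x-\hat x\rangle+\frac12\langle X(x-\hat x),x-\hat x\rangle+o(|x-\hat x|^2)$ as $\mathcal O\ni x\to\hat x$; and $J^{2,-}_{\mathcal O}u(\hat x)=-J^{2,+}_{\mathcal O}(-u)(\hat x)$. (Viscosity notions.) A subsolution of $F=0$ in $\mathcal O$ is a function $u$, upper semicontinuous on $\mathcal O$, with $F(x,u(x),p,X)\le0$ for all $x\in\mathcal O$ and $(p,X)\in J^{2,+}_{\mathcal O}u(x)$. A supersolution is a function $v$, lower semicontinuous on $\mathcal O$, with $F(x,v(x),p,X)\ge0$ for all $x\in\mathcal O$ and $(p,X)\in J^{2,-}_{\mathcal O}v(x)$. *)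

theory Defs
  imports "HOL-Analysis.Analysis" "HOL-Library.Landau_Symbols"
begin

section \<open>Symmetric matrices and their order\<close>

definition sym_mats :: "(real ^ 'n ^ 'n) set" where
  "sym_mats = {X. transpose X = X}"

text \<open>
  The order is defined for all square matrices but is only used between symmetric ones.
  It is not the componentwise order \<open>\<le>\<close> that the library puts on vectors.
\<close>

definition mat_le :: "real ^ 'n ^ 'n \<Rightarrow> real ^ 'n ^ 'n \<Rightarrow> bool"  (infix \<open>\<preceq>\<close> 50) where
  "Y \<preceq> X \<longleftrightarrow> (\<forall>\<xi>. (Y *v \<xi>) \<bullet> \<xi> \<le> (X *v \<xi>) \<bullet> \<xi>)"

text \<open>
  The block matrix with first block row \<open>A B\<close> and second block row \<open>C D\<close>; the sum type
  \<open>'n + 'n\<close> indexes the \<open>2N\<close> coordinates.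
\<close>

definition block_mat ::
  "real ^ 'n ^ 'n \<Rightarrow> real ^ 'n ^ 'n \<Rightarrow> real ^ 'n ^ 'n \<Rightarrow> real ^ 'n ^ 'n
    \<Rightarrow> real ^ ('n + 'n) ^ ('n + 'n)" where
  "block_mat A B C D = (\<chi> i j.
     case i of
       Inl k \<Rightarrow> (case j of Inl l \<Rightarrow> A $ k $ l | Inr l \<Rightarrow> B $ k $ l)
     | Inr k \<Rightarrow> (case j of Inl l \<Rightarrow> C $ k $ l | Inr l \<Rightarrow> D $ k $ l))"

section \<open>Semicontinuity\<close>

definition usc_on :: "'a::topological_space set \<Rightarrow> ('a \<Rightarrow> real) \<Rightarrow> bool" where
  "usc_on S f \<longleftrightarrow> (\<forall>x\<in>S. \<forall>a. f x < a \<longrightarrow> (\<forall>\<^sub>F y in at x within S. f y < a))"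

definition lsc_on :: "'a::topological_space set \<Rightarrow> ('a \<Rightarrow> real) \<Rightarrow> bool" where
  "lsc_on S f \<longleftrightarrow> (\<forall>x\<in>S. \<forall>a. a < f x \<longrightarrow> (\<forall>\<^sub>F y in at x within S. a < f y))"

section \<open>Proper equations, semijets and viscosity solutions\<close>

definition proper_on ::
  "(real ^ 'n) set \<Rightarrow> (real ^ 'n \<Rightarrow> real \<Rightarrow> real ^ 'n \<Rightarrow> real ^ 'n ^ 'n \<Rightarrow> real) \<Rightarrow> bool" where
  "proper_on S F \<longleftrightarrow>
     (\<forall>x\<in>S. \<forall>r s p. \<forall>X\<in>sym_mats. \<forall>Y\<in>sym_mats.
        r \<le> s \<longrightarrow> Y \<preceq> X \<longrightarrow> F x r p X \<le> F x s p Y)"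

text \<open>
  The \<open>o\<close>-term is a function \<open>h\<close>. The filter is punctured at \<open>z\<close>, where the inequality
  with \<open>h z = 0\<close> is trivial.
\<close>

definition superjet ::
  "(real ^ 'n) set \<Rightarrow> (real ^ 'n \<Rightarrow> real) \<Rightarrow> real ^ 'n \<Rightarrow> ((real ^ 'n) \<times> (real ^ 'n ^ 'n)) set" where
  "superjet S u z = {(p, X). X \<in> sym_mats \<and>
     (\<exists>h \<in> o[at z within S](\<lambda>x. (norm (x - z))\<^sup>2).
        \<forall>\<^sub>F x in at z within S.
          u x \<le> u z + p \<bullet> (x - z) + 1/2 * ((X *v (x - z)) \<bullet> (x - z)) + h x)}"

definition subjet ::
  "(real ^ 'n) set \<Rightarrow> (real ^ 'n \<Rightarrow> real) \<Rightarrow> real ^ 'n \<Rightarrow> ((real ^ 'n) \<times> (real ^ 'n ^ 'n)) set" where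
  "subjet S u z = uminus ` superjet S (\<lambda>x. - u x) z"

definition viscosity_subsolution ::
  "(real ^ 'n \<Rightarrow> real \<Rightarrow> real ^ 'n \<Rightarrow> real ^ 'n ^ 'n \<Rightarrow> real) \<Rightarrow> (real ^ 'n) set
    \<Rightarrow> (real ^ 'n \<Rightarrow> real) \<Rightarrow> bool" where
  "viscosity_subsolution F S u \<longleftrightarrow>
     usc_on S u \<and> (\<forall>x\<in>S. \<forall>(p, X) \<in> superjet S u x. F x (u x) p X \<le> 0)"

definition viscosity_supersolution ::
  "(real ^ 'n \<Rightarrow> real \<Rightarrow> real ^ 'n \<Rightarrow> real ^ 'n ^ 'n \<Rightarrow> real) \<Rightarrow> (real ^ 'n) set
    \<Rightarrow> (real ^ 'n \<Rightarrow> real) \<Rightarrow> bool" where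
  "viscosity_supersolution F S v \<longleftrightarrow>
     lsc_on S v \<and> (\<forall>x\<in>S. \<forall>(p, X) \<in> subjet S v x. F x (v x) p X \<ge> 0)"

end

(* The theorem on sums is proved without the theorems of Rademacher and Alexandrov, because it
   only needs second order expansions along a sequence of scales. For a nonexpansive map J an L^2
   energy identity shows that the second differences of J at scale t are o(t) almost everywhere
   along t = 2^-k, so almost everywhere J has a linear blow-up along a subsequence. With J the
   inverse of the subdifferential of a strongly convex function F, this gives quadratic blow-ups
   of F at points where F is touched from above by a paraboloid, and a tilting argument produces
   such points near a maximum. An error e t^2 at one small scale t suffices for an exact superjet
   at a nearby point. The comparison principle then follows by doubling the variables. *)
theory Submission
  imports Defs
begin

section \<open>Blow-ups of Lipschitz maps\<close>

text \<open>The subdifferential of a convex function may be multivalued and need not be Lipschitz,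
  whereas under strong convexity its inverse is single valued, defined everywhere and nonexpansive;
  so the measure theory is done for the inverse and transferred back. Dyadic scales are natural
  because a difference quotient at scale 2t is the mean of two quotients at scale t: the energies
  then increase and stay bounded, and the second differences are controlled by the increments.
  Nothing here makes the linear parts at different scales converge, hence the subsequence; it is
  common to all increments, which is all that a quadratic blow-up requires. One scale is enough at
  the end because the equation is continuous, so jets at nearby points with converging gradients and
  matrices do as well as jets at the maximum itself. Apart from its penalty the doubled function has
  no mixed terms, so its limiting quadratic form splits into two, and these supply the two matrices
  of the structure condition.\<close>

lemma nn_integral_cball_translate:
  fixes f :: "'a::euclidean_space \<Rightarrow> ennreal"
  assumes [measurable]: "f \<in> borel_measurable borel"
  shows "(\<integral>\<^sup>+q. f (q + a) * indicator (cball 0 r) q \<partial>lborel)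
    \<le> (\<integral>\<^sup>+q. f q * indicator (cball 0 (r + norm a)) q \<partial>lborel)"
proof -
  have "(\<integral>\<^sup>+q. f (q + a) * indicator (cball 0 r) q \<partial>lborel)
    \<le> (\<integral>\<^sup>+q. f (a + q) * indicator (cball 0 (r + norm a)) (a + q) \<partial>lborel)"
    by (intro nn_integral_mono) (auto split: split_indicator simp: add.commute intro: norm_triangle_le)
  also have "\<dots> = (\<integral>\<^sup>+q. f q * indicator (cball 0 (r + norm a)) q \<partial>distr lborel borel ((+) a))"
    by (subst nn_integral_distr) (auto intro!: borel_measurable_times_ennreal borel_measurable_indicator)
  finally show ?thesis by (simp add: lborel_distr_plus)
qed

lemma AE_lborel_of_cballs:
  assumes "\<And>n::nat. AE q in lborel. q \<in> cball (0::'a::euclidean_space) (real n) \<longrightarrow> P q"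
  shows "AE q in lborel. P q"
proof -
  have "AE q in lborel. \<forall>n::nat. q \<in> cball (0::'a) (real n) \<longrightarrow> P q"
    using assms by (intro AE_all_countable[THEN iffD2] allI)
  then show ?thesis
    by eventually_elim (metis mem_cball_0 real_arch_simple)
qed

text \<open>By monotone convergence the bound on partial sums passes to the integral of the whole
  series, and a series that is finite almost everywhere has terms tending to zero.\<close>

lemma AE_tendsto_zero_of_summable_nn_integral:
  fixes f :: "nat \<Rightarrow> 'a \<Rightarrow> real"
  assumes [measurable]: "\<And>k. f k \<in> borel_measurable M"
    and nn: "\<And>k x. 0 \<le> f k x"
    and bd: "\<And>n. (\<Sum>k<n. \<integral>\<^sup>+x. f k x \<partial>M) \<le> C" and C: "C < \<infinity>"
  shows "AE x in M. (\<lambda>k. f k x) \<longlonglongrightarrow> 0"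
proof -
  have "(\<integral>\<^sup>+x. (\<Sum>k. ennreal (f k x)) \<partial>M) = (\<Sum>k. \<integral>\<^sup>+x. f k x \<partial>M)"
    by (intro nn_integral_suminf) measurable
  also have "\<dots> \<le> C"
    by (intro suminf_le_const summableI bd)
  finally have "(\<integral>\<^sup>+x. (\<Sum>k. ennreal (f k x)) \<partial>M) \<noteq> \<infinity>"
    using C by (simp add: order.strict_iff_not top_unique)
       (metis infinity_ennreal_def neq_top_trans order.strict_iff_not)
  then have "AE x in M. (\<Sum>k. ennreal (f k x)) \<noteq> \<infinity>"
    by (intro nn_integral_PInf_AE) measurable
  then show ?thesis
    by eventually_elim (auto intro!: summable_LIMSEQ_zero summable_suminf_not_top nn)
qed

text \<open>Divided by the scale, a second difference is the difference \<open>D\<close> of two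
  neighbouring first quotients \<open>d\<close>. Its squared L2 norms are summable over the scales,
  since they are controlled by the increments of a bounded monotone sequence of energies. The offset
  \<open>s\<close> merely shifts the base point by at most \<open>norm s\<close>.\<close>

lemma AE_second_difference:
  fixes J :: "'a::euclidean_space \<Rightarrow> 'b::euclidean_space"
  assumes lip: "\<And>x y. norm (J x - J y) \<le> C * norm (x - y)"
  shows "AE q in lborel.
    (\<lambda>k. 2^k *\<^sub>R (J (q + (1/2)^k *\<^sub>R (s + 2 *\<^sub>R v)) - 2 *\<^sub>R J (q + (1/2)^k *\<^sub>R (s + v)) + J (q + (1/2)^k *\<^sub>R s)))
      \<longlonglongrightarrow> 0"
proof (rule AE_lborel_of_cballs)
  fix N :: nat
  define t :: "nat \<Rightarrow> real" where "t k = (1/2)^k" for k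
  have t: "0 \<le> t k" "t k \<le> 1" "t k = 2 * t (Suc k)" "2^k * t k = 1" for k
    by (auto simp: t_def power_one_over field_simps)
  have cont: "continuous_on UNIV J"
  proof (rule lipschitz_on_continuous_on)
    have "norm (J x - J y) \<le> \<bar>C\<bar> * norm (x - y)" for x y
      by (rule order_trans[OF lip]) (simp add: mult_right_mono)
    then show "\<bar>C\<bar>-lipschitz_on UNIV J"
      by (intro lipschitz_onI) (auto simp: dist_norm)
  qed
  then have [measurable]: "J \<in> borel_measurable borel"
    by (rule borel_measurable_continuous_onI)
  define d where "d k q = 2^k *\<^sub>R (J (q + t k *\<^sub>R v) - J q)" for k q
  define D where "D k q = d k (q + t k *\<^sub>R v) - d k q" for k q
  have [measurable]: "d k \<in> borel_measurable borel" for k unfolding d_def by measurable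
  have [measurable]: "D k \<in> borel_measurable borel" for k unfolding D_def by measurable
  have dbd: "norm (d k q) \<le> C * norm v" for k q
  proof -
    have "norm (d k q) = 2^k * norm (J (q + t k *\<^sub>R v) - J q)" by (simp add: d_def)
    also have "\<dots> \<le> 2^k * (C * norm (t k *\<^sub>R v))"
      using lip[of "q + t k *\<^sub>R v" q] by (intro mult_left_mono) auto
    also have "\<dots> = (2^k * t k) * (C * norm v)" using t(1)[of k] by simp
    finally show ?thesis by (simp add: t(4))
  qed
  have dS: "d k q = (1/2) *\<^sub>R (d (Suc k) q + d (Suc k) (q + t (Suc k) *\<^sub>R v))" for k q
    by (simp add: d_def t(3)[of k] algebra_simps scaleR_2[symmetric] flip: scaleR_add_left)
  have para: "(norm (D (Suc k) q))\<^sup>2 + 4 * (norm (d k q))\<^sup>2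
      = 2 * (norm (d (Suc k) q))\<^sup>2 + 2 * (norm (d (Suc k) (q + t (Suc k) *\<^sub>R v)))\<^sup>2" for k q
    using dS[of k q] by (simp add: D_def power2_norm_eq_inner inner_simps inner_commute algebra_simps)
  have m[simp, intro]: "(\<lambda>q. ennreal ((norm (D k q))\<^sup>2) * indicator (cball 0 r) q) \<in> borel_measurable borel"
    "(\<lambda>q. ennreal ((norm (d k q))\<^sup>2) * indicator (cball 0 r) q) \<in> borel_measurable borel"
    "(\<lambda>q. ennreal ((norm (d k (q + c)))\<^sup>2) * indicator (cball 0 r) q) \<in> borel_measurable borel" for k r c
    by (auto intro!: borel_measurable_times_ennreal borel_measurable_indicator)
  \<comment> \<open>Integrals over the whole space could diverge, so the energies live on balls. The
    shifts up to scale \<open>k\<close> add up to \<open>(1 - t k) * norm v\<close> in length, so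
    all radii stay below \<open>R + norm v\<close>; the \<open>norm s\<close> in \<open>R\<close> is
    room for the final shift by \<open>s\<close>.\<close>
  define R where "R = real N + norm s"
  define \<rho> where "\<rho> k = R + (1 - t k) * norm v" for k
  have \<rho>S: "\<rho> (Suc k) = \<rho> k + norm (t (Suc k) *\<^sub>R v)" for k
    using t(1)[of "Suc k"] t(3)[of k] by (simp add: \<rho>_def algebra_simps)
  have \<rho>le: "R \<le> \<rho> k" "\<rho> k \<le> R + norm v" for k
    using t(1,2)[of k] by (auto simp: \<rho>_def mult_left_le_one_le)
  define I where "I k = (\<integral>\<^sup>+q. ennreal ((norm (d k q))\<^sup>2) * indicator (cball 0 (\<rho> k)) q \<partial>lborel)" for k
  define a where "a k = (\<integral>\<^sup>+q. ennreal ((norm (D (Suc k) q))\<^sup>2) * indicator (cball 0 (\<rho> k)) q \<partial>lborel)" for k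
  txt \<open>Since \<open>d k\<close> is the mean of two translates of \<open>d (Suc k)\<close>, the parallelogram law makes the energies
    \<open>I k\<close> increase by at least \<open>a k / 4\<close>. The radius \<open>\<rho> k\<close> grows by exactly the length of the translation,
    so the cut-off to balls costs nothing.\<close>
  have step: "a k + 4 * I k \<le> 4 * I (Suc k)" for k
  proof -
    have "a k + 4 * I k = (\<integral>\<^sup>+q. ennreal ((norm (D (Suc k) q))\<^sup>2) * indicator (cball 0 (\<rho> k)) q
        + 4 * (ennreal ((norm (d k q))\<^sup>2) * indicator (cball 0 (\<rho> k)) q) \<partial>lborel)"
      unfolding a_def I_def
      by (subst nn_integral_add) (auto simp: nn_integral_cmult intro!: borel_measurable_times_ennreal borel_measurable_indicator)
    also have "\<dots> = (\<integral>\<^sup>+q. 2 * (ennreal ((norm (d (Suc k) q))\<^sup>2) * indicator (cball 0 (\<rho> k)) q)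
        + 2 * (ennreal ((norm (d (Suc k) (q + t (Suc k) *\<^sub>R v)))\<^sup>2) * indicator (cball 0 (\<rho> k)) q) \<partial>lborel)"
    proof (intro nn_integral_cong)
      fix q
      have "ennreal ((norm (D (Suc k) q))\<^sup>2 + 4 * (norm (d k q))\<^sup>2)
        = ennreal (2 * (norm (d (Suc k) q))\<^sup>2 + 2 * (norm (d (Suc k) (q + t (Suc k) *\<^sub>R v)))\<^sup>2)"
        by (simp only: para)
      then show "ennreal ((norm (D (Suc k) q))\<^sup>2) * indicator (cball 0 (\<rho> k)) q
        + 4 * (ennreal ((norm (d k q))\<^sup>2) * indicator (cball 0 (\<rho> k)) q)
        = 2 * (ennreal ((norm (d (Suc k) q))\<^sup>2) * indicator (cball 0 (\<rho> k)) q)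
        + 2 * (ennreal ((norm (d (Suc k) (q + t (Suc k) *\<^sub>R v)))\<^sup>2) * indicator (cball 0 (\<rho> k)) q)"
        by (auto split: split_indicator simp: ennreal_plus ennreal_mult simp del: ennreal_plus[symmetric])
    qed
    also have "\<dots> = 2 * (\<integral>\<^sup>+q. ennreal ((norm (d (Suc k) q))\<^sup>2) * indicator (cball 0 (\<rho> k)) q \<partial>lborel)
      + 2 * (\<integral>\<^sup>+q. ennreal ((norm (d (Suc k) (q + t (Suc k) *\<^sub>R v)))\<^sup>2) * indicator (cball 0 (\<rho> k)) q \<partial>lborel)"
      by (subst nn_integral_add) (auto simp: nn_integral_cmult intro!: borel_measurable_times_ennreal borel_measurable_indicator)
    also have "\<dots> \<le> 2 * I (Suc k) + 2 * I (Suc k)"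
    proof (intro add_mono mult_left_mono)
      show "(\<integral>\<^sup>+q. ennreal ((norm (d (Suc k) q))\<^sup>2) * indicator (cball 0 (\<rho> k)) q \<partial>lborel) \<le> I (Suc k)"
        unfolding I_def \<rho>S
        by (intro nn_integral_mono mult_left_mono) (auto split: split_indicator intro: order_trans)
      show "(\<integral>\<^sup>+q. ennreal ((norm (d (Suc k) (q + t (Suc k) *\<^sub>R v)))\<^sup>2) * indicator (cball 0 (\<rho> k)) q \<partial>lborel) \<le> I (Suc k)"
        unfolding I_def \<rho>S
        by (rule nn_integral_cball_translate[of "\<lambda>q. ennreal ((norm (d (Suc k) q))\<^sup>2)"]) measurable
    qed auto
    also have "\<dots> = 4 * I (Suc k)"
      by (simp flip: distrib_right)
    finally show ?thesis .
  qed
  have sums: "(\<Sum>k<n. a k) + 4 * I 0 \<le> 4 * I n" for n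
  proof (induction n)
    case (Suc n)
    have "(\<Sum>k<Suc n. a k) + 4 * I 0 = a n + ((\<Sum>k<n. a k) + 4 * I 0)" by (simp add: ac_simps)
    also have "\<dots> \<le> a n + 4 * I n" using Suc by (intro add_left_mono)
    also note step
    finally show ?case .
  qed simp
  define V where "V = 4 * (ennreal ((C * norm v)\<^sup>2) * emeasure lborel (cball (0::'a) (R + norm v)))"
  have "4 * I n \<le> V" for n
  proof -
    have "I n \<le> (\<integral>\<^sup>+q. ennreal ((C * norm v)\<^sup>2) * indicator (cball (0::'a) (R + norm v)) q \<partial>lborel)"
      unfolding I_def
      by (intro nn_integral_mono)
        (auto split: split_indicator intro!: ennreal_leI power_mono dbd intro: order_trans[OF _ \<rho>le(2)])
    then show ?thesis unfolding V_def
      by (intro mult_left_mono) (auto simp: nn_integral_cmult_indicator)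
  qed
  then have aV: "(\<Sum>k<n. a k) \<le> V" for n
    using sums[of n] by (meson add_increasing2 order_trans order_refl zero_le le_add_same_cancel1)
  have V: "V < \<infinity>" unfolding V_def
    using emeasure_lborel_cball_finite[of "0::'a" "R + norm v"] by (auto simp: ennreal_mult_less_top)
  have "AE q in lborel. (\<lambda>k. (norm (D (Suc k) (q + t (Suc k) *\<^sub>R s)))\<^sup>2 * indicator (cball 0 (real N)) q) \<longlonglongrightarrow> 0"
  proof (rule AE_tendsto_zero_of_summable_nn_integral[OF _ _ _ V])
    fix n
    have "(\<Sum>k<n. \<integral>\<^sup>+q. ennreal ((norm (D (Suc k) (q + t (Suc k) *\<^sub>R s)))\<^sup>2 * indicator (cball 0 (real N)) q) \<partial>lborel)
      \<le> (\<Sum>k<n. a k)"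
    proof (rule sum_mono)
      fix k
      have "(\<integral>\<^sup>+q. ennreal ((norm (D (Suc k) (q + t (Suc k) *\<^sub>R s)))\<^sup>2 * indicator (cball 0 (real N)) q) \<partial>lborel)
        = (\<integral>\<^sup>+q. ennreal ((norm (D (Suc k) (q + t (Suc k) *\<^sub>R s)))\<^sup>2) * indicator (cball 0 (real N)) q \<partial>lborel)"
        by (intro nn_integral_cong) (auto split: split_indicator)
      also have "\<dots> \<le> (\<integral>\<^sup>+q. ennreal ((norm (D (Suc k) q))\<^sup>2) * indicator (cball 0 (real N + norm (t (Suc k) *\<^sub>R s))) q \<partial>lborel)"
        by (rule nn_integral_cball_translate[of "\<lambda>q. ennreal ((norm (D (Suc k) q))\<^sup>2)"]) measurable
      also have "\<dots> \<le> a k"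
      proof -
        have "real N + norm (t (Suc k) *\<^sub>R s) \<le> \<rho> k"
          using \<rho>le(1)[of k] t(1,2)[of "Suc k"] by (auto simp: R_def mult_left_le_one_le intro: order_trans[rotated])
        then show ?thesis unfolding a_def
          by (intro nn_integral_mono mult_left_mono) (auto split: split_indicator)
      qed
      finally show "(\<integral>\<^sup>+q. ennreal ((norm (D (Suc k) (q + t (Suc k) *\<^sub>R s)))\<^sup>2 * indicator (cball 0 (real N)) q) \<partial>lborel) \<le> a k" .
    qed
    also note aV
    finally show "(\<Sum>k<n. \<integral>\<^sup>+q. ennreal ((norm (D (Suc k) (q + t (Suc k) *\<^sub>R s)))\<^sup>2 * indicator (cball 0 (real N)) q) \<partial>lborel) \<le> V" .
  qed (auto intro!: borel_measurable_times borel_measurable_indicator)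
  then show "AE q in lborel. q \<in> cball 0 (real N) \<longrightarrow>
    (\<lambda>k. 2^k *\<^sub>R (J (q + (1/2)^k *\<^sub>R (s + 2 *\<^sub>R v)) - 2 *\<^sub>R J (q + (1/2)^k *\<^sub>R (s + v)) + J (q + (1/2)^k *\<^sub>R s)))
      \<longlonglongrightarrow> 0"
  proof eventually_elim
    case (elim q)
    show ?case
    proof
      assume "q \<in> cball 0 (real N)"
      then have "(\<lambda>k. (norm (D (Suc k) (q + t (Suc k) *\<^sub>R s)))\<^sup>2) \<longlonglongrightarrow> 0"
        using elim by simp
      then have "(\<lambda>k. sqrt ((norm (D (Suc k) (q + t (Suc k) *\<^sub>R s)))\<^sup>2)) \<longlonglongrightarrow> sqrt 0"
        by (intro tendsto_real_sqrt)
      then have "(\<lambda>k. D (Suc k) (q + t (Suc k) *\<^sub>R s)) \<longlonglongrightarrow> 0"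
        by (simp add: tendsto_norm_zero_iff)
      \<comment> \<open>The energy step controls \<open>D (Suc k)\<close>, so the scale
        \<open>k = 0\<close> is missing; a limit does not see it.\<close>
      then have "(\<lambda>k. D k (q + t k *\<^sub>R s)) \<longlonglongrightarrow> 0"
        by (rule LIMSEQ_imp_Suc)
      moreover have "D k (q + t k *\<^sub>R s) = 2^k *\<^sub>R (J (q + t k *\<^sub>R (s + 2 *\<^sub>R v)) - 2 *\<^sub>R J (q + t k *\<^sub>R (s + v)) + J (q + t k *\<^sub>R s))" for k
        by (simp add: D_def d_def algebra_simps scaleR_2)
      ultimately show "(\<lambda>k. 2^k *\<^sub>R (J (q + (1/2)^k *\<^sub>R (s + 2 *\<^sub>R v)) - 2 *\<^sub>R J (q + (1/2)^k *\<^sub>R (s + v)) + J (q + (1/2)^k *\<^sub>R s))) \<longlonglongrightarrow> 0"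
        by (simp add: t_def)
    qed
  qed
qed

definition blowup :: "('a::real_normed_vector \<Rightarrow> 'b::real_normed_vector) \<Rightarrow> 'a \<Rightarrow> nat \<Rightarrow> 'a \<Rightarrow> 'b" where
  "blowup J q k h = 2^k *\<^sub>R (J (q + (1/2)^k *\<^sub>R h) - J q)"

lemma AE_blowup_additive:
  fixes J :: "'a::euclidean_space \<Rightarrow> 'b::euclidean_space"
  assumes lip: "\<And>x y. norm (J x - J y) \<le> C * norm (x - y)"
  shows "AE q in lborel. (\<lambda>k. blowup J q k (g + h) - blowup J q k g - blowup J q k h) \<longlonglongrightarrow> 0"
  using AE_second_difference[of J C 0 "(1/2) *\<^sub>R (g + h)", OF lip]
    AE_second_difference[of J C g "(1/2) *\<^sub>R (h - g)", OF lip]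
  \<comment> \<open>the four-point difference is the difference of two second differences with the same midpoint\<close>
proof eventually_elim
  case (elim q)
  have arg: "0 + 2 *\<^sub>R ((1/2) *\<^sub>R (g + h)) = g + h" "g + 2 *\<^sub>R ((1/2) *\<^sub>R (h - g)) = h"
      "g + (1/2) *\<^sub>R (h - g) = 0 + (1/2) *\<^sub>R (g + h)" "q + (1/2)^k *\<^sub>R 0 = q" for k :: nat
    by (simp_all add: algebra_simps flip: scaleR_add_left)
  have "2^k *\<^sub>R (A - B) - 2^k *\<^sub>R (G - B) - 2^k *\<^sub>R (H - B)
      = 2^k *\<^sub>R (A - 2 *\<^sub>R M + B) - 2^k *\<^sub>R (H - 2 *\<^sub>R M + G)" for A B G H M :: 'b and k :: nat
    by (simp add: algebra_simps)
  then have "blowup J q k (g + h) - blowup J q k g - blowup J q k h =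
    2^k *\<^sub>R (J (q + (1/2)^k *\<^sub>R (0 + 2 *\<^sub>R ((1/2) *\<^sub>R (g + h)))) - 2 *\<^sub>R J (q + (1/2)^k *\<^sub>R (0 + (1/2) *\<^sub>R (g + h))) + J (q + (1/2)^k *\<^sub>R 0))
    - 2^k *\<^sub>R (J (q + (1/2)^k *\<^sub>R (g + 2 *\<^sub>R ((1/2) *\<^sub>R (h - g)))) - 2 *\<^sub>R J (q + (1/2)^k *\<^sub>R (g + (1/2) *\<^sub>R (h - g))) + J (q + (1/2)^k *\<^sub>R g))" for k
    unfolding blowup_def arg by blast
  then show ?case
    using tendsto_diff[OF elim] by simp
qed

section \<open>Maps that become additive in the limit\<close>

lemma tendsto_add_cong_zero:
  fixes a b :: "nat \<Rightarrow> 'a::real_normed_vector"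
  shows "(\<lambda>k. a k - b k) \<longlonglongrightarrow> 0 \<Longrightarrow> b \<longlonglongrightarrow> 0 \<Longrightarrow> a \<longlonglongrightarrow> 0"
  using tendsto_add[of "\<lambda>k. a k - b k" 0 sequentially b 0] by simp

text \<open>This is the Cauchy functional equation in the limit: a rational combination of basis
  vectors uses finitely many additions, so their errors still tend to zero. Only rational points
  occur because additivity is available almost everywhere for countably many pairs
  simultaneously.\<close>

lemma asymptotically_additive_imp_zero:
  fixes e :: "nat \<Rightarrow> 'a::euclidean_space \<Rightarrow> 'b::real_normed_vector"
  defines "D \<equiv> {x. \<forall>b\<in>Basis. x \<bullet> b \<in> \<rat>}"
  assumes add: "\<And>g h. g \<in> D \<Longrightarrow> h \<in> D \<Longrightarrow> (\<lambda>k. e k (g + h) - e k g - e k h) \<longlonglongrightarrow> 0"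
    and zero: "\<And>k. e k 0 = 0" and basis: "\<And>b. b \<in> Basis \<Longrightarrow> (\<lambda>k. e k b) \<longlonglongrightarrow> 0"
    and x: "x \<in> D"
  shows "(\<lambda>k. e k x) \<longlonglongrightarrow> 0"
proof -
  have D0[simp]: "0 \<in> D" by (simp add: D_def)
  have D_add: "g \<in> D \<Longrightarrow> h \<in> D \<Longrightarrow> g + h \<in> D" for g h
    by (auto simp: D_def inner_add_left)
  have D_scale: "c \<in> \<rat> \<Longrightarrow> h \<in> D \<Longrightarrow> c *\<^sub>R h \<in> D" for c h
    by (auto simp: D_def)
  have D_basis: "b \<in> Basis \<Longrightarrow> b \<in> D" for b
    by (auto simp: D_def inner_Basis)
  have Z_add: "(\<lambda>k. e k (g + h)) \<longlonglongrightarrow> 0"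
    if "g \<in> D" "h \<in> D" "(\<lambda>k. e k g) \<longlonglongrightarrow> 0" "(\<lambda>k. e k h) \<longlonglongrightarrow> 0" for g h
    using tendsto_add[OF tendsto_add[OF add[OF that(1,2)] that(3)] that(4)] by simp
  have Z_neg: "(\<lambda>k. e k (- h)) \<longlonglongrightarrow> 0" if h: "h \<in> D" "(\<lambda>k. e k h) \<longlonglongrightarrow> 0" for h
  proof -
    have "- h \<in> D" using D_scale[of "-1" h] h by simp
    from tendsto_minus[OF tendsto_add[OF add[OF h(1) this] h(2)]] show ?thesis by (simp add: zero)
  qed
  have mult: "(\<lambda>k. e k (real n *\<^sub>R h) - real n *\<^sub>R e k h) \<longlonglongrightarrow> 0" if h: "h \<in> D" for n h
  proof (induction n)
    case 0 show ?case by (simp add: zero)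
  next
    case (Suc n)
    have "real n *\<^sub>R h \<in> D" by (simp add: D_scale h)
    from tendsto_add[OF add[OF h this] Suc.IH] show ?case
      by (simp add: algebra_simps)
  qed
  have Z_nat: "(\<lambda>k. e k (real n *\<^sub>R h)) \<longlonglongrightarrow> 0" if "h \<in> D" "(\<lambda>k. e k h) \<longlonglongrightarrow> 0" for n h
    by (rule tendsto_add_cong_zero[OF mult[OF that(1)]])
       (use tendsto_scaleR[OF tendsto_const that(2)] in simp)
  \<comment> \<open>Division is multiplication read backwards: \<open>n\<close> times
    \<open>e k (b / n)\<close> differs from \<open>e k b\<close> by a null sequence, and the latter
    tends to zero.\<close>
  have Z_div: "(\<lambda>k. e k ((1 / real n) *\<^sub>R b)) \<longlonglongrightarrow> 0" if b: "b \<in> Basis" and n: "n \<noteq> 0" for b n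
  proof -
    have "(1 / real n) *\<^sub>R b \<in> D" by (simp add: D_scale D_basis b)
    from tendsto_diff[OF basis[OF b] mult[OF this, of n]] n
    have "(\<lambda>k. real n *\<^sub>R e k ((1 / real n) *\<^sub>R b)) \<longlonglongrightarrow> 0"
      by simp
    from tendsto_scaleR[OF tendsto_const this, of "1 / real n"] n show ?thesis by simp
  qed
  have Z_rat: "(\<lambda>k. e k (c *\<^sub>R b)) \<longlonglongrightarrow> 0" if b: "b \<in> Basis" and c: "c \<in> \<rat>" for b c
  proof -
    obtain m n :: nat where n: "n \<noteq> 0" and mn: "\<bar>c\<bar> = real m / real n"
      using Rats_abs_nat_div_natE[OF c] by metis
    have D: "(1 / real n) *\<^sub>R b \<in> D" by (simp add: D_scale D_basis b)
    from Z_nat[OF D Z_div[OF b n], of m] have abs: "(\<lambda>k. e k (\<bar>c\<bar> *\<^sub>R b)) \<longlonglongrightarrow> 0"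
      by (simp add: mn)
    show ?thesis
    proof (cases "c \<ge> 0")
      case False
      then show ?thesis using Z_neg[OF _ abs] D_scale[of "\<bar>c\<bar>" b] D_basis[OF b] c
        by (simp add: abs_if)
    qed (use abs in simp)
  qed
  have "(\<Sum>b\<in>S. (x \<bullet> b) *\<^sub>R b) \<in> D \<and> (\<lambda>k. e k (\<Sum>b\<in>S. (x \<bullet> b) *\<^sub>R b)) \<longlonglongrightarrow> 0"
    if "finite S" "S \<subseteq> Basis" for S
    using that
  proof (induction S)
    case (insert b S)
    have "x \<bullet> b \<in> \<rat>" using x insert by (auto simp: D_def)
    then have "(x \<bullet> b) *\<^sub>R b \<in> D" "(\<lambda>k. e k ((x \<bullet> b) *\<^sub>R b)) \<longlonglongrightarrow> 0"
      using insert.prems by (simp_all add: D_scale D_basis Z_rat)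
    then show ?case using insert by (simp add: D_add Z_add)
  qed (simp add: zero)
  from this[of Basis] show ?thesis by (simp add: euclidean_representation)
qed

lemma rational_points:
  fixes D :: "'a::euclidean_space set"
  defines "D \<equiv> {x. \<forall>b\<in>Basis. x \<bullet> b \<in> \<rat>}"
  shows "countable D" "closure D = UNIV"
proof -
  have eq: "D = (\<Union>f \<in> Basis \<rightarrow> \<rat>. { \<Sum>i \<in> Basis. f i *\<^sub>R i })"
  proof safe
    fix x assume "x \<in> D"
    then have "(\<lambda>b. x \<bullet> b) \<in> Basis \<rightarrow> \<rat>" by (auto simp: D_def)
    moreover have "x = (\<Sum>i \<in> Basis. (x \<bullet> i) *\<^sub>R i)" by (simp add: euclidean_representation)
    ultimately show "x \<in> (\<Union>f \<in> Basis \<rightarrow> \<rat>. { \<Sum>i \<in> Basis. f i *\<^sub>R i })" by blast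
  qed (auto simp: D_def)
  then show "closure D = UNIV" by (simp add: closure_rational_coordinates)
  have "D \<subseteq> (\<lambda>f. \<Sum>i \<in> Basis. f i *\<^sub>R i) ` (Basis \<rightarrow>\<^sub>E \<rat>)"
  proof
    fix x assume "x \<in> D"
    then have "restrict (\<lambda>b. x \<bullet> b) Basis \<in> Basis \<rightarrow>\<^sub>E \<rat>" by (auto simp: D_def)
    moreover have "x = (\<Sum>i \<in> Basis. restrict (\<lambda>b. x \<bullet> b) Basis i *\<^sub>R i)" by (simp add: euclidean_representation)
    ultimately show "x \<in> (\<lambda>f. \<Sum>i \<in> Basis. f i *\<^sub>R i) ` (Basis \<rightarrow>\<^sub>E \<rat>)" by blast
  qed
  moreover have "countable (Basis \<rightarrow>\<^sub>E (\<rat>::real set))"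
    by (intro countable_PiE countable_rat) auto
  ultimately show "countable D"
    by (rule countable_subset[OF _ countable_image])
qed

lemma Lipschitz_tendsto_zero_dense:
  fixes e :: "nat \<Rightarrow> 'a::real_normed_vector \<Rightarrow> 'b::real_normed_vector"
  assumes lip: "\<And>k x y. norm (e k x - e k y) \<le> C * norm (x - y)"
    and D: "closure D = UNIV" and lim: "\<And>x. x \<in> D \<Longrightarrow> (\<lambda>k. e k x) \<longlonglongrightarrow> 0"
  shows "(\<lambda>k. e k x) \<longlonglongrightarrow> 0"
proof (rule LIMSEQ_I)
  fix r :: real assume r: "r > 0"
  define d where "d = r / (2 * (\<bar>C\<bar> + 1))"
  have d: "d > 0" using r by (simp add: d_def)
  obtain y where y: "y \<in> D" "dist y x < d" using D d closure_approachable[of x D] by auto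
  have "\<forall>\<^sub>F k in sequentially. norm (e k y) < r / 2"
    using lim[OF y(1)] r by (auto simp: tendsto_iff dist_norm dest: spec[of _ "r/2"])
  moreover have "norm (e k x) < r" if "norm (e k y) < r / 2" for k
  proof -
    have "norm (e k x - e k y) \<le> C * norm (x - y)" by (rule lip)
    also have "\<dots> \<le> (\<bar>C\<bar> + 1) * d"
      using y(2) by (intro mult_mono) (auto simp: dist_norm norm_minus_commute)
    also have "\<dots> = r / 2" using r by (simp add: d_def field_simps)
    finally show ?thesis using that norm_triangle_sub[of "e k x" "e k y"] by linarith
  qed
  ultimately have "\<forall>\<^sub>F k in sequentially. norm (e k x) < r" by (auto elim: eventually_mono)
  then show "\<exists>N. \<forall>n\<ge>N. norm (e n x - 0) < r" by (simp add: eventually_sequentially)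
qed

lemma Lipschitz_tendsto_zero_uniform:
  fixes e :: "nat \<Rightarrow> 'a::real_normed_vector \<Rightarrow> 'b::real_normed_vector"
  assumes lip: "\<And>k x y. norm (e k x - e k y) \<le> C * norm (x - y)"
    and lim: "\<And>x. (\<lambda>k. e k x) \<longlonglongrightarrow> 0" and K: "compact K" and r: "r > 0"
  shows "\<forall>\<^sub>F k in sequentially. \<forall>x\<in>K. norm (e k x) < r"
proof -
  define d where "d = r / (2 * (\<bar>C\<bar> + 1))"
  have d: "d > 0" using r by (simp add: d_def)
  obtain A where A: "finite A" "K \<subseteq> (\<Union>x\<in>A. ball x d)"
    using compactE_image[OF K, of K "\<lambda>x. ball x d"] d by (metis (no_types, lifting) UN_I centre_in_ball open_ball subsetI)
  have "\<forall>\<^sub>F k in sequentially. \<forall>y\<in>A. norm (e k y) < r / 2"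
    using tendstoD[OF lim, of "r/2"] r A(1) by (intro eventually_ball_finite) (auto simp: dist_norm)
  then show ?thesis
  proof eventually_elim
    case (elim k)
    show ?case
    proof
      fix x assume "x \<in> K"
      then obtain y where y: "y \<in> A" "dist y x < d" using A by auto
      have "norm (e k x - e k y) \<le> C * norm (x - y)" by (rule lip)
      also have "\<dots> \<le> (\<bar>C\<bar> + 1) * d"
        using y(2) by (intro mult_mono) (auto simp: dist_norm norm_minus_commute)
      also have "\<dots> = r / 2" using r by (simp add: d_def field_simps)
      finally show "norm (e k x) < r"
        using elim y(1) norm_triangle_sub[of "e k x" "e k y"] by fastforce
    qed
  qed
qed

text \<open>A weak form of Rademacher's theorem: differentiability along a sequence of scales.\<close>

theorem AE_blowup_subsequence_linear:
  fixes J :: "'a::euclidean_space \<Rightarrow> 'b::euclidean_space"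
  assumes lip: "\<And>x y. norm (J x - J y) \<le> C * norm (x - y)"
  shows "AE q in lborel. \<exists>r L. strict_mono r \<and> bounded_linear L \<and>
    (\<forall>K d. compact K \<longrightarrow> d > 0 \<longrightarrow> (\<forall>\<^sub>F n in sequentially. \<forall>h\<in>K. norm (blowup J q (r n) h - L h) < d))"
proof -
  define D where "D = {x::'a. \<forall>b\<in>Basis. x \<bullet> b \<in> \<rat>}"
  have D: "countable D" "closure D = UNIV" unfolding D_def by (rule rational_points)+
  have "AE q in lborel. \<forall>g\<in>D. \<forall>h\<in>D.
      (\<lambda>k. blowup J q k (g + h) - blowup J q k g - blowup J q k h) \<longlonglongrightarrow> 0"
    using D(1) AE_blowup_additive[of J C, OF lip] by (intro AE_ball_countable[THEN iffD2] ballI)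
  then show ?thesis
  proof eventually_elim
    case (elim q)
    define f where "f = blowup J q"
    have flip: "norm (f k x - f k y) \<le> C * norm (x - y)" for k x y
    proof -
      have "norm (f k x - f k y) = 2^k * norm (J (q + (1/2)^k *\<^sub>R x) - J (q + (1/2)^k *\<^sub>R y))"
        by (simp add: f_def blowup_def flip: scaleR_diff_right)
      also have "\<dots> \<le> 2^k * (C * norm ((1/2)^k *\<^sub>R (x - y)))"
        using lip[of "q + (1/2)^k *\<^sub>R x" "q + (1/2)^k *\<^sub>R y"]
        by (intro mult_left_mono) (auto simp: algebra_simps)
      also have "\<dots> = C * norm (x - y)" by (simp add: power_one_over)
      finally show ?thesis .
    qed
    have f0: "f k 0 = 0" for k by (simp add: f_def blowup_def)
    \<comment> \<open>The linear map that agrees with \<open>f k\<close> on the basis makes the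
      error \<open>e k\<close> vanish there at every scale. The maps \<open>l k\<close> need not
      converge, but they are bounded in a finite-dimensional space; this is where the subsequence
      \<open>r\<close> enters.\<close>
    define l where "l k = Blinfun (\<lambda>h. \<Sum>b\<in>Basis. (h \<bullet> b) *\<^sub>R f k b)" for k
    have "bounded_linear (\<lambda>h. \<Sum>b\<in>Basis. (h \<bullet> b) *\<^sub>R f k b)" for k
      by (intro bounded_linear_sum bounded_linear_scaleR_const bounded_linear_inner_left)
    then have l: "blinfun_apply (l k) h = (\<Sum>b\<in>Basis. (h \<bullet> b) *\<^sub>R f k b)" for k h
      by (simp add: l_def bounded_linear_Blinfun_apply)
    have lb: "norm (l k h) \<le> (real DIM('a) * C) * norm h" for k h
    proof -
      have "norm ((h \<bullet> b) *\<^sub>R f k b) \<le> norm h * C" if "b \<in> Basis" for b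
        using flip[of k b 0] that Basis_le_norm[OF that, of h] by (auto simp: f0 intro!: mult_mono)
      then show ?thesis unfolding l using sum_norm_bound[of Basis "\<lambda>b. (h \<bullet> b) *\<^sub>R f k b" "norm h * C"]
        by (simp add: ac_simps)
    qed
    have "C \<ge> 0"
    proof -
      obtain b :: 'a where "b \<in> Basis" using nonempty_Basis by blast
      then show ?thesis using order_trans[OF norm_ge_zero flip[of 0 b 0]] by simp
    qed
    then have "norm (l k) \<le> real DIM('a) * C" for k
      using lb by (intro norm_blinfun_bound) auto
    then have "bounded (range l)" by (auto simp: bounded_iff)
    then obtain lim r where r: "strict_mono (r :: nat \<Rightarrow> nat)" "(\<lambda>n. l (r n)) \<longlonglongrightarrow> lim"
      using bounded_imp_convergent_subsequence[of l] by (auto simp: o_def)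
    define e where "e k h = f k h - l k h" for k h
    have elip: "norm (e k x - e k y) \<le> (C + real DIM('a) * C) * norm (x - y)" for k x y
    proof -
      have eq: "e k x - e k y = (f k x - f k y) - l k (x - y)" by (simp add: e_def blinfun.diff_right)
      show ?thesis unfolding eq distrib_right
        by (rule order_trans[OF norm_triangle_ineq4 add_mono[OF flip lb]])
    qed
    have "(\<lambda>k. e k h) \<longlonglongrightarrow> 0" if "h \<in> D" for h
    proof (rule asymptotically_additive_imp_zero[OF _ _ _ that[unfolded D_def]], goal_cases)
      case (1 g h)
      then show ?case using elim
        by (simp add: e_def f_def D_def blinfun.add_right algebra_simps)
    next
      case (3 b)
      then have "l k b = f k b" for k
        unfolding l by (subst sum.remove[of _ b]) (auto simp: inner_Basis intro!: sum.neutral split: if_splits)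
      then show ?case by (simp add: e_def)
    qed (simp add: e_def f0)
    then have elim0: "(\<lambda>k. e k h) \<longlonglongrightarrow> 0" for h
      by (rule Lipschitz_tendsto_zero_dense[OF elip D(2)])
    define E where "E n h = f (r n) h - lim h" for n h
    have "(\<lambda>n. E n h) \<longlonglongrightarrow> 0" for h
    proof -
      have "(\<lambda>n. l (r n) h) \<longlonglongrightarrow> lim h"
        using r(2) by (intro tendsto_intros)
      then have "(\<lambda>n. e (r n) h + (l (r n) h - lim h)) \<longlonglongrightarrow> 0 + 0"
        using LIMSEQ_subseq_LIMSEQ[OF elim0 r(1)]
        by (intro tendsto_add) (auto simp: o_def LIM_zero)
      then show ?thesis by (simp add: e_def E_def)
    qed
    moreover have "norm (E n x - E n y) \<le> (C + norm lim) * norm (x - y)" for n x y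
    proof -
      have eq: "E n x - E n y = (f (r n) x - f (r n) y) - lim (x - y)" by (simp add: E_def blinfun.diff_right)
      show ?thesis unfolding eq distrib_right
        by (rule order_trans[OF norm_triangle_ineq4 add_mono[OF flip norm_blinfun]])
    qed
    ultimately have "\<forall>\<^sub>F n in sequentially. \<forall>h\<in>K. norm (E n h) < d" if "compact K" "d > 0" for K d
      using that Lipschitz_tendsto_zero_uniform[of E] by blast
    then show ?case
      using r(1) blinfun.bounded_linear_right[of lim] unfolding E_def f_def by blast
  qed
qed

section \<open>Strongly convex functions\<close>

text \<open>Equivalently, \<open>q - z\<close> is an ordinary subgradient at \<open>z\<close> of
  \<open>F\<close> minus half the squared norm. The modulus one is a normalisation that gives the
  inverse of the subdifferential Lipschitz constant one.\<close>

definition strong_subgradient :: "('a::real_inner \<Rightarrow> real) \<Rightarrow> 'a \<Rightarrow> 'a \<Rightarrow> bool" where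
  "strong_subgradient F q z \<longleftrightarrow> (\<forall>z'. F z + q \<bullet> (z' - z) + (norm (z' - z))\<^sup>2 / 2 \<le> F z')"

lemma strong_subgradientD:
  "strong_subgradient F q z \<Longrightarrow> F z + q \<bullet> (z' - z) + (norm (z' - z))\<^sup>2 / 2 \<le> F z'"
  by (simp add: strong_subgradient_def)

lemma strong_subgradient_affine:
  assumes "strong_subgradient F q z"
  shows "F z + q \<bullet> (z' - z) \<le> F z'"
proof -
  have "0 \<le> (norm (z' - z))\<^sup>2 / 2" by simp
  with strong_subgradientD[OF assms, of z'] show ?thesis by linarith
qed

text \<open>Adding the two inequalities, each tested at the other point, cancels the values of
  \<open>F\<close> and leaves strong monotonicity; Cauchy-Schwarz does the rest.\<close>

lemma strong_subgradient_nonexpansive: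
  assumes "strong_subgradient F q z" "strong_subgradient F q' z'"
  shows "norm (z - z') \<le> norm (q - q')"
proof -
  have "(norm (z - z'))\<^sup>2 \<le> (q - q') \<bullet> (z - z')"
    using strong_subgradientD[OF assms(1), of z'] strong_subgradientD[OF assms(2), of z]
    by (simp add: norm_minus_commute inner_simps)
  also have "\<dots> \<le> norm (q - q') * norm (z - z')" by (rule norm_cauchy_schwarz)
  finally have "norm (z - z') * norm (z - z') \<le> norm (q - q') * norm (z - z')" by (simp add: power2_eq_square)
  then show ?thesis by (cases "z = z'") (auto simp: mult_le_cancel_right)
qed

lemma strong_subgradient_unique:
  "strong_subgradient F q z \<Longrightarrow> strong_subgradient F q z' \<Longrightarrow> z = z'"
  using strong_subgradient_nonexpansive[of F q z q z'] by simp

text \<open>The point sought is the minimiser of \<open>F\<close> minus the linear function given by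
  \<open>q\<close>; the quadratic term of a strong subgradient at \<open>0\<close> makes this
  difference coercive.\<close>

lemma strong_subgradient_surj:
  fixes F :: "'a::euclidean_space \<Rightarrow> real"
  assumes cont: "continuous_on UNIV F" and sub: "\<And>z. \<exists>q. strong_subgradient F q z"
  shows "\<exists>z. strong_subgradient F q z"
proof -
  define G where "G z = F z - q \<bullet> z" for z
  have subG: "\<exists>p. \<forall>z'. G z + p \<bullet> (z' - z) + (norm (z' - z))\<^sup>2 / 2 \<le> G z'" for z
  proof -
    obtain p where "strong_subgradient F p z" using sub by blast
    then have "\<forall>z'. G z + (p - q) \<bullet> (z' - z) + (norm (z' - z))\<^sup>2 / 2 \<le> G z'"
      by (auto simp: strong_subgradient_def G_def inner_simps algebra_simps)
    then show ?thesis by blast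
  qed
  obtain p where p: "\<And>z'. G 0 + p \<bullet> z' + (norm z')\<^sup>2 / 2 \<le> G z'" using subG[of 0] by auto
  define R where "R = 2 * norm p"
  have far: "G 0 \<le> G z'" if "norm z' \<ge> R" for z'
  proof -
    have "- (norm p * norm z') \<le> p \<bullet> z'" using norm_cauchy_schwarz[of "-p" z'] by simp
    moreover have "norm p * norm z' \<le> (norm z')\<^sup>2 / 2"
      using that mult_right_mono[of R "norm z'" "norm z'"] by (simp add: R_def power2_eq_square)
    ultimately show ?thesis using p[of z'] by linarith
  qed
  have "continuous_on (cball 0 R) G" unfolding G_def
    by (intro continuous_intros continuous_on_subset[OF cont]) auto
  moreover have "R \<ge> 0" by (simp add: R_def)
  ultimately obtain z where z: "z \<in> cball 0 R" "\<forall>y\<in>cball 0 R. G z \<le> G y"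
    using continuous_attains_inf[of "cball 0 R" G] by auto
  have min: "G z \<le> G y" for y
  proof (cases "norm y \<le> R")
    case False
    then have "G 0 \<le> G y" using far by simp
    moreover have "G z \<le> G 0" using z(2) \<open>R \<ge> 0\<close> by simp
    ultimately show ?thesis by simp
  qed (use z in simp)
  \<comment> \<open>Minimality alone gives \<open>G z \<le> G y\<close>. The quadratic gain comes
    from a strong subgradient at a point \<open>w\<close> of the segment from \<open>z\<close> to
    \<open>y\<close>, as \<open>w\<close> approaches \<open>z\<close>.\<close>
  have "G z + (norm (y - z))\<^sup>2 / 2 \<le> G y" for y
  proof -
    have *: "(1 - t) * ((norm (y - z))\<^sup>2 / 2) \<le> G y - G z" if t: "0 < t" "t < 1" for t
    proof -
      define w where "w = z + t *\<^sub>R (y - z)"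
      obtain p where p: "\<And>z'. G w + p \<bullet> (z' - w) + (norm (z' - w))\<^sup>2 / 2 \<le> G z'" using subG[of w] by auto
      have e: "z - w = (- t) *\<^sub>R (y - z)" "y - w = (1 - t) *\<^sub>R (y - z)"
        by (simp_all add: w_def algebra_simps)
      have a: "G w - t * (p \<bullet> (y - z)) + t\<^sup>2 * (norm (y - z))\<^sup>2 / 2 \<le> G z"
        using p[of z] t unfolding e by (simp add: power_mult_distrib)
      have b: "G w + (1 - t) * (p \<bullet> (y - z)) + (1 - t)\<^sup>2 * (norm (y - z))\<^sup>2 / 2 \<le> G y"
        using p[of y] t unfolding e by (simp add: power_mult_distrib)
      \<comment> \<open>With the weights \<open>1 - t\<close> and \<open>t\<close> the terms in
        \<open>p\<close> cancel, and the quadratic ones combine to \<open>t * (1 - t)\<close> times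
        half the squared distance.\<close>
      have "(1 - t) * (G w - t * (p \<bullet> (y - z)) + t\<^sup>2 * (norm (y - z))\<^sup>2 / 2)
          + t * (G w + (1 - t) * (p \<bullet> (y - z)) + (1 - t)\<^sup>2 * (norm (y - z))\<^sup>2 / 2)
        \<le> (1 - t) * G z + t * G y"
        using t by (intro add_mono mult_left_mono a b) auto
      moreover have "(1 - t) * (G w - t * (p \<bullet> (y - z)) + t\<^sup>2 * (norm (y - z))\<^sup>2 / 2)
          + t * (G w + (1 - t) * (p \<bullet> (y - z)) + (1 - t)\<^sup>2 * (norm (y - z))\<^sup>2 / 2)
        = G w + t * ((1 - t) * ((norm (y - z))\<^sup>2 / 2))"
        by (simp add: field_simps power2_eq_square)
      ultimately have "G w + t * ((1 - t) * ((norm (y - z))\<^sup>2 / 2)) \<le> (1 - t) * G z + t * G y"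
        by linarith
      moreover have "(1 - t) * G z + t * G y = G z + t * (G y - G z)" by (simp add: algebra_simps)
      ultimately have "t * ((1 - t) * ((norm (y - z))\<^sup>2 / 2)) \<le> t * (G y - G z)"
        using min[of w] by linarith
      then show ?thesis using t by simp
    qed
    have "((\<lambda>t. (1 - t) * ((norm (y - z))\<^sup>2 / 2)) \<longlongrightarrow> (1 - 0) * ((norm (y - z))\<^sup>2 / 2)) (at_right 0)"
      by (intro tendsto_intros)
    moreover have "\<forall>\<^sub>F t in at_right 0. (1 - t) * ((norm (y - z))\<^sup>2 / 2) \<le> G y - G z"
      using * by (intro eventually_at_rightI[of 0 1]) auto
    ultimately have "(1 - 0) * ((norm (y - z))\<^sup>2 / 2) \<le> G y - G z"
      by (rule tendsto_upperbound) simp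
    then show ?thesis by simp
  qed
  then have "strong_subgradient F q z"
    by (auto simp: strong_subgradient_def G_def inner_simps algebra_simps)
  then show ?thesis by blast
qed

text \<open>Sum the subgradient inequalities over a fine partition of the segment from \<open>0\<close> to \<open>s\<close>.\<close>

lemma near_quadratic_of_near_linear_subgradient:
  fixes G :: "'a::real_inner \<Rightarrow> real"
  assumes G0: "G 0 = 0" and M: "linear M"
    and sub: "\<And>s s'. norm s \<le> 1 \<Longrightarrow> norm s' \<le> 1 \<Longrightarrow> G s + H s \<bullet> (s' - s) \<le> G s'"
    and near: "\<And>s. norm s \<le> 1 \<Longrightarrow> norm (H s - M s) \<le> d"
    and s: "norm s \<le> 1"
  shows "\<bar>G s - (M s \<bullet> s) / 2\<bar> \<le> d"
proof -
  define b where "b = M s \<bullet> s"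
  have ball: "norm (c *\<^sub>R s) \<le> 1" if "0 \<le> c" "c \<le> 1" for c
    using that s by (simp add: mult_le_one)
  have H: "\<bar>H (c *\<^sub>R s) \<bullet> s - c * b\<bar> \<le> d" if "0 \<le> c" "c \<le> 1" for c
  proof -
    have "H (c *\<^sub>R s) \<bullet> s - c * b = (H (c *\<^sub>R s) - M (c *\<^sub>R s)) \<bullet> s"
      by (simp add: b_def linear_scale[OF M] inner_simps)
    also have "\<bar>\<dots>\<bar> \<le> norm (H (c *\<^sub>R s) - M (c *\<^sub>R s)) * norm s" by (rule Cauchy_Schwarz_ineq2)
    also have "\<dots> \<le> d * 1"
      using near[OF ball[OF that]] s norm_ge_zero order_trans by (intro mult_mono) blast+
    finally show ?thesis by simp
  qed
  have bound: "\<bar>G s - b / 2\<bar> \<le> d + \<bar>b\<bar> / (2 * real n)" if n: "n > 0" for n :: nat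
  proof -
    define g where "g i = G ((real i / real n) *\<^sub>R s)" for i
    \<comment> \<open>Each of the \<open>n\<close> steps costs \<open>d / n\<close> because
      \<open>H\<close> is only near \<open>M\<close>, and \<open>\<bar>b\<bar> / (2 * n^2)\<close>
      because a slope is taken at an endpoint instead of the midpoint. The subgradient at the left
      end bounds the increment from below, the one at the right end from above.\<close>
    have "\<bar>g i - (real i / real n)\<^sup>2 * b / 2\<bar> \<le> (real i / real n) * d + real i * \<bar>b\<bar> / (2 * (real n)\<^sup>2)" if "i \<le> n" for i
      using that
    proof (induction i)
      case 0 show ?case by (simp add: g_def G0)
    next
      case (Suc i)
      define x y where "x = real i / real n" and "y = real (Suc i) / real n"
      have xy: "0 \<le> x" "x \<le> 1" "0 \<le> y" "y \<le> 1" "y - x = 1 / real n"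
        using Suc.prems n by (auto simp: x_def y_def divide_simps)
      have diff: "x *\<^sub>R s - y *\<^sub>R s = - ((1 / real n) *\<^sub>R s)" "y *\<^sub>R s - x *\<^sub>R s = (1 / real n) *\<^sub>R s"
        by (simp_all only: xy(5)[symmetric] scaleR_diff_left minus_diff_eq)
      have g: "g i = G (x *\<^sub>R s)" "g (Suc i) = G (y *\<^sub>R s)"
        by (simp_all only: g_def x_def y_def)
      have up: "g (Suc i) \<le> g i + (1 / real n) * (H (y *\<^sub>R s) \<bullet> s)"
        using sub[OF ball[OF xy(3,4)] ball[OF xy(1,2)]]
        unfolding diff g inner_minus_right inner_scaleR_right by linarith
      have lo: "g i + (1 / real n) * (H (x *\<^sub>R s) \<bullet> s) \<le> g (Suc i)"
        using sub[OF ball[OF xy(1,2)] ball[OF xy(3,4)]]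
        unfolding diff g inner_scaleR_right by linarith
      have up': "g (Suc i) \<le> g i + (1 / real n) * (y * b + d)"
        using H[OF xy(3,4)] by (intro order_trans[OF up] add_left_mono mult_left_mono) auto
      have lo': "g i + (1 / real n) * (x * b - d) \<le> g (Suc i)"
        using H[OF xy(1,2)] by (intro order_trans[OF _ lo] add_left_mono mult_left_mono) auto
      define X Y A B E where "X = x\<^sup>2 * b / 2" and "Y = y\<^sup>2 * b / 2" and "A = b / (2 * (real n)\<^sup>2)"
        and "B = \<bar>b\<bar> / (2 * (real n)\<^sup>2)" and "E = d / real n"
      have e1: "(1 / real n) * (y * b + d) = Y - X + E + A"
        using n by (simp add: x_def y_def X_def Y_def A_def E_def field_simps power2_eq_square)
      have e2: "(1 / real n) * (x * b - d) = Y - X - E - A"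
        using n by (simp add: x_def y_def X_def Y_def A_def E_def field_simps power2_eq_square)
      define W where "W = x * d + real i * \<bar>b\<bar> / (2 * (real n)\<^sup>2)"
      have e3: "y * d + real (Suc i) * \<bar>b\<bar> / (2 * (real n)\<^sup>2) = W + E + B"
        by (simp add: x_def y_def W_def E_def B_def add_divide_distrib algebra_simps)
      have "\<bar>A\<bar> \<le> B" by (simp add: A_def B_def)
      moreover have "\<bar>g i - X\<bar> \<le> W"
        using Suc by (simp add: x_def X_def W_def)
      ultimately have "\<bar>g (Suc i) - Y\<bar> \<le> W + E + B" using up' lo' unfolding e1 e2 by linarith
      then show ?case unfolding e3[symmetric] Y_def y_def .
    qed
    from this[of n] n show ?thesis by (simp add: g_def power2_eq_square field_simps)
  qed
  have "(\<lambda>n. d + \<bar>b\<bar> / 2 * inverse (real (Suc n))) \<longlonglongrightarrow> d + \<bar>b\<bar> / 2 * 0"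
    by (intro tendsto_intros LIMSEQ_inverse_real_of_nat)
  moreover have "\<bar>G s - b / 2\<bar> \<le> d + \<bar>b\<bar> / 2 * inverse (real (Suc n))" for n
    using bound[of "Suc n"] by (simp add: field_simps)
  ultimately have "\<bar>G s - b / 2\<bar> \<le> d + \<bar>b\<bar> / 2 * 0"
    by (intro LIMSEQ_le_const) auto
  then show ?thesis by (simp add: b_def)
qed

text \<open>The factor \<open>4^k\<close> is the inverse square of the scale, so the limit is half
  of a Hessian form; hence the comparisons with \<open>(M s \<bullet> s) / 2\<close>.\<close>

definition second_blowup :: "('a::real_inner \<Rightarrow> real) \<Rightarrow> 'a \<Rightarrow> 'a \<Rightarrow> nat \<Rightarrow> 'a \<Rightarrow> real" where
  "second_blowup F q z k s = 4^k * (F (z + (1/2)^k *\<^sub>R s) - F z - (1/2)^k * (q \<bullet> s))"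

text \<open>
  The map \<open>J\<close> inverts the subdifferential of \<open>F\<close>, so its blow-ups invert those of the subdifferential.
  The contact condition bounds the latter, which makes the limit \<open>L\<close> onto, hence invertible;
  \<open>M\<close> is its inverse.
\<close>

lemma second_blowup_quadratic:
  fixes F :: "'a::euclidean_space \<Rightarrow> real"
  assumes sub: "\<And>z. \<exists>q. strong_subgradient F q z" and J: "\<And>q. strong_subgradient F q (J q)"
    and L: "bounded_linear L"
    and conv: "\<And>K d. compact K \<Longrightarrow> d > 0 \<Longrightarrow> \<forall>\<^sub>F n in sequentially. \<forall>h\<in>K. norm (blowup J q (r n) h - L h) < d"
    and C: "C > 0" and contact: "\<And>s. F (J q + s) \<le> F (J q) + q \<bullet> s + C / 2 * (norm s)\<^sup>2"
  shows "\<exists>M. linear M \<and> (\<forall>d>0. \<forall>\<^sub>F n in sequentially. \<forall>s\<in>cball 0 1.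
    \<bar>second_blowup F q (J q) (r n) s - (M s \<bullet> s) / 2\<bar> \<le> d)"
proof -
  define G where "G = second_blowup F q (J q)"
  define t :: "nat \<Rightarrow> real" where "t k = (1/2)^k" for k
  have t: "t k > 0" "4^k * (t k)\<^sup>2 = 1" "4^k * t k = 2^k" "2^k * t k = 1" for k
  proof -
    show t: "2^k * t k = 1" "t k > 0" by (simp_all add: t_def power_one_over)
    have "(4::real)^k = 2^k * 2^k" by (simp flip: power_mult_distrib)
    then show "4^k * t k = 2^k" using t by simp
    then show "4^k * (t k)\<^sup>2 = 1" using t by (simp add: power2_eq_square mult.assoc[symmetric])
  qed
  have G: "G k s = 4^k * (F (J q + t k *\<^sub>R s) - F (J q) - t k * (q \<bullet> s))" for k s
    by (simp add: G_def second_blowup_def t_def)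
  have G0: "G k 0 = 0" for k by (simp add: G)
  have Gnn: "0 \<le> G k s" for k s
  proof -
    have "F (J q) + t k * (q \<bullet> s) \<le> F (J q + t k *\<^sub>R s)"
      using strong_subgradient_affine[OF J[of q], of "J q + t k *\<^sub>R s"] by simp
    then show ?thesis unfolding G by (intro mult_nonneg_nonneg) auto
  qed
  have Gub: "G k s \<le> C / 2 * (norm s)\<^sup>2" for k s
  proof -
    have "G k s \<le> 4^k * (C / 2 * (norm (t k *\<^sub>R s))\<^sup>2)"
      unfolding G using contact[of "t k *\<^sub>R s"] by (intro mult_left_mono) auto
    also have "\<dots> = (4^k * (t k)\<^sup>2) * (C / 2 * (norm s)\<^sup>2)" by (simp add: power_mult_distrib)
    finally show ?thesis by (simp only: t(2) mult_1)
  qed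
  \<comment> \<open>The rescaled \<open>p - q\<close> is a subgradient of \<open>G k\<close> at
    \<open>s\<close>, and since \<open>J\<close> sends \<open>p\<close> to the point where it is a
    subgradient, the blow-up of \<open>J\<close> sends it back to \<open>s\<close>. Any choice
    \<open>H\<close> of such subgradients will do.\<close>
  have "\<exists>h. blowup J q k h = s \<and> (\<forall>s'. G k s + h \<bullet> (s' - s) \<le> G k s')" for k s
  proof -
    obtain p where p: "strong_subgradient F p (J q + t k *\<^sub>R s)" using sub by blast
    define h where "h = 2^k *\<^sub>R (p - q)"
    have th: "t k *\<^sub>R h = p - q" using t(4)[of k] by (simp add: h_def mult.commute)
    have "J p = J q + t k *\<^sub>R s" by (rule strong_subgradient_unique[OF J p])
    then have "blowup J q k h = s" using th t(4)[of k]
      by (simp add: blowup_def t_def[symmetric])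
    moreover have "G k s + h \<bullet> (s' - s) \<le> G k s'" for s'
    proof -
      have "F (J q + t k *\<^sub>R s) + t k * (p \<bullet> (s' - s)) \<le> F (J q + t k *\<^sub>R s')"
      proof -
        have "J q + t k *\<^sub>R s' - (J q + t k *\<^sub>R s) = t k *\<^sub>R (s' - s)" by (simp add: algebra_simps)
        then show ?thesis using strong_subgradient_affine[OF p, of "J q + t k *\<^sub>R s'"] by simp
      qed
      then have "4^k * (F (J q + t k *\<^sub>R s) + t k * (p \<bullet> (s' - s)) - F (J q) - t k * (q \<bullet> s')) \<le> G k s'"
        unfolding G by (intro mult_left_mono) auto
      moreover have "4^k * (F (J q + t k *\<^sub>R s) + t k * (p \<bullet> (s' - s)) - F (J q) - t k * (q \<bullet> s'))
        = G k s + (4^k * t k) * ((p - q) \<bullet> (s' - s))"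
        unfolding G by (simp add: algebra_simps inner_simps)
      moreover have "(4^k * t k) * ((p - q) \<bullet> (s' - s)) = h \<bullet> (s' - s)"
        by (simp add: t(3) h_def)
      ultimately show ?thesis by simp
    qed
    ultimately show ?thesis by blast
  qed
  then obtain H where HJ: "\<And>k s. blowup J q k (H k s) = s"
    and HG: "\<And>k s s'. G k s + H k s \<bullet> (s' - s) \<le> G k s'" by metis
  have Hb: "norm (H k s) \<le> 2 * C * norm s" for k s
  proof -
    \<comment> \<open>The subgradient inequality is tested at \<open>s\<close> plus \<open>a\<close>
      times \<open>H k s\<close>. With this \<open>a\<close> the term \<open>C * a^2\<close> equals
      \<open>a / 2\<close>, so the left-hand side absorbs it.\<close>
    define a where "a = 1 / (2 * C)"
    have "a * (norm (H k s))\<^sup>2 \<le> C / 2 * (norm (s + a *\<^sub>R H k s))\<^sup>2"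
      using HG[of k s "s + a *\<^sub>R H k s"] Gnn[of k s] Gub[of k "s + a *\<^sub>R H k s"]
      by (simp add: power2_norm_eq_inner)
    also have "(norm (s + a *\<^sub>R H k s))\<^sup>2 \<le> 2 * (norm s)\<^sup>2 + 2 * (norm (a *\<^sub>R H k s))\<^sup>2"
    proof -
      have "0 \<le> (norm (s - a *\<^sub>R H k s))\<^sup>2" by simp
      then show ?thesis
        by (simp add: power2_norm_eq_inner inner_simps inner_commute algebra_simps power2_eq_square[of a])
    qed
    finally have "a * (norm (H k s))\<^sup>2 \<le> C * (norm s)\<^sup>2 + C * (a\<^sup>2 * (norm (H k s))\<^sup>2)"
      using C by (simp add: power_mult_distrib algebra_simps)
    then have "(norm (H k s))\<^sup>2 \<le> (2 * C * norm s)\<^sup>2"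
      using C by (simp add: a_def field_simps power2_eq_square)
    then show ?thesis by (rule power2_le_imp_le) (use C in simp)
  qed
  \<comment> \<open>All \<open>H k s\<close> with \<open>s\<close> in the unit ball lie in one ball
    of radius \<open>2 * C\<close>, where the blow-ups of \<open>J\<close> are uniformly close to
    \<open>L\<close>; there the blow-up of \<open>J\<close> at \<open>H k s\<close> is
    \<open>s\<close> itself.\<close>
  have near: "\<forall>\<^sub>F n in sequentially. \<forall>s\<in>cball 0 1. norm (s - L (H (r n) s)) < d" if d: "d > 0" for d
    using conv[OF compact_cball[of 0 "2 * C"] d]
  proof eventually_elim
    case (elim n)
    show ?case
    proof
      fix s :: 'a assume "s \<in> cball 0 1"
      then have "H (r n) s \<in> cball 0 (2 * C)"
        using order_trans[OF Hb[of "r n" s] mult_left_le[of "norm s" "2 * C"]] C by simp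
      from elim[rule_format, OF this] show "norm (s - L (H (r n) s)) < d" by (simp add: HJ)
    qed
  qed
  have lin: "linear L" by (simp add: L bounded_linear.linear)
  have ball: "s \<in> range L" if "norm s \<le> 1" for s
  proof -
    have "s \<in> closure (range L)"
      unfolding closure_approachable
    proof safe
      fix e :: real assume "e > 0"
      from eventually_happens'[OF _ near[OF this]] obtain n where "\<forall>s\<in>cball 0 1. norm (s - L (H (r n) s)) < e"
        by auto
      then have "dist (L (H (r n) s)) s < e" using that by (simp add: dist_norm norm_minus_commute)
      then show "\<exists>y\<in>range L. dist y s < e" by blast
    qed
    moreover have "closed (range L)"
      by (intro closed_subspace linear_subspace_image lin) auto
    ultimately show ?thesis by simp
  qed
  have "s \<in> range L" for s
  proof -
    have "norm ((1 / (norm s + 1)) *\<^sub>R s) \<le> 1" by (simp add: divide_le_eq_1 add_nonneg_pos)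
    then obtain x where "(1 / (norm s + 1)) *\<^sub>R s = L x" using ball by blast
    then have "L ((norm s + 1) *\<^sub>R x) = (norm s + 1) *\<^sub>R ((1 / (norm s + 1)) *\<^sub>R s)"
      by (simp only: linear_scale[OF lin])
    also have "\<dots> = s" by (simp add: add_nonneg_eq_0_iff)
    finally show ?thesis by (metis rangeI)
  qed
  then have "surj L" by blast
  then obtain M where M: "linear M" "\<And>x. M (L x) = x" "\<And>x. L (M x) = x"
    using linear_surjective_isomorphism[OF lin] by blast
  then obtain B where B: "B > 0" "\<And>x. norm (M x) \<le> norm x * B"
    using bounded_linear.pos_bounded[of M] by (auto simp: linear_conv_bounded_linear)
  have "\<forall>\<^sub>F n in sequentially. \<forall>s\<in>cball 0 1. \<bar>G (r n) s - (M s \<bullet> s) / 2\<bar> \<le> d" if d: "d > 0" for d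
    using near[OF divide_pos_pos[OF d B(1)]]
  proof eventually_elim
    case (elim n)
    have "norm (H (r n) s - M s) \<le> d" if "norm s \<le> 1" for s
    proof -
      have "H (r n) s - M s = - M (s - L (H (r n) s))" by (simp add: linear_diff[OF M(1)] M(2))
      then have "norm (H (r n) s - M s) \<le> norm (s - L (H (r n) s)) * B" using B(2) by simp
      also have "\<dots> \<le> d / B * B" using elim that B(1) by (intro mult_right_mono) (auto simp: less_imp_le)
      finally show ?thesis using B(1) by simp
    qed
    then show ?case
      using near_quadratic_of_near_linear_subgradient[of "G (r n)" M "H (r n)" d] G0 M(1) HG by auto
  qed
  then show ?thesis using M(1) unfolding G_def by blast
qed

section \<open>Second order behaviour near a maximum\<close>

lemma linear_le_quadratic_imp_zero:
  fixes v :: "'a::real_inner"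
  assumes d: "d > 0" and le: "\<And>k. norm k < d \<Longrightarrow> v \<bullet> k \<le> C * (norm k)\<^sup>2"
  shows "v = 0"
proof (rule ccontr)
  assume v: "v \<noteq> 0"
  define a where "a = min (d / (2 * norm v)) (1 / (2 * (\<bar>C\<bar> + 1)))"
  have a: "a > 0" using v d by (simp add: a_def)
  have "a * norm v \<le> d / (2 * norm v) * norm v" by (intro mult_right_mono) (auto simp: a_def)
  then have "norm (a *\<^sub>R v) < d" using v d a by simp
  from le[OF this] have "a * (norm v)\<^sup>2 \<le> (a * C) * (a * (norm v)\<^sup>2)"
    by (simp add: power2_norm_eq_inner power_mult_distrib power2_eq_square[of a] algebra_simps)
  moreover have "a * C < 1"
  proof -
    have "a * C \<le> a * \<bar>C\<bar>" using a by (intro mult_left_mono) auto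
    also have "\<dots> \<le> 1 / (2 * (\<bar>C\<bar> + 1)) * \<bar>C\<bar>" by (intro mult_right_mono) (auto simp: a_def)
    also have "\<dots> < 1" by (simp add: divide_simps)
    finally show ?thesis .
  qed
  then have "(a * C) * (a * (norm v)\<^sup>2) < 1 * (a * (norm v)\<^sup>2)"
    using a v by (intro mult_strict_right_mono) auto
  ultimately show False by simp
qed

text \<open>
  Jensen's lemma combined with a weak form of Alexandrov's theorem. Tilting by \<open>p\<close> moves the maximum to a point
  \<open>J q\<close>, and \<open>p\<close> is a Lipschitz function of \<open>q\<close>; so the set of tilts that lead to a bad \<open>q\<close> is null.
\<close>

theorem perturbed_maximum_second_order:
  fixes F :: "'a::euclidean_space \<Rightarrow> real"
  assumes cont: "continuous_on UNIV F" and sub: "\<And>z. \<exists>q. strong_subgradient F q z"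
    and T: "linear T" and sym: "\<And>x y. T x \<bullet> y = x \<bullet> T y"
    and max: "\<And>z. F z - (T z \<bullet> z) / 2 \<le> F z0 - (T z0 \<bullet> z0) / 2"
    and \<kappa>: "\<kappa> > 0" and \<delta>: "\<delta> > 0"
  obtains z q M r where "norm (z - z0) \<le> \<delta>" "norm (q - T z) \<le> \<delta>"
    "linear M" "\<And>s. (norm s)\<^sup>2 \<le> M s \<bullet> s" "\<And>s. M s \<bullet> s \<le> T s \<bullet> s + \<kappa> * (norm s)\<^sup>2"
    "strict_mono (r :: nat \<Rightarrow> nat)"
    "\<And>d. d > 0 \<Longrightarrow> \<forall>\<^sub>F n in sequentially. \<forall>s\<in>cball 0 1.
      \<bar>second_blowup F q z (r n) s - (M s \<bullet> s) / 2\<bar> \<le> d"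
proof -
  obtain J where J: "\<And>q. strong_subgradient F q (J q)"
    using strong_subgradient_surj[OF cont sub] by metis
  have Jlip: "norm (J x - J y) \<le> 1 * norm (x - y)" for x y
    using strong_subgradient_nonexpansive[OF J J] by simp
  define good where "good q \<longleftrightarrow> (\<exists>r L. strict_mono r \<and> bounded_linear L \<and>
    (\<forall>K d. compact K \<longrightarrow> d > 0 \<longrightarrow> (\<forall>\<^sub>F n in sequentially. \<forall>h\<in>K. norm (blowup J q (r n) h - L h) < d)))" for q
  have "AE q in lborel. good q"
    unfolding good_def by (rule AE_blowup_subsequence_linear[of J 1, OF Jlip])
  then have "AE q in lebesgue. good q" by (rule AE_completion)
  then have neg: "negligible {q. \<not> good q}"
    by (auto simp: eventually_ae_filter_negligible intro: negligible_subset)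
  obtain B where B: "B > 0" "\<And>x. norm (T x) \<le> norm x * B"
    using bounded_linear.pos_bounded[of T] T by (auto simp: linear_conv_bounded_linear)
  have TB: "T s \<bullet> s \<le> B * (norm s)\<^sup>2" for s
    using order_trans[OF norm_cauchy_schwarz[of "T s" s] mult_right_mono[OF B(2)[of s], of "norm s"]]
    by (simp add: power2_eq_square ac_simps)
  \<comment> \<open>At a maximum \<open>z\<close> of the tilted function \<open>W\<close> below,
    gradients balance: \<open>q\<close> is \<open>T z\<close> plus \<open>\<kappa>\<close> times
    \<open>z - z0\<close> plus the tilt \<open>p\<close>. With \<open>z = J q\<close>, the map
    \<open>\<Psi>\<close> solves this for \<open>p\<close>.\<close>
  define \<Psi> where "\<Psi> q = q - T (J q) - \<kappa> *\<^sub>R (J q - z0)" for q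
  have \<Psi>lip: "norm (\<Psi> y - \<Psi> x) \<le> (1 + B + \<kappa>) * norm (y - x)" for x y
  proof -
    have "\<Psi> y - \<Psi> x = (y - x) - (T (J y - J x) + \<kappa> *\<^sub>R (J y - J x))"
      by (simp add: \<Psi>_def linear_diff[OF T] algebra_simps)
    then have "norm (\<Psi> y - \<Psi> x) \<le> norm (y - x) + (norm (T (J y - J x)) + norm (\<kappa> *\<^sub>R (J y - J x)))"
      by (simp only:) (intro order_trans[OF norm_triangle_ineq4] add_left_mono norm_triangle_ineq)
    also have "\<dots> \<le> norm (y - x) + (norm (y - x) * B + \<kappa> * norm (y - x))"
    proof (intro add_mono order_refl)
      show "norm (T (J y - J x)) \<le> norm (y - x) * B"
        using Jlip[of y x] B(1) by (intro order_trans[OF B(2)] mult_right_mono) auto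
      show "norm (\<kappa> *\<^sub>R (J y - J x)) \<le> \<kappa> * norm (y - x)"
        using Jlip[of y x] \<kappa> by simp
    qed
    finally show ?thesis by (simp add: algebra_simps)
  qed
  have neg\<Psi>: "negligible (\<Psi> ` {q. \<not> good q})"
    using \<Psi>lip by (intro negligible_locally_Lipschitz_image neg) (auto intro!: exI[of _ UNIV])
  \<comment> \<open>The maximiser will lie within \<open>2 * norm p / \<kappa>\<close> of
    \<open>z0\<close>, and \<open>q - T z\<close> will have norm at most \<open>3 * norm p\<close>;
    the two entries of the minimum keep both below \<open>\<delta>\<close>.\<close>
  define \<epsilon> where "\<epsilon> = min (\<kappa> * \<delta> / 2) (\<delta> / 3)"
  have \<epsilon>: "\<epsilon> > 0" "2 * \<epsilon> / \<kappa> \<le> \<delta>" "3 * \<epsilon> \<le> \<delta>"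
    using \<kappa> \<delta> by (auto simp: \<epsilon>_def field_simps min_def)
  have "\<not> ball 0 \<epsilon> \<subseteq> \<Psi> ` {q. \<not> good q}"
    using open_not_negligible[of "ball (0::'a) \<epsilon>"] \<epsilon>(1) negligible_subset[OF neg\<Psi>] by auto
  then obtain p where p: "norm p < \<epsilon>" "p \<notin> \<Psi> ` {q. \<not> good q}" by (metis mem_ball_0 subsetI)
  \<comment> \<open>The term with \<open>\<kappa>\<close> makes the maximum at \<open>z0\<close>
    strict, which confines the maximisers after tilting to a small ball. Its price is the
    \<open>\<kappa>\<close> in the upper bound for \<open>M\<close>.\<close>
  define W where "W z = F z - (T z \<bullet> z) / 2 - \<kappa> / 2 * (norm (z - z0))\<^sup>2 - p \<bullet> (z - z0)" for z
  define \<rho> where "\<rho> = 2 * norm p / \<kappa>"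
  have \<rho>: "\<rho> \<ge> 0" using \<kappa> by (simp add: \<rho>_def)
  have far: "W z \<le> W z0" if "norm (z - z0) \<ge> \<rho>" for z
  proof -
    have "- (p \<bullet> (z - z0)) \<le> norm p * norm (z - z0)" using norm_cauchy_schwarz[of "-p" "z - z0"] by simp
    also have "\<dots> \<le> \<kappa> / 2 * norm (z - z0) * norm (z - z0)"
      using that \<kappa> by (intro mult_right_mono) (auto simp: \<rho>_def field_simps)
    finally show ?thesis using max[of z] by (simp add: W_def power2_eq_square)
  qed
  have "continuous_on (cball z0 \<rho>) W" unfolding W_def
    by (intro continuous_intros continuous_on_subset[OF cont] linear_continuous_on T[unfolded linear_conv_bounded_linear]) auto
  then obtain z where z: "z \<in> cball z0 \<rho>" "\<forall>y\<in>cball z0 \<rho>. W y \<le> W z"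
    using continuous_attains_sup[of "cball z0 \<rho>" W] \<rho> by auto
  have Wmax: "W y \<le> W z" for y
  proof (cases "norm (y - z0) \<le> \<rho>")
    case True then show ?thesis using z(2) by (simp add: dist_norm norm_minus_commute)
  next
    case False
    then have "W y \<le> W z0" using far by simp
    moreover have "W z0 \<le> W z" using z(2) \<rho> by simp
    ultimately show ?thesis by simp
  qed
  define q where "q = T z + \<kappa> *\<^sub>R (z - z0) + p"
  have contact: "F (z + s) \<le> F z + q \<bullet> s + (T s \<bullet> s + \<kappa> * (norm s)\<^sup>2) / 2" for s
  proof -
    have a: "T (z + s) \<bullet> (z + s) = T z \<bullet> z + 2 * (T z \<bullet> s) + T s \<bullet> s"
      using sym[of s z] by (simp add: linear_add[OF T] inner_simps inner_commute)
    have b: "(norm (z + s - z0))\<^sup>2 = (norm (z - z0))\<^sup>2 + 2 * ((z - z0) \<bullet> s) + (norm s)\<^sup>2"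
      by (simp add: power2_norm_eq_inner inner_simps inner_commute)
    have c: "p \<bullet> (z + s - z0) = p \<bullet> (z - z0) + p \<bullet> s" by (simp add: inner_simps)
    have "q \<bullet> s = T z \<bullet> s + \<kappa> * ((z - z0) \<bullet> s) + p \<bullet> s"
      by (simp add: q_def inner_simps)
    then show ?thesis using Wmax[of "z + s"] unfolding W_def a b c
      by (simp add: field_simps)
  qed
  have contact': "F (z + s) \<le> F z + q \<bullet> s + (B + \<kappa>) / 2 * (norm s)\<^sup>2" for s
    using contact[of s] TB[of s] by (simp add: algebra_simps add_divide_distrib)
  \<comment> \<open>Some strong subgradient \<open>q'\<close> exists at \<open>z\<close>, and the
    contact from above leaves no choice for it but \<open>q\<close>.\<close>
  have sz: "strong_subgradient F q z"
  proof -
    obtain q' where q': "strong_subgradient F q' z" using sub by blast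
    have "(q' - q) \<bullet> s \<le> (B + \<kappa>) / 2 * (norm s)\<^sup>2" for s
      using contact'[of s] strong_subgradient_affine[OF q', of "z + s"] by (simp add: inner_simps)
    then have "q' - q = 0" by (rule linear_le_quadratic_imp_zero[OF zero_less_one])
    then show ?thesis using q' by simp
  qed
  then have Jq: "J q = z" using strong_subgradient_unique[OF J] by blast
  have "\<Psi> q = p" unfolding \<Psi>_def Jq by (simp add: q_def)
  then have "good q" using p(2) by blast
  then obtain r L where r: "strict_mono r" "bounded_linear L"
    "\<And>K d. compact K \<Longrightarrow> d > 0 \<Longrightarrow> \<forall>\<^sub>F n in sequentially. \<forall>h\<in>K. norm (blowup J q (r n) h - L h) < d"
    unfolding good_def by blast
  obtain M where M: "linear M" "\<And>d. d > 0 \<Longrightarrow> \<forall>\<^sub>F n in sequentially. \<forall>s\<in>cball 0 1.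
    \<bar>second_blowup F q z (r n) s - (M s \<bullet> s) / 2\<bar> \<le> d"
    using second_blowup_quadratic[OF sub J r(2,3), of "B + \<kappa>"] contact' B(1) \<kappa> unfolding Jq by auto
  have t: "(4::real)^k * ((1/2)^k)\<^sup>2 = 1" for k :: nat
  proof -
    have "(4::real)^k = 2^k * 2^k" by (simp flip: power_mult_distrib)
    then show ?thesis by (simp add: power2_eq_square power_one_over)
  qed
  have lo: "(norm s)\<^sup>2 / 2 \<le> second_blowup F q z k s" for k s
  proof -
    have "4^k * ((norm ((1/2)^k *\<^sub>R s))\<^sup>2 / 2) \<le> second_blowup F q z k s"
      unfolding second_blowup_def using strong_subgradientD[OF sz, of "z + (1/2)^k *\<^sub>R s"]
      by (intro mult_left_mono) auto
    moreover have "4^k * ((norm ((1/2)^k *\<^sub>R s))\<^sup>2 / 2) = (4^k * ((1/2)^k)\<^sup>2) * ((norm s)\<^sup>2 / 2)"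
      by (simp add: power_mult_distrib)
    ultimately show ?thesis by (simp only: t mult_1)
  qed
  have up: "second_blowup F q z k s \<le> (T s \<bullet> s + \<kappa> * (norm s)\<^sup>2) / 2" for k s
  proof -
    define s' where "s' = (1/2)^k *\<^sub>R s"
    have "second_blowup F q z k s \<le> 4^k * ((T s' \<bullet> s' + \<kappa> * (norm s')\<^sup>2) / 2)"
    proof -
      have "q \<bullet> s' = (1/2)^k * (q \<bullet> s)" by (simp add: s'_def)
      then have "F (z + s') - F z - (1/2)^k * (q \<bullet> s) \<le> (T s' \<bullet> s' + \<kappa> * (norm s')\<^sup>2) / 2"
        using contact[of s'] by linarith
      then show ?thesis unfolding second_blowup_def s'_def[symmetric]
        by (intro mult_left_mono) auto
    qed
    moreover have "4^k * ((T s' \<bullet> s' + \<kappa> * (norm s')\<^sup>2) / 2) = (4^k * ((1/2)^k)\<^sup>2) * ((T s \<bullet> s + \<kappa> * (norm s)\<^sup>2) / 2)"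
      by (simp add: s'_def linear_scale[OF T] power_mult_distrib power2_eq_square algebra_simps)
    ultimately show ?thesis by (simp only: t mult_1)
  qed
  have lim: "(\<lambda>n. second_blowup F q z (r n) s) \<longlonglongrightarrow> (M s \<bullet> s) / 2" if "norm s \<le> 1" for s
  proof (rule LIMSEQ_I)
    fix e :: real assume "e > 0"
    have "\<forall>\<^sub>F n in sequentially. norm (second_blowup F q z (r n) s - (M s \<bullet> s) / 2) < e"
      using M(2)[OF half_gt_zero[OF \<open>e > 0\<close>]]
    proof eventually_elim
      case (elim n)
      from elim[rule_format, of s] that \<open>e > 0\<close> show ?case by simp
    qed
    then show "\<exists>N. \<forall>n\<ge>N. norm (second_blowup F q z (r n) s - (M s \<bullet> s) / 2) < e"
      by (simp add: eventually_sequentially)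
  qed
  have ball: "(norm s)\<^sup>2 \<le> M s \<bullet> s \<and> M s \<bullet> s \<le> T s \<bullet> s + \<kappa> * (norm s)\<^sup>2" if "norm s \<le> 1" for s
    using LIMSEQ_le_const[OF lim[OF that], of "(norm s)\<^sup>2 / 2"] LIMSEQ_le_const2[OF lim[OF that], of "(T s \<bullet> s + \<kappa> * (norm s)\<^sup>2) / 2"]
      lo[of s] up[of _ s] by auto
  have Mb: "(norm s)\<^sup>2 \<le> M s \<bullet> s \<and> M s \<bullet> s \<le> T s \<bullet> s + \<kappa> * (norm s)\<^sup>2" for s
  proof -
    define c where "c = 1 / (norm s + 1)"
    have c: "c > 0" by (simp add: c_def add_nonneg_pos)
    have "norm (c *\<^sub>R s) \<le> 1" by (simp add: c_def divide_le_eq_1 add_nonneg_pos)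
    from ball[OF this] c have "c\<^sup>2 * (norm s)\<^sup>2 \<le> c\<^sup>2 * (M s \<bullet> s) \<and> c\<^sup>2 * (M s \<bullet> s) \<le> c\<^sup>2 * (T s \<bullet> s + \<kappa> * (norm s)\<^sup>2)"
      by (simp add: linear_scale[OF T] linear_scale[OF M(1)] power_mult_distrib power2_eq_square algebra_simps)
    then show ?thesis using c by simp
  qed
  have "norm (z - z0) \<le> \<rho>" using z(1) by (simp add: dist_norm norm_minus_commute)
  then have zz: "norm (z - z0) \<le> 2 * norm p / \<kappa>" by (simp add: \<rho>_def)
  also have "\<dots> \<le> 2 * \<epsilon> / \<kappa>" using p(1) \<kappa> by (intro divide_right_mono) auto
  finally have "norm (z - z0) \<le> \<delta>" using \<epsilon>(2) by simp
  moreover have "norm (q - T z) \<le> \<delta>"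
  proof -
    have "norm (q - T z) \<le> norm (\<kappa> *\<^sub>R (z - z0)) + norm p"
      by (simp add: q_def add.assoc) (rule norm_triangle_le, simp)
    also have "norm (\<kappa> *\<^sub>R (z - z0)) = \<kappa> * norm (z - z0)" using \<kappa> by simp
    also have "\<kappa> * norm (z - z0) \<le> 2 * norm p" using zz \<kappa> by (simp add: field_simps)
    finally show ?thesis using p(1) \<epsilon>(3) by linarith
  qed
  ultimately show ?thesis using that M(1) Mb r(1) M(2) by blast
qed

section \<open>Semicontinuity and sup-convolution\<close>

lemma usc_on_dist:
  fixes f :: "'a::metric_space \<Rightarrow> real"
  assumes "usc_on S f" "x \<in> S" "f x < a"
  obtains d where "d > 0" "\<And>y. y \<in> S \<Longrightarrow> dist y x < d \<Longrightarrow> f y < a"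
proof -
  have "\<forall>\<^sub>F y in at x within S. f y < a" using assms by (simp add: usc_on_def)
  then obtain d where "d > 0" "\<forall>y\<in>S. y \<noteq> x \<and> dist y x < d \<longrightarrow> f y < a"
    by (auto simp: eventually_at)
  then show thesis using assms(3) by (intro that) auto
qed

text \<open>If every \<open>x\<close> were beaten by some \<open>g x\<close>, the same
  \<open>g x\<close> would beat a neighbourhood of \<open>x\<close>. Finitely many neighbourhoods
  cover \<open>K\<close>, and the best of their finitely many \<open>g x\<close> would beat
  itself.\<close>

lemma usc_on_attains_sup:
  fixes f :: "'a::metric_space \<Rightarrow> real"
  assumes K: "compact K" "K \<noteq> {}" and f: "usc_on K f"
  shows "\<exists>x\<in>K. \<forall>y\<in>K. f y \<le> f x"
proof (rule ccontr)
  assume "\<not> ?thesis"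
  then have "\<forall>x\<in>K. \<exists>y\<in>K. f x < f y" by (auto simp: not_le)
  then obtain g where g: "\<And>x. x \<in> K \<Longrightarrow> g x \<in> K" "\<And>x. x \<in> K \<Longrightarrow> f x < f (g x)" by metis
  have "\<forall>x\<in>K. \<exists>d>0. \<forall>y\<in>K. dist y x < d \<longrightarrow> f y < f (g x)"
    using usc_on_dist[OF f _ g(2)] by metis
  then obtain d where d: "\<And>x. x \<in> K \<Longrightarrow> d x > 0"
    "\<And>x y. x \<in> K \<Longrightarrow> y \<in> K \<Longrightarrow> dist y x < d x \<Longrightarrow> f y < f (g x)" by metis
  obtain A where A: "A \<subseteq> K" "finite A" "K \<subseteq> (\<Union>x\<in>A. ball x (d x))"
    using compactE_image[OF K(1), of K "\<lambda>x. ball x (d x)"] d(1)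
    by (metis (no_types, lifting) UN_I centre_in_ball open_ball subsetI)
  have "A \<noteq> {}" using A(3) K(2) by auto
  define m where "m = Max ((\<lambda>x. f (g x)) ` A)"
  have "m \<in> (\<lambda>x. f (g x)) ` A" unfolding m_def by (intro Max_in) (use A \<open>A \<noteq> {}\<close> in auto)
  then obtain x where x: "x \<in> A" "m = f (g x)" by auto
  then obtain y where y: "y \<in> A" "dist y (g x) < d y" using A g(1)[of x] by fastforce
  have "f (g x) < f (g y)" using d(2)[of y "g x"] y x A g(1) by (auto simp: dist_commute)
  also have "\<dots> \<le> m" unfolding m_def by (intro Max_ge) (use A y in auto)
  finally show False using x by simp
qed

lemma continuous_on_imp_usc_on:
  "continuous_on S f \<Longrightarrow> usc_on S f"
  unfolding usc_on_def continuous_on_def by (blast intro: order_tendstoD(2))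

lemma usc_on_add:
  fixes f g :: "'a::topological_space \<Rightarrow> real"
  assumes "usc_on S f" "usc_on S g"
  shows "usc_on S (\<lambda>x. f x + g x)"
  unfolding usc_on_def
proof (intro ballI allI impI)
  fix x a assume x: "x \<in> S" and a: "f x + g x < a"
  define e where "e = (a - f x - g x) / 2"
  have "\<forall>\<^sub>F y in at x within S. f y < f x + e" "\<forall>\<^sub>F y in at x within S. g y < g x + e"
    using assms x a by (auto simp: usc_on_def e_def)
  then show "\<forall>\<^sub>F y in at x within S. f y + g y < a"
    by eventually_elim (simp add: e_def field_simps)
qed

lemma usc_on_compose:
  fixes f :: "'a::metric_space \<Rightarrow> real" and g :: "'b::metric_space \<Rightarrow> 'a"
  assumes f: "usc_on S f" and g: "continuous_on T g" "g ` T \<subseteq> S"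
  shows "usc_on T (\<lambda>x. f (g x))"
  unfolding usc_on_def
proof (intro ballI allI impI)
  fix x a assume x: "x \<in> T" and a: "f (g x) < a"
  then obtain d where d: "d > 0" "\<And>y. y \<in> S \<Longrightarrow> dist y (g x) < d \<Longrightarrow> f y < a"
    using usc_on_dist[OF f, of "g x" a] g by blast
  have "\<forall>\<^sub>F y in at x within T. dist (g y) (g x) < d"
    using g(1) x d(1) by (auto simp: continuous_on_def tendsto_iff)
  moreover have "\<forall>\<^sub>F y in at x within T. y \<in> T" by (simp add: eventually_at_filter)
  ultimately show "\<forall>\<^sub>F y in at x within T. f (g y) < a"
    by eventually_elim (use d g in auto)
qed

text \<open>The supremum runs over \<open>K\<close> only, while \<open>\<xi>\<close> ranges over the
  whole space. For compact \<open>K\<close> the result is finite and continuous everywhere, so no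
  boundary enters the second order analysis.\<close>

definition sup_convolution :: "real \<Rightarrow> 'a set \<Rightarrow> ('a \<Rightarrow> real) \<Rightarrow> 'a::euclidean_space \<Rightarrow> real" where
  "sup_convolution l K u \<xi> = (SUP x\<in>K. u x - l / 2 * (norm (x - \<xi>))\<^sup>2)"

context
  fixes K :: "'a::euclidean_space set" and u :: "'a \<Rightarrow> real" and l :: real
  assumes K: "compact K" "K \<noteq> {}" and u: "usc_on K u" and l: "l > 0"
begin

lemma sup_convolution_attained:
  obtains x where "x \<in> K" "sup_convolution l K u \<xi> = u x - l / 2 * (norm (x - \<xi>))\<^sup>2"
    "\<And>y. y \<in> K \<Longrightarrow> u y - l / 2 * (norm (y - \<xi>))\<^sup>2 \<le> sup_convolution l K u \<xi>"
proof -
  have "usc_on K (\<lambda>x. u x + - (l / 2 * (norm (x - \<xi>))\<^sup>2))"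
    by (intro usc_on_add u continuous_on_imp_usc_on continuous_intros)
  from usc_on_attains_sup[OF K this] obtain x where
    x: "x \<in> K" "\<And>y. y \<in> K \<Longrightarrow> u y - l / 2 * (norm (y - \<xi>))\<^sup>2 \<le> u x - l / 2 * (norm (x - \<xi>))\<^sup>2"
    by auto
  then have "sup_convolution l K u \<xi> = u x - l / 2 * (norm (x - \<xi>))\<^sup>2"
    unfolding sup_convolution_def by (intro cSup_eq_maximum) auto
  with x show thesis by (intro that) auto
qed

lemma sup_convolution_upper:
  "y \<in> K \<Longrightarrow> u y - l / 2 * (norm (y - \<xi>))\<^sup>2 \<le> sup_convolution l K u \<xi>"
  by (rule sup_convolution_attained) blast

text \<open>The maximiser \<open>x\<close> for \<open>\<xi>\<close> remains a competitor at
  \<open>\<xi> + h\<close>. This yields semiconvexity and also identifies \<open>l\<close> times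
  \<open>x - \<xi>\<close> as the only possible gradient at \<open>\<xi>\<close>.\<close>

lemma sup_convolution_lower_parabola:
  assumes "x \<in> K" "sup_convolution l K u \<xi> = u x - l / 2 * (norm (x - \<xi>))\<^sup>2"
  shows "sup_convolution l K u \<xi> + l * ((x - \<xi>) \<bullet> h) - l / 2 * (norm h)\<^sup>2 \<le> sup_convolution l K u (\<xi> + h)"
proof -
  have eq: "(norm (x - (\<xi> + h)))\<^sup>2 = (norm (x - \<xi>))\<^sup>2 - 2 * ((x - \<xi>) \<bullet> h) + (norm h)\<^sup>2"
    by (simp add: power2_norm_eq_inner inner_simps inner_commute algebra_simps)
  show ?thesis using sup_convolution_upper[OF assms(1), of "\<xi> + h"] unfolding assms(2) eq
    by (simp add: field_simps del: inner_diff_left)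
qed

text \<open>Of the factor \<open>l + 1\<close>, the part \<open>l\<close> offsets the concave
  parabola from below and the remaining \<open>1\<close> supplies the modulus. The subgradient is
  \<open>l\<close> times \<open>x - \<xi>\<close> plus \<open>l + 1\<close> times
  \<open>\<xi>\<close>, for a maximiser \<open>x\<close>.\<close>

lemma sup_convolution_strong_subgradient:
  "\<exists>q. strong_subgradient (\<lambda>\<xi>. sup_convolution l K u \<xi> + (l + 1) / 2 * (norm \<xi>)\<^sup>2) q \<xi>"
proof -
  obtain x where x: "x \<in> K" "sup_convolution l K u \<xi> = u x - l / 2 * (norm (x - \<xi>))\<^sup>2"
    using sup_convolution_attained by metis
  have "sup_convolution l K u \<xi> + (l + 1) / 2 * (norm \<xi>)\<^sup>2 + (l *\<^sub>R x + \<xi>) \<bullet> (z - \<xi>) + (norm (z - \<xi>))\<^sup>2 / 2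
     \<le> sup_convolution l K u z + (l + 1) / 2 * (norm z)\<^sup>2" for z
  proof -
    define h where "h = z - \<xi>"
    have z: "z = \<xi> + h" by (simp add: h_def)
    have "(norm z)\<^sup>2 = (norm \<xi>)\<^sup>2 + 2 * (\<xi> \<bullet> h) + (norm h)\<^sup>2"
      unfolding z by (simp add: power2_norm_eq_inner inner_simps inner_commute)
    moreover have "(l *\<^sub>R x + \<xi>) \<bullet> h = l * ((x - \<xi>) \<bullet> h) + (l + 1) * (\<xi> \<bullet> h)"
      by (simp add: inner_simps algebra_simps)
    ultimately show ?thesis
      using sup_convolution_lower_parabola[OF x, of h] unfolding z[symmetric] h_def[symmetric]
      by (simp add: field_simps)
  qed
  then show ?thesis by (auto simp: strong_subgradient_def)
qed

text \<open>After adding \<open>l / 2\<close> times the squared norm, what remains is a supremum of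
  affine functions of \<open>\<xi>\<close> with slopes \<open>l\<close> times \<open>x\<close>, and
  these are bounded because \<open>K\<close> is.\<close>

lemma continuous_on_sup_convolution: "continuous_on UNIV (sup_convolution l K u)"
proof -
  obtain B where B: "\<And>x. x \<in> K \<Longrightarrow> norm x \<le> B" "B > 0"
    using compact_imp_bounded[OF K(1)] by (auto simp: bounded_pos)
  define f where "f \<xi> = sup_convolution l K u \<xi> + l / 2 * (norm \<xi>)\<^sup>2" for \<xi>
  have le: "f \<xi> - f z \<le> l * B * norm (\<xi> - z)" for \<xi> z
  proof -
    obtain x where x: "x \<in> K" "sup_convolution l K u \<xi> = u x - l / 2 * (norm (x - \<xi>))\<^sup>2"
      using sup_convolution_attained by metis
    define h where "h = z - \<xi>"
    have z: "z = \<xi> + h" by (simp add: h_def)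
    have "(norm z)\<^sup>2 = (norm \<xi>)\<^sup>2 + 2 * (\<xi> \<bullet> h) + (norm h)\<^sup>2"
      unfolding z by (simp add: power2_norm_eq_inner inner_simps inner_commute)
    then have "f \<xi> + l * (x \<bullet> h) \<le> f z"
      using sup_convolution_lower_parabola[OF x, of h] unfolding z[symmetric] f_def
      by (simp add: field_simps inner_simps)
    moreover have "- (x \<bullet> h) \<le> B * norm h"
      using norm_cauchy_schwarz[of "- x" h] mult_right_mono[OF B(1)[OF x(1)], of "norm h"] by simp
    then have "l * - (x \<bullet> h) \<le> l * (B * norm h)" using l by (intro mult_left_mono) auto
    ultimately show ?thesis by (simp add: h_def norm_minus_commute)
  qed
  have "(l * B)-lipschitz_on UNIV f"
    using le l B(2) by (intro lipschitz_onI) (auto simp: dist_norm abs_le_iff, metis norm_minus_commute)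
  then have "continuous_on UNIV (\<lambda>\<xi>. f \<xi> - l / 2 * (norm \<xi>)\<^sup>2)"
    by (intro continuous_intros lipschitz_on_continuous_on)
  then show ?thesis by (simp add: f_def)
qed

end

section \<open>Superjets and symmetric matrices\<close>

lemma superjetI:
  fixes X :: "real^'n^'n"
  assumes "X \<in> sym_mats" "d > 0"
    and "\<And>y. y \<in> S \<Longrightarrow> norm (y - x) < d \<Longrightarrow> u y \<le> u x + p \<bullet> (y - x) + 1/2 * ((X *v (y - x)) \<bullet> (y - x))"
  shows "(p, X) \<in> superjet S u x"
  unfolding superjet_def
proof (safe intro!: assms(1) bexI[of _ "\<lambda>_. 0"])
  show "\<forall>\<^sub>F y in at x within S. u y \<le> u x + p \<bullet> (y - x) + 1/2 * ((X *v (y - x)) \<bullet> (y - x)) + 0"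
    unfolding eventually_at using assms(2,3) by (auto simp: dist_norm intro!: exI[of _ d])
qed auto

lemma sym_mats_inner:
  fixes X :: "real^'n^'n"
  assumes "X \<in> sym_mats" shows "(X *v x) \<bullet> y = x \<bullet> (X *v y)"
proof -
  have "transpose X = X" using assms by (simp add: sym_mats_def)
  then have "X *v x = x v* X" by (metis vector_transpose_matrix)
  then show ?thesis by (simp add: dot_lmul_matrix)
qed

lemma sym_mats_add:
  fixes X Y :: "real^'n^'n"
  shows "X \<in> sym_mats \<Longrightarrow> Y \<in> sym_mats \<Longrightarrow> X + Y \<in> sym_mats"
proof -
  have "transpose (X + Y) = transpose X + transpose Y" by (simp add: transpose_def vec_eq_iff)
  then show "X \<in> sym_mats \<Longrightarrow> Y \<in> sym_mats \<Longrightarrow> X + Y \<in> sym_mats" by (simp add: sym_mats_def)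
qed

lemma scaleR_mat1_sym_mats: "(c *\<^sub>R mat 1 :: real^'n^'n) \<in> sym_mats"
  by (auto simp: sym_mats_def transpose_def vec_eq_iff mat_def)

lemma scaleR_mat1_vector_mult: "(c *\<^sub>R mat 1) *v h = c *\<^sub>R (h :: real^'n)"
  by (simp add: scaleR_matrix_vector_assoc[symmetric])

text \<open>
  An expansion with error \<open>e t\<^sup>2\<close> at the single scale \<open>t\<close> suffices for a genuine superjet nearby: subtracting
  \<open>2 e |h|\<^sup>2\<close> forces an interior maximum in the ball of radius \<open>t\<close>. The jet of the sup-convolution is then a jet
  of \<open>u\<close> at the maximizing point \<open>x\<close>.
\<close>

lemma sup_convolution_superjet:
  fixes K :: "(real^'n) set" and X :: "real^'n^'n"
  assumes K: "compact K" "K \<noteq> {}" and u: "usc_on K u" and l: "l > 0" and S: "S \<subseteq> K"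
    and X: "X \<in> sym_mats" and t: "t > 0" and e: "e > 0"
    and le: "\<And>h. norm h \<le> t \<Longrightarrow> sup_convolution l K u (\<xi> + h)
      \<le> sup_convolution l K u \<xi> + p \<bullet> h + 1/2 * ((X *v h) \<bullet> h) + e * t\<^sup>2"
  obtains h x where "norm h \<le> t" "x \<in> K" "l *\<^sub>R (x - (\<xi> + h)) = p + X *v h + (4 * e) *\<^sub>R h"
    "sup_convolution l K u (\<xi> + h) = u x - l / 2 * (norm (x - (\<xi> + h)))\<^sup>2"
    "(p + X *v h + (4 * e) *\<^sub>R h, X + (4 * e) *\<^sub>R mat 1) \<in> superjet S u x"
proof -
  define U where "U = sup_convolution l K u"
  have contU: "continuous_on UNIV U" unfolding U_def by (rule continuous_on_sup_convolution[OF K u l])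
  define \<psi> where "\<psi> h = U (\<xi> + h) - p \<bullet> h - 1/2 * ((X *v h) \<bullet> h) - 2 * e * (norm h)\<^sup>2" for h
  have "continuous_on (cball 0 t) \<psi>" unfolding \<psi>_def
    by (intro continuous_intros continuous_on_compose2[OF contU]
        linear_continuous_on matrix_vector_mul_bounded_linear) auto
  then obtain h where h: "h \<in> cball 0 t" "\<And>y. y \<in> cball 0 t \<Longrightarrow> \<psi> y \<le> \<psi> h"
    using continuous_attains_sup[of "cball 0 t" \<psi>] t by auto
  have "norm h < t"
  proof (rule ccontr)
    assume "\<not> norm h < t"
    then have ht: "norm h = t" using h(1) by simp
    have "\<psi> h \<le> U \<xi> + e * t\<^sup>2 - 2 * e * t\<^sup>2"
      using le[of h] by (simp add: \<psi>_def U_def ht)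
    also have "\<dots> < U \<xi>" using e t by simp
    also have "U \<xi> = \<psi> 0" by (simp add: \<psi>_def)
    also have "\<psi> 0 \<le> \<psi> h" using h(2)[of 0] t by simp
    finally show False by simp
  qed
  \<comment> \<open>\<open>p'\<close> and \<open>X'\<close> are the gradient and the Hessian at
    \<open>h\<close> of the test paraboloid, to which \<open>2 * e\<close> times the squared norm
    contributes \<open>4 * e\<close> times \<open>h\<close> and \<open>4 * e\<close> times the
    identity.\<close>
  define \<zeta> where "\<zeta> = \<xi> + h"
  define p' where "p' = p + X *v h + (4 * e) *\<^sub>R h"
  define X' where "X' = X + (4 * e) *\<^sub>R mat 1"
  have Xk: "(X' *v k) \<bullet> k = (X *v k) \<bullet> k + 4 * e * (norm k)\<^sup>2" for k
    by (simp add: X'_def matrix_vector_mult_add_rdistrib scaleR_mat1_vector_mult inner_simps power2_norm_eq_inner)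
  define d where "d = t - norm h"
  have d: "d > 0" using \<open>norm h < t\<close> by (simp add: d_def)
  have near: "U (\<zeta> + k) \<le> U \<zeta> + p' \<bullet> k + 1/2 * ((X' *v k) \<bullet> k)" if k: "norm k < d" for k
  proof -
    have "norm (h + k) \<le> t" using k norm_triangle_ineq[of h k] by (simp add: d_def)
    then have "\<psi> (h + k) \<le> \<psi> h" using h(2) by simp
    moreover have a: "(X *v (h + k)) \<bullet> (h + k) = (X *v h) \<bullet> h + 2 * ((X *v h) \<bullet> k) + (X *v k) \<bullet> k"
      using sym_mats_inner[OF X, of k h] by (simp add: matrix_vector_right_distrib inner_simps inner_commute)
    moreover have b: "(norm (h + k))\<^sup>2 = (norm h)\<^sup>2 + 2 * (h \<bullet> k) + (norm k)\<^sup>2"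
      by (simp add: power2_norm_eq_inner inner_simps inner_commute)
    moreover have c: "p' \<bullet> k = p \<bullet> k + (X *v h) \<bullet> k + 4 * e * (h \<bullet> k)" by (simp add: p'_def inner_simps)
    ultimately have "U (\<zeta> + k) - p \<bullet> (h + k) - 1/2 * ((X *v h) \<bullet> h + 2 * ((X *v h) \<bullet> k) + (X *v k) \<bullet> k)
        - 2 * e * ((norm h)\<^sup>2 + 2 * (h \<bullet> k) + (norm k)\<^sup>2)
      \<le> U \<zeta> - p \<bullet> h - 1/2 * ((X *v h) \<bullet> h) - 2 * e * (norm h)\<^sup>2"
      by (simp only: \<psi>_def \<zeta>_def add.assoc)
    then show ?thesis unfolding c Xk inner_add_right
      by (simp add: field_simps)
  qed
  obtain x where x: "x \<in> K" "U \<zeta> = u x - l / 2 * (norm (x - \<zeta>))\<^sup>2"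
    unfolding U_def using sup_convolution_attained[OF K u l] by metis
  have X': "X' \<in> sym_mats" unfolding X'_def by (intro sym_mats_add X scaleR_mat1_sym_mats)
  have jet: "(p', X') \<in> superjet S u x"
  proof (rule superjetI[OF X' d])
    fix y assume y: "y \<in> S" "norm (y - x) < d"
    \<comment> \<open>Shifting the centre by the same vector that takes \<open>x\<close> to
      \<open>y\<close> leaves the penalty unchanged, so the increment of \<open>u\<close> is bounded
      by that of its sup-convolution.\<close>
    have "u y - l / 2 * (norm (y - (\<zeta> + (y - x))))\<^sup>2 \<le> U (\<zeta> + (y - x))"
      unfolding U_def using sup_convolution_upper[OF K u l] y S by blast
    also have "y - (\<zeta> + (y - x)) = x - \<zeta>" by simp
    finally show "u y \<le> u x + p' \<bullet> (y - x) + 1/2 * ((X' *v (y - x)) \<bullet> (y - x))"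
      using near[OF y(2)] x(2) by simp
  qed
  obtain C where C: "\<And>k. norm (X' *v k) \<le> norm k * C"
    using bounded_linear.bounded[OF matrix_vector_mul_bounded_linear[of X']] by blast
  \<comment> \<open>At \<open>\<zeta>\<close> the sup-convolution lies above a parabola with
    gradient \<open>l\<close> times \<open>x - \<zeta>\<close> and below one with gradient
    \<open>p'\<close>, which forces the gradients to agree.\<close>
  have "l *\<^sub>R (x - \<zeta>) - p' = 0"
  proof (rule linear_le_quadratic_imp_zero[OF d])
    fix k :: "real^'n" assume k: "norm k < d"
    have "U \<zeta> + l * ((x - \<zeta>) \<bullet> k) - l / 2 * (norm k)\<^sup>2 \<le> U \<zeta> + p' \<bullet> k + 1/2 * ((X' *v k) \<bullet> k)"
      using sup_convolution_lower_parabola[OF K u l x(1) x(2)[unfolded U_def], of k] near[OF k]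
      by (simp add: U_def)
    moreover have "(X' *v k) \<bullet> k \<le> C * (norm k)\<^sup>2"
      using order_trans[OF norm_cauchy_schwarz mult_right_mono[OF C[of k] norm_ge_zero[of k]]]
      by (simp add: power2_eq_square ac_simps)
    ultimately show "(l *\<^sub>R (x - \<zeta>) - p') \<bullet> k \<le> (l / 2 + C / 2) * (norm k)\<^sup>2"
      by (simp add: inner_simps algebra_simps)
  qed
  then have "l *\<^sub>R (x - \<zeta>) = p'" by simp
  with h(1) x jet show thesis
    by (intro that[of h x]) (auto simp: U_def \<zeta>_def p'_def X'_def)
qed

section \<open>The theorem on sums\<close>

lemma norm_prod_squared: "(norm z)\<^sup>2 = (norm (fst z))\<^sup>2 + (norm (snd z))\<^sup>2"
  by (simp add: norm_prod_def)

lemma strong_subgradient_sum: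
  assumes "strong_subgradient f q x" "strong_subgradient g p y"
  shows "strong_subgradient (\<lambda>z. f (fst z) + g (snd z)) (q, p) (x, y)"
  unfolding strong_subgradient_def
proof
  fix z :: "'a \<times> 'b"
  show "f (fst (x, y)) + g (snd (x, y)) + (q, p) \<bullet> (z - (x, y)) + (norm (z - (x, y)))\<^sup>2 / 2 \<le> f (fst z) + g (snd z)"
    using strong_subgradientD[OF assms(1), of "fst z"] strong_subgradientD[OF assms(2), of "snd z"]
    by (simp add: norm_prod_squared inner_prod_def add_divide_distrib)
qed

text \<open>A sum of functions of separate variables has no mixed differences. In the limit this
  makes the quadratic form of \<open>M\<close> block diagonal, and so yields one matrix for each
  variable.\<close>

lemma second_blowup_sum:
  fixes f :: "'a::real_inner \<Rightarrow> real" and g :: "'b::real_inner \<Rightarrow> real"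
  defines "F \<equiv> \<lambda>z. f (fst z) + g (snd z)"
  shows "second_blowup F q z k (a, b) = second_blowup F q z k (a, 0) + second_blowup F q z k (0, b)"
  by (simp add: second_blowup_def F_def inner_prod_def algebra_simps)

text \<open>The limit map \<open>M\<close> is not shown to be symmetric, but superjets ask for
  symmetric matrices. Only the quadratic form matters, and symmetrising preserves it.\<close>

lemma sym_mats_of_linear:
  fixes A :: "real^'n \<Rightarrow> real^'n"
  assumes "linear A"
  obtains X where "X \<in> sym_mats" "\<And>h. (X *v h) \<bullet> h = A h \<bullet> h"
proof
  define B where "B = matrix A"
  have B: "B *v h = A h" for h by (simp add: B_def matrix_works assms)
  show "(1/2) *\<^sub>R (B + transpose B) \<in> sym_mats"
    by (simp add: sym_mats_def transpose_def vec_eq_iff)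
  have "(transpose B *v h) \<bullet> h = h \<bullet> (B *v h)" for h
    by (simp add: dot_lmul_matrix)
  then show "((1/2) *\<^sub>R (B + transpose B) *v h) \<bullet> h = A h \<bullet> h" for h
    unfolding scaleR_matrix_vector_assoc[symmetric] matrix_vector_mult_add_rdistrib inner_scaleR_left inner_add_left B
    by (simp add: inner_commute)
qed

text \<open>Equality holds for three equal vectors; accordingly \<open>\<xi>0\<close> and
  \<open>\<zeta>0\<close> below cut the segment from \<open>x0\<close> to \<open>y0\<close> into
  three equal parts.\<close>

lemma norm_add3_squared_le:
  fixes a b c :: "'a::real_inner"
  shows "(norm (a + b + c))\<^sup>2 \<le> 3 * ((norm a)\<^sup>2 + (norm b)\<^sup>2 + (norm c)\<^sup>2)"
proof -
  have "0 \<le> (norm (a - b))\<^sup>2 + (norm (b - c))\<^sup>2 + (norm (a - c))\<^sup>2" by simp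
  then show ?thesis by (simp add: power2_norm_eq_inner inner_simps inner_commute algebra_simps)
qed

text \<open>The second function stands for the negative of the supersolution, so both are upper
  semicontinuous and superjets serve for both variables.\<close>

locale doubled_maximum =
  fixes K :: "(real^'n) set" and u1 u2 :: "real^'n \<Rightarrow> real" and x0 y0 :: "real^'n" and \<alpha> :: real
  assumes K: "compact K" and u1: "usc_on K u1" and u2: "usc_on K u2"
    and x0: "x0 \<in> K" and y0: "y0 \<in> K" and \<alpha>: "\<alpha> > 0"
    and max: "\<And>x y. x \<in> K \<Longrightarrow> y \<in> K \<Longrightarrow>
      u1 x + u2 y - \<alpha> / 2 * (norm (x - y))\<^sup>2 \<le> u1 x0 + u2 y0 - \<alpha> / 2 * (norm (x0 - y0))\<^sup>2"
begin

text \<open>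
  Sup-convolving with \<open>l = 3 \<alpha>\<close> turns the penalty \<open>\<alpha>/2 |x - y|\<^sup>2\<close> into \<open>3 \<alpha>/2 |\<xi> - \<zeta>|\<^sup>2\<close> and the maximum point
  \<open>(x0, y0)\<close> into \<open>(\<xi>0, \<zeta>0)\<close>. This is the source of both constants in the matrix inequality.
\<close>

definition "l = 3 * \<alpha>"
definition "e0 = (1/3) *\<^sub>R (x0 - y0)"
definition "\<xi>0 = x0 - e0"
definition "\<zeta>0 = y0 + e0"
abbreviation "U1 \<equiv> sup_convolution l K u1"
abbreviation "U2 \<equiv> sup_convolution l K u2"

lemma l_pos: "l > 0" using \<alpha> by (simp add: l_def)
lemma K_ne: "K \<noteq> {}" using x0 by auto
lemma x0_y0: "x0 - y0 = 3 *\<^sub>R e0" by (simp add: e0_def)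
lemma diff0: "\<xi>0 - \<zeta>0 = e0"
proof -
  have "\<xi>0 - \<zeta>0 = (x0 - y0) - 2 *\<^sub>R e0" by (simp add: \<xi>0_def \<zeta>0_def scaleR_2)
  also have "\<dots> = e0" unfolding x0_y0 by (simp flip: scaleR_diff_left)
  finally show ?thesis .
qed

text \<open>The vector \<open>x - y\<close> is a sum of three pieces through \<open>\<xi>\<close>
  and \<open>\<zeta>\<close>. With \<open>l = 3 * \<alpha>\<close> the penalties of the three pieces
  together dominate that of \<open>x - y\<close>.\<close>

lemma convolved_le: "U1 \<xi> + U2 \<zeta> - l / 2 * (norm (\<xi> - \<zeta>))\<^sup>2 \<le> u1 x0 + u2 y0 - \<alpha> / 2 * (norm (x0 - y0))\<^sup>2"
proof -
  obtain x where x: "x \<in> K" "U1 \<xi> = u1 x - l / 2 * (norm (x - \<xi>))\<^sup>2"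
    using sup_convolution_attained[OF K K_ne u1 l_pos] by metis
  obtain y where y: "y \<in> K" "U2 \<zeta> = u2 y - l / 2 * (norm (y - \<zeta>))\<^sup>2"
    using sup_convolution_attained[OF K K_ne u2 l_pos] by metis
  have "(norm (x - y))\<^sup>2 = (norm ((\<xi> - \<zeta>) + (x - \<xi>) + (- (y - \<zeta>))))\<^sup>2" by (simp add: algebra_simps)
  also have "\<dots> \<le> 3 * ((norm (\<xi> - \<zeta>))\<^sup>2 + (norm (x - \<xi>))\<^sup>2 + (norm (- (y - \<zeta>)))\<^sup>2)"
    by (rule norm_add3_squared_le)
  finally have "\<alpha> / 2 * (norm (x - y))\<^sup>2 \<le> \<alpha> / 2 * (3 * ((norm (\<xi> - \<zeta>))\<^sup>2 + (norm (x - \<xi>))\<^sup>2 + (norm (y - \<zeta>))\<^sup>2))"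
    using \<alpha> by (intro mult_left_mono) (auto simp: norm_minus_commute[of \<zeta> y])
  moreover have la: "l / 2 * c = \<alpha> / 2 * (3 * c)" for c by (simp add: l_def)
  ultimately show ?thesis using max[OF x(1) y(1)] unfolding x(2) y(2) la by (simp add: field_simps)
qed

text \<open>Taking \<open>x0\<close> and \<open>y0\<close> as competitors gives lower bounds for
  both values, and \<open>convolved_le\<close> bounds their sum by exactly the sum of these bounds;
  hence both are equalities.\<close>

lemma convolved_at:
  shows "U1 \<xi>0 = u1 x0 - l / 2 * (norm e0)\<^sup>2" "U2 \<zeta>0 = u2 y0 - l / 2 * (norm e0)\<^sup>2"
proof -
  have a: "u1 x0 - l / 2 * (norm e0)\<^sup>2 \<le> U1 \<xi>0"
    using sup_convolution_upper[OF K K_ne u1 l_pos x0, of \<xi>0] by (simp add: \<xi>0_def)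
  have b: "u2 y0 - l / 2 * (norm e0)\<^sup>2 \<le> U2 \<zeta>0"
    using sup_convolution_upper[OF K K_ne u2 l_pos y0, of \<zeta>0] by (simp add: \<zeta>0_def)
  have "\<alpha> / 2 * (norm (x0 - y0))\<^sup>2 = 3 * (l / 2 * (norm e0)\<^sup>2)"
    unfolding x0_y0 by (simp add: power_mult_distrib l_def)
  then have "U1 \<xi>0 + U2 \<zeta>0 \<le> u1 x0 + u2 y0 - 2 * (l / 2 * (norm e0)\<^sup>2)"
    using convolved_le[of \<xi>0 \<zeta>0] unfolding diff0 by simp
  with a b show "U1 \<xi>0 = u1 x0 - l / 2 * (norm e0)\<^sup>2" "U2 \<zeta>0 = u2 y0 - l / 2 * (norm e0)\<^sup>2"
    by linarith+
qed

lemma convolved_max: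
  "U1 \<xi> + U2 \<zeta> - l / 2 * (norm (\<xi> - \<zeta>))\<^sup>2 \<le> U1 \<xi>0 + U2 \<zeta>0 - l / 2 * (norm (\<xi>0 - \<zeta>0))\<^sup>2"
proof -
  have "\<alpha> / 2 * (norm (x0 - y0))\<^sup>2 = 3 * (l / 2 * (norm e0)\<^sup>2)"
    unfolding x0_y0 by (simp add: power_mult_distrib l_def)
  then show ?thesis using convolved_le[of \<xi> \<zeta>] unfolding convolved_at diff0 by simp
qed

text \<open>The quadratic terms with \<open>l + 1\<close> make \<open>F\<close> strongly convex.
  They enter \<open>T\<close> as well, next to the penalty, so that \<open>F\<close> minus half the
  form of \<open>T\<close> is the doubled function itself.\<close>

definition "F z = (U1 (fst z) + (l + 1) / 2 * (norm (fst z))\<^sup>2) + (U2 (snd z) + (l + 1) / 2 * (norm (snd z))\<^sup>2)"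
definition "T z = (l *\<^sub>R (fst z - snd z) + (l + 1) *\<^sub>R fst z, l *\<^sub>R (snd z - fst z) + (l + 1) *\<^sub>R snd z)"

lemma F_sub: "\<exists>q. strong_subgradient F q z"
proof -
  obtain q p where "strong_subgradient (\<lambda>\<xi>. U1 \<xi> + (l + 1) / 2 * (norm \<xi>)\<^sup>2) q (fst z)"
    "strong_subgradient (\<lambda>\<xi>. U2 \<xi> + (l + 1) / 2 * (norm \<xi>)\<^sup>2) p (snd z)"
    using sup_convolution_strong_subgradient[OF K K_ne u1 l_pos]
      sup_convolution_strong_subgradient[OF K K_ne u2 l_pos] by blast
  from strong_subgradient_sum[OF this] show ?thesis unfolding F_def[abs_def] by auto
qed

lemma F_cont: "continuous_on UNIV F"
  unfolding F_def[abs_def]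
  by (intro continuous_intros
      continuous_on_compose2[OF continuous_on_sup_convolution[OF K K_ne u1 l_pos]]
      continuous_on_compose2[OF continuous_on_sup_convolution[OF K K_ne u2 l_pos]]) auto

lemma T_linear: "linear T"
  by (intro linearI) (auto simp: T_def algebra_simps)

lemma T_sym: "T x \<bullet> y = x \<bullet> T y"
  by (simp add: T_def inner_prod_def inner_simps algebra_simps inner_commute)

lemma T_form: "T z \<bullet> z = l * (norm (fst z - snd z))\<^sup>2 + (l + 1) * (norm z)\<^sup>2"
  by (simp add: T_def inner_prod_def norm_prod_squared power2_norm_eq_inner inner_simps algebra_simps inner_commute)

lemma F_max: "F z - (T z \<bullet> z) / 2 \<le> F (\<xi>0, \<zeta>0) - (T (\<xi>0, \<zeta>0) \<bullet> (\<xi>0, \<zeta>0)) / 2"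
proof -
  have "F z - (T z \<bullet> z) / 2 = U1 (fst z) + U2 (snd z) - l / 2 * (norm (fst z - snd z))\<^sup>2" for z
    unfolding T_form norm_prod_squared F_def by (simp add: field_simps)
  then show ?thesis using convolved_max[of "fst z" "snd z"] by simp
qed

text \<open>The form of \<open>M\<close> lies between the squared norm and that of \<open>T\<close>
  plus \<open>\<kappa>\<close>. Taking \<open>(l + 1)\<close> times the squared norm away again
  leaves the lower bound \<open>- l\<close> and the penalty form as upper bound. What remains of
  \<open>\<rho>\<close> pays for the shift to points with exact superjets.\<close>

lemma superjets_near:
  assumes S: "S \<subseteq> K" and \<rho>: "\<rho> > 0"
  obtains \<xi> \<zeta> x y p q X Y where
    "norm (\<xi> - \<xi>0) \<le> \<rho>" "norm (\<zeta> - \<zeta>0) \<le> \<rho>" "norm (p - l *\<^sub>R e0) \<le> \<rho>" "norm (q + l *\<^sub>R e0) \<le> \<rho>"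
    "l *\<^sub>R (x - \<xi>) = p" "l *\<^sub>R (y - \<zeta>) = q"
    "U1 \<xi> = u1 x - l / 2 * (norm (x - \<xi>))\<^sup>2" "U2 \<zeta> = u2 y - l / 2 * (norm (y - \<zeta>))\<^sup>2"
    "(p, X) \<in> superjet S u1 x" "(q, Y) \<in> superjet S u2 y"
    "\<And>h k. - l * ((norm h)\<^sup>2 + (norm k)\<^sup>2) \<le> (X *v h) \<bullet> h + (Y *v k) \<bullet> k"
    "\<And>h k. (X *v h) \<bullet> h + (Y *v k) \<bullet> k \<le> l * (norm (h - k))\<^sup>2 + \<rho> * ((norm h)\<^sup>2 + (norm k)\<^sup>2)"
proof -
  \<comment> \<open>In the matrix bound \<open>\<kappa> + 4 * \<epsilon> = \<rho>\<close>. In the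
    gradient bound \<open>\<delta> + 2 * l * \<delta>\<close> takes half of \<open>\<rho>\<close>;
    the other half is kept for the change of the gradient on the small ball.\<close>
  define \<kappa> \<delta> \<epsilon> where "\<kappa> = \<rho> / 2" and "\<delta> = \<rho> / (4 * (l + 1))" and "\<epsilon> = \<rho> / 8"
  have pos: "\<kappa> > 0" "\<delta> > 0" "\<epsilon> > 0" using \<rho> l_pos by (auto simp: \<kappa>_def \<delta>_def \<epsilon>_def)
  have \<delta>: "\<delta> + 2 * l * \<delta> \<le> \<rho> / 2" "\<delta> \<le> \<rho> / 4"
  proof -
    have "4 * ((l + 1) * \<delta>) = \<rho>"
      using l_pos by (simp add: \<delta>_def divide_simps)
    moreover have "0 \<le> l * \<delta>" using l_pos pos by simp
    ultimately show "\<delta> + 2 * l * \<delta> \<le> \<rho> / 2" "\<delta> \<le> \<rho> / 4"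
      using pos(2) by (simp_all add: algebra_simps)
  qed
  obtain z q M r where z: "norm (z - (\<xi>0, \<zeta>0)) \<le> \<delta>" "norm (q - T z) \<le> \<delta>"
    and M: "linear M" "\<And>s. (norm s)\<^sup>2 \<le> M s \<bullet> s" "\<And>s. M s \<bullet> s \<le> T s \<bullet> s + \<kappa> * (norm s)\<^sup>2"
    and r: "strict_mono (r :: nat \<Rightarrow> nat)"
    and conv: "\<And>d. d > 0 \<Longrightarrow> \<forall>\<^sub>F n in sequentially. \<forall>s\<in>cball 0 1.
      \<bar>second_blowup F q z (r n) s - (M s \<bullet> s) / 2\<bar> \<le> d"
    by (rule perturbed_maximum_second_order[OF F_cont F_sub T_linear T_sym F_max pos(1,2)]) (rule that)
  define A where "A h = fst (M (h, 0))" for h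
  define B where "B k = snd (M (0, k))" for k
  have linA: "linear A" and linB: "linear B"
    unfolding A_def B_def
    by (auto intro!: linearI simp: linear_add[OF M(1), symmetric] linear_scale[OF M(1), symmetric]
        fst_add[symmetric] snd_add[symmetric] fst_scaleR[symmetric] snd_scaleR[symmetric]
        simp del: fst_add snd_add fst_scaleR snd_scaleR)
  have Aform: "M (h, 0) \<bullet> (h, 0) = A h \<bullet> h" for h by (simp add: A_def inner_prod_def)
  have Bform: "M (0, k) \<bullet> (0, k) = B k \<bullet> k" for k by (simp add: B_def inner_prod_def)
  have split: "M (h, k) \<bullet> (h, k) = A h \<bullet> h + B k \<bullet> k" for h k
  proof -
    have small: "M (h, k) \<bullet> (h, k) = A h \<bullet> h + B k \<bullet> k" if "norm (h, k) \<le> 1" for h k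
    proof -
      \<comment> \<open>Three blow-ups each miss half of a form by at most \<open>d\<close>;
        doubling gives the \<open>6\<close>.\<close>
      have "\<bar>M (h, k) \<bullet> (h, k) - (A h \<bullet> h + B k \<bullet> k)\<bar> \<le> 6 * d" if d: "d > 0" for d
      proof -
        obtain n where n: "\<forall>s\<in>cball 0 1. \<bar>second_blowup F q z (r n) s - (M s \<bullet> s) / 2\<bar> \<le> d"
          using eventually_happens'[OF _ conv[OF d]] by auto
        have "norm (h, 0::real^'n) \<le> 1" "norm (0::real^'n, k) \<le> 1"
          using \<open>norm (h, k) \<le> 1\<close> norm_fst_le[of h k] norm_snd_le[of k h] by auto
        then show ?thesis
          using n[rule_format, of "(h, k)"] n[rule_format, of "(h, 0)"] n[rule_format, of "(0, k)"] \<open>norm (h, k) \<le> 1\<close>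
            second_blowup_sum[of "\<lambda>x. U1 x + (l + 1) / 2 * (norm x)\<^sup>2" "\<lambda>x. U2 x + (l + 1) / 2 * (norm x)\<^sup>2" q z "r n" h k]
          unfolding F_def[abs_def, symmetric] Aform Bform by simp
      qed
      from this[of "d / 6" for d] have eps: "\<bar>M (h, k) \<bullet> (h, k) - (A h \<bullet> h + B k \<bullet> k)\<bar> \<le> d" if "d > 0" for d
        using that by fastforce
      have "\<bar>M (h, k) \<bullet> (h, k) - (A h \<bullet> h + B k \<bullet> k)\<bar> \<le> 0"
        by (rule field_le_epsilon) (simp only: add_0 eps)
      then show ?thesis by simp
    qed
    define c where "c = 1 / (norm (h, k) + 1)"
    have c: "c > 0" by (simp add: c_def add_nonneg_pos)
    have "norm (c *\<^sub>R (h, k)) \<le> 1" by (simp add: c_def divide_le_eq_1 add_nonneg_pos del: scaleR_Pair)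
    then have "norm (c *\<^sub>R h, c *\<^sub>R k) \<le> 1" by simp
    from small[OF this] have "c * (c * (M (h, k) \<bullet> (h, k))) = c * (c * (A h \<bullet> h + B k \<bullet> k))"
      using linear_scale[OF M(1), of c "(h, k)"]
      by (simp add: linear_scale[OF linA] linear_scale[OF linB] inner_prod_def algebra_simps)
    then show ?thesis using c by simp
  qed
  obtain X0 where X0: "X0 \<in> sym_mats" "\<And>h. (X0 *v h) \<bullet> h = A h \<bullet> h" using sym_mats_of_linear[OF linA] by metis
  obtain Y0 where Y0: "Y0 \<in> sym_mats" "\<And>h. (Y0 *v h) \<bullet> h = B h \<bullet> h" using sym_mats_of_linear[OF linB] by metis
  \<comment> \<open>Subtracting \<open>l + 1\<close> times the identity undoes the convexification
    of the sup-convolutions.\<close>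
  define X where "X = X0 + (- (l + 1)) *\<^sub>R mat 1"
  define Y where "Y = Y0 + (- (l + 1)) *\<^sub>R mat 1"
  have XY: "X \<in> sym_mats" "Y \<in> sym_mats"
    unfolding X_def Y_def using X0 Y0 by (auto intro!: sym_mats_add scaleR_mat1_sym_mats)
  have Xf: "(X *v h) \<bullet> h = A h \<bullet> h - (l + 1) * (norm h)\<^sup>2" and Yf: "(Y *v h) \<bullet> h = B h \<bullet> h - (l + 1) * (norm h)\<^sup>2" for h
    unfolding X_def Y_def matrix_vector_mult_add_rdistrib scaleR_mat1_vector_mult
    by (simp_all add: inner_add_left X0(2) Y0(2) power2_norm_eq_inner left_diff_distrib distrib_right)
  obtain CX CY where CX: "CX > 0" "\<And>k. norm (X *v k) \<le> norm k * CX" and CY: "CY > 0" "\<And>k. norm (Y *v k) \<le> norm k * CY"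
    using bounded_linear.pos_bounded[OF matrix_vector_mul_bounded_linear[of X]]
      bounded_linear.pos_bounded[OF matrix_vector_mul_bounded_linear[of Y]] by blast
  \<comment> \<open>\<open>C\<close> bounds the change of either gradient per unit of length; the
    summand \<open>1\<close> makes \<open>t * C \<le> \<rho> / 2\<close> imply
    \<open>t \<le> \<rho> / 2\<close> as well.\<close>
  define C where "C = CX + CY + 4 * \<epsilon> + 1"
  have C: "C > 0" using CX CY pos by (simp add: C_def)
  have "(\<lambda>n. (1/2::real)^(r n)) \<longlonglongrightarrow> 0"
    using LIMSEQ_subseq_LIMSEQ[OF LIMSEQ_realpow_zero[of "1/2::real"] r] by (simp add: o_def)
  then have "\<forall>\<^sub>F n in sequentially. (1/2::real)^(r n) < \<rho> / (2 * C)"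
    using \<rho> C by (intro order_tendstoD(2)) auto
  then have "\<forall>\<^sub>F n in sequentially. (1/2::real)^(r n) < \<rho> / (2 * C) \<and>
     (\<forall>s\<in>cball 0 1. \<bar>second_blowup F q z (r n) s - (M s \<bullet> s) / 2\<bar> \<le> \<epsilon>)"
    using conv[OF pos(3)] by (rule eventually_conj)
  from eventually_happens'[OF _ this] obtain n where n: "(1/2::real)^(r n) < \<rho> / (2 * C)"
    "\<And>s. norm s \<le> 1 \<Longrightarrow> \<bar>second_blowup F q z (r n) s - (M s \<bullet> s) / 2\<bar> \<le> \<epsilon>"
    by auto
  define t :: real where "t = (1/2)^(r n)"
  have t: "t > 0" "t * C \<le> \<rho> / 2" "t \<le> \<rho> / 2" "4^(r n) * t\<^sup>2 = 1"
  proof -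
    show "t > 0" by (simp add: t_def)
    show tC: "t * C \<le> \<rho> / 2" using n(1) C by (simp add: t_def field_simps)
    have "t * 1 \<le> t * C" using \<open>t > 0\<close> CX CY pos by (intro mult_left_mono) (auto simp: C_def)
    then show "t \<le> \<rho> / 2" using tC by simp
    have "(4::real)^(r n) = 2^(r n) * 2^(r n)" by (simp flip: power_mult_distrib)
    then show "4^(r n) * t\<^sup>2 = 1" by (simp add: t_def power2_eq_square power_one_over)
  qed
  \<comment> \<open>Closeness within \<open>\<epsilon>\<close> on the unit ball scales to an error
    \<open>\<epsilon>\<close> times the square of \<open>t\<close> on the ball of radius
    \<open>t\<close>, the single-scale hypothesis of
    \<open>sup_convolution_superjet\<close>.\<close>
  have expand: "F (z + s) - F z - q \<bullet> s \<le> (M s \<bullet> s) / 2 + \<epsilon> * t\<^sup>2" if s: "norm s \<le> t" for s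
  proof -
    define s' where "s' = (1/t) *\<^sub>R s"
    have s': "s = t *\<^sub>R s'" "norm s' \<le> 1" using s t(1) by (auto simp: s'_def divide_le_eq)
    have "4^(r n) * (F (z + s) - F z - q \<bullet> s) \<le> (M s' \<bullet> s') / 2 + \<epsilon>"
      using n(2)[OF s'(2)] unfolding second_blowup_def t_def[symmetric] s'(1)[symmetric]
      by (simp add: s'(1) abs_le_iff)
    then have "t\<^sup>2 * (4^(r n) * (F (z + s) - F z - q \<bullet> s)) \<le> t\<^sup>2 * ((M s' \<bullet> s') / 2 + \<epsilon>)"
      by (intro mult_left_mono) auto
    moreover have "t\<^sup>2 * (4^(r n) * (F (z + s) - F z - q \<bullet> s)) = (4^(r n) * t\<^sup>2) * (F (z + s) - F z - q \<bullet> s)"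
      by simp
    moreover have "t\<^sup>2 * ((M s' \<bullet> s') / 2 + \<epsilon>) = (M s \<bullet> s) / 2 + \<epsilon> * t\<^sup>2"
      unfolding s'(1) linear_scale[OF M(1)] by (simp add: power2_eq_square algebra_simps)
    ultimately show ?thesis by (simp only: t(4) mult_1)
  qed
  obtain \<xi> \<zeta> where z_eq: "z = (\<xi>, \<zeta>)" by (cases z)
  obtain q1 q2 where q_eq: "q = (q1, q2)" by (cases q)
  define p1 p2 where "p1 = q1 - (l + 1) *\<^sub>R \<xi>" and "p2 = q2 - (l + 1) *\<^sub>R \<zeta>"
  have e1: "U1 (\<xi> + h) \<le> U1 \<xi> + p1 \<bullet> h + 1/2 * ((X *v h) \<bullet> h) + \<epsilon> * t\<^sup>2" if "norm h \<le> t" for h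
  proof -
    have "(norm (\<xi> + h))\<^sup>2 = (norm \<xi>)\<^sup>2 + 2 * (\<xi> \<bullet> h) + (norm h)\<^sup>2"
      by (simp add: power2_norm_eq_inner inner_simps inner_commute)
    moreover have "F ((\<xi>, \<zeta>) + (h, 0)) - F (\<xi>, \<zeta>) - (q1, q2) \<bullet> (h, 0) \<le> (A h \<bullet> h) / 2 + \<epsilon> * t\<^sup>2"
      using expand[of "(h, 0)"] that unfolding Aform z_eq q_eq by simp
    ultimately show ?thesis unfolding Xf p1_def by (simp add: F_def inner_diff_left inner_add_left field_simps)
  qed
  have e2: "U2 (\<zeta> + h) \<le> U2 \<zeta> + p2 \<bullet> h + 1/2 * ((Y *v h) \<bullet> h) + \<epsilon> * t\<^sup>2" if "norm h \<le> t" for h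
  proof -
    have "(norm (\<zeta> + h))\<^sup>2 = (norm \<zeta>)\<^sup>2 + 2 * (\<zeta> \<bullet> h) + (norm h)\<^sup>2"
      by (simp add: power2_norm_eq_inner inner_simps inner_commute)
    moreover have "F ((\<xi>, \<zeta>) + (0, h)) - F (\<xi>, \<zeta>) - (q1, q2) \<bullet> (0, h) \<le> (B h \<bullet> h) / 2 + \<epsilon> * t\<^sup>2"
      using expand[of "(0, h)"] that unfolding Bform z_eq q_eq by simp
    ultimately show ?thesis unfolding Yf p2_def by (simp add: F_def inner_diff_left inner_add_left field_simps)
  qed
  obtain h x where h: "norm h \<le> t" and x: "l *\<^sub>R (x - (\<xi> + h)) = p1 + X *v h + (4 * \<epsilon>) *\<^sub>R h"
    "U1 (\<xi> + h) = u1 x - l / 2 * (norm (x - (\<xi> + h)))\<^sup>2"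
    "(p1 + X *v h + (4 * \<epsilon>) *\<^sub>R h, X + (4 * \<epsilon>) *\<^sub>R mat 1) \<in> superjet S u1 x"
    by (rule sup_convolution_superjet[OF K K_ne u1 l_pos S XY(1) t(1) pos(3)]) (erule e1, rule that)
  obtain k y where k: "norm k \<le> t" and y: "l *\<^sub>R (y - (\<zeta> + k)) = p2 + Y *v k + (4 * \<epsilon>) *\<^sub>R k"
    "U2 (\<zeta> + k) = u2 y - l / 2 * (norm (y - (\<zeta> + k)))\<^sup>2"
    "(p2 + Y *v k + (4 * \<epsilon>) *\<^sub>R k, Y + (4 * \<epsilon>) *\<^sub>R mat 1) \<in> superjet S u2 y"
    by (rule sup_convolution_superjet[OF K K_ne u2 l_pos S XY(2) t(1) pos(3)]) (erule e2, rule that)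
  have d1: "norm (\<xi> - \<xi>0) \<le> \<delta>" "norm (\<zeta> - \<zeta>0) \<le> \<delta>"
    using z(1) norm_fst_le[of "\<xi> - \<xi>0" "\<zeta> - \<zeta>0"] norm_snd_le[of "\<zeta> - \<zeta>0" "\<xi> - \<xi>0"] unfolding z_eq by auto
  have d2: "norm (p1 - l *\<^sub>R (\<xi> - \<zeta>)) \<le> \<delta>" "norm (p2 + l *\<^sub>R (\<xi> - \<zeta>)) \<le> \<delta>"
  proof -
    have "q - T z = (p1 - l *\<^sub>R (\<xi> - \<zeta>), p2 + l *\<^sub>R (\<xi> - \<zeta>))"
      by (simp add: T_def z_eq q_eq p1_def p2_def algebra_simps)
    then show "norm (p1 - l *\<^sub>R (\<xi> - \<zeta>)) \<le> \<delta>" "norm (p2 + l *\<^sub>R (\<xi> - \<zeta>)) \<le> \<delta>"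
      using z(2) norm_fst_le norm_snd_le order_trans by metis+
  qed
  have d3: "norm (l *\<^sub>R (\<xi> - \<zeta>) - l *\<^sub>R e0) \<le> 2 * l * \<delta>"
  proof -
    have "l *\<^sub>R (\<xi> - \<zeta>) - l *\<^sub>R e0 = l *\<^sub>R ((\<xi> - \<xi>0) - (\<zeta> - \<zeta>0))"
      unfolding diff0[symmetric] by (simp add: algebra_simps)
    then have "norm (l *\<^sub>R (\<xi> - \<zeta>) - l *\<^sub>R e0) = l * norm ((\<xi> - \<xi>0) - (\<zeta> - \<zeta>0))"
      using l_pos by simp
    also have "\<dots> \<le> l * (\<delta> + \<delta>)"
      using l_pos by (intro mult_left_mono order_trans[OF norm_triangle_ineq4 add_mono[OF d1]]) auto
    finally show ?thesis by simp
  qed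
  have small: "norm (X *v h + (4 * \<epsilon>) *\<^sub>R h) \<le> \<rho> / 2" "norm (Y *v k + (4 * \<epsilon>) *\<^sub>R k) \<le> \<rho> / 2"
  proof -
    have "norm (X *v h + (4 * \<epsilon>) *\<^sub>R h) \<le> norm h * CX + 4 * \<epsilon> * norm h"
      using pos by (intro norm_triangle_le add_mono CX) auto
    also have "\<dots> = norm h * (CX + 4 * \<epsilon>)" by (simp add: algebra_simps)
    also have "\<dots> \<le> t * C" using h CX CY pos t by (intro mult_mono) (auto simp: C_def)
    finally show "norm (X *v h + (4 * \<epsilon>) *\<^sub>R h) \<le> \<rho> / 2" using t(2) by simp
    have "norm (Y *v k + (4 * \<epsilon>) *\<^sub>R k) \<le> norm k * CY + 4 * \<epsilon> * norm k"
      using pos by (intro norm_triangle_le add_mono CY) auto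
    also have "\<dots> = norm k * (CY + 4 * \<epsilon>)" by (simp add: algebra_simps)
    also have "\<dots> \<le> t * C" using k CX CY pos t by (intro mult_mono) (auto simp: C_def)
    finally show "norm (Y *v k + (4 * \<epsilon>) *\<^sub>R k) \<le> \<rho> / 2" using t(2) by simp
  qed
  have form: "((X + (4 * \<epsilon>) *\<^sub>R mat 1) *v a) \<bullet> a + ((Y + (4 * \<epsilon>) *\<^sub>R mat 1) *v b) \<bullet> b
     = M (a, b) \<bullet> (a, b) + (4 * \<epsilon> - (l + 1)) * ((norm a)\<^sup>2 + (norm b)\<^sup>2)" for a b
    unfolding matrix_vector_mult_add_rdistrib scaleR_mat1_vector_mult inner_add_left Xf Yf split
    by (simp add: power2_norm_eq_inner algebra_simps)
  show thesis
  proof (rule that[of "\<xi> + h" "\<zeta> + k", OF _ _ _ _ x(1) y(1) x(2) y(2) x(3) y(3)])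
    show "norm (\<xi> + h - \<xi>0) \<le> \<rho>"
      using norm_triangle_ineq[of "\<xi> - \<xi>0" h] d1 h t(3) \<delta>(2) \<rho> by (simp add: algebra_simps)
    show "norm (\<zeta> + k - \<zeta>0) \<le> \<rho>"
      using norm_triangle_ineq[of "\<zeta> - \<zeta>0" k] d1 k t(3) \<delta>(2) \<rho> by (simp add: algebra_simps)
    have eq1: "p1 + X *v h + (4 * \<epsilon>) *\<^sub>R h - l *\<^sub>R e0 = (p1 - l *\<^sub>R (\<xi> - \<zeta>)) + (l *\<^sub>R (\<xi> - \<zeta>) - l *\<^sub>R e0) + (X *v h + (4 * \<epsilon>) *\<^sub>R h)"
      by (simp add: algebra_simps)
    have "norm (p1 + X *v h + (4 * \<epsilon>) *\<^sub>R h - l *\<^sub>R e0) \<le> \<delta> + 2 * l * \<delta> + \<rho> / 2"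
      unfolding eq1 by (rule order_trans[OF norm_triangle_ineq add_mono[OF order_trans[OF norm_triangle_ineq add_mono[OF d2(1) d3]] small(1)]])
    then show "norm (p1 + X *v h + (4 * \<epsilon>) *\<^sub>R h - l *\<^sub>R e0) \<le> \<rho>" using \<delta>(1) by simp
    have eq2: "p2 + Y *v k + (4 * \<epsilon>) *\<^sub>R k + l *\<^sub>R e0 = (p2 + l *\<^sub>R (\<xi> - \<zeta>)) - (l *\<^sub>R (\<xi> - \<zeta>) - l *\<^sub>R e0) + (Y *v k + (4 * \<epsilon>) *\<^sub>R k)"
      by (simp add: algebra_simps)
    have "norm (p2 + Y *v k + (4 * \<epsilon>) *\<^sub>R k + l *\<^sub>R e0) \<le> \<delta> + 2 * l * \<delta> + \<rho> / 2"
      unfolding eq2 by (rule order_trans[OF norm_triangle_ineq add_mono[OF order_trans[OF norm_triangle_ineq4 add_mono[OF d2(2) d3]] small(2)]])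
    then show "norm (p2 + Y *v k + (4 * \<epsilon>) *\<^sub>R k + l *\<^sub>R e0) \<le> \<rho>" using \<delta>(1) by simp
  next
    fix a b :: "real^'n"
    have nab: "(norm (a, b))\<^sup>2 = (norm a)\<^sup>2 + (norm b)\<^sup>2" by (simp add: norm_prod_squared)
    have "0 \<le> 4 * \<epsilon> * ((norm a)\<^sup>2 + (norm b)\<^sup>2)" using pos by simp
    then show "- l * ((norm a)\<^sup>2 + (norm b)\<^sup>2)
      \<le> ((X + (4 * \<epsilon>) *\<^sub>R mat 1) *v a) \<bullet> a + ((Y + (4 * \<epsilon>) *\<^sub>R mat 1) *v b) \<bullet> b"
      unfolding form using M(2)[of "(a, b)"] unfolding nab by (simp add: algebra_simps)
    have "4 * \<epsilon> + \<kappa> = \<rho>" by (simp add: \<epsilon>_def \<kappa>_def)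
    then have "\<rho> * ((norm a)\<^sup>2 + (norm b)\<^sup>2) = 4 * \<epsilon> * ((norm a)\<^sup>2 + (norm b)\<^sup>2) + \<kappa> * ((norm a)\<^sup>2 + (norm b)\<^sup>2)"
      by (metis distrib_right)
    then show "((X + (4 * \<epsilon>) *\<^sub>R mat 1) *v a) \<bullet> a + ((Y + (4 * \<epsilon>) *\<^sub>R mat 1) *v b) \<bullet> b
      \<le> l * (norm (a - b))\<^sup>2 + \<rho> * ((norm a)\<^sup>2 + (norm b)\<^sup>2)"
      unfolding form using M(3)[of "(a, b)"] unfolding T_form nab by (simp add: algebra_simps)
  qed
qed

end

text \<open>Polarisation recovers the entries of a symmetric matrix from its quadratic form. This
  turns the two-sided matrix inequality into compactness.\<close>

lemma sym_mats_norm_le: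
  fixes X :: "real^'n^'n"
  assumes X: "X \<in> sym_mats" and C: "\<And>h. \<bar>(X *v h) \<bullet> h\<bar> \<le> C * (norm h)\<^sup>2"
  shows "norm X \<le> real CARD('n) * (real CARD('n) * C)"
proof -
  have entry: "\<bar>X $ i $ j\<bar> \<le> C" for i j
  proof -
    define h k :: "real^'n" where "h = axis j 1" and "k = axis i 1"
    have "X $ i $ j = (X *v h) \<bullet> k"
      by (simp add: h_def k_def inner_axis matrix_vector_mult_basis column_def)
    moreover have "4 * ((X *v h) \<bullet> k) = (X *v (h + k)) \<bullet> (h + k) - (X *v (h - k)) \<bullet> (h - k)"
      using sym_mats_inner[OF X, of k h]
      by (simp add: matrix_vector_right_distrib matrix_vector_mult_diff_distrib inner_simps inner_commute)
    moreover have "C * (norm (h + k))\<^sup>2 + C * (norm (h - k))\<^sup>2 = 4 * C"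
    proof -
      have "(norm (h + k))\<^sup>2 + (norm (h - k))\<^sup>2 = 2 * (norm h)\<^sup>2 + 2 * (norm k)\<^sup>2"
        by (simp add: power2_norm_eq_inner inner_simps inner_commute)
      also have "\<dots> = 4" by (simp add: h_def k_def)
      finally show ?thesis by (simp flip: distrib_left)
    qed
    ultimately show ?thesis using C[of "h + k"] C[of "h - k"] by linarith
  qed
  have row: "norm (X $ i) \<le> real CARD('n) * C" for i
  proof -
    have "norm (X $ i) \<le> (\<Sum>j\<in>UNIV. \<bar>X $ i $ j\<bar>)" by (rule norm_le_l1_cart)
    also have "\<dots> \<le> real CARD('n) * C" by (rule sum_bounded_above) (rule entry)
    finally show ?thesis .
  qed
  have "norm X \<le> (\<Sum>i\<in>UNIV. norm (X $ i))" unfolding norm_vec_def by (rule L2_set_le_sum) simp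
  also have "\<dots> \<le> real CARD('n) * (real CARD('n) * C)" by (rule sum_bounded_above) (rule row)
  finally show ?thesis .
qed

lemma closed_sym_mats: "closed (sym_mats :: (real^'n^'n) set)"
proof -
  have "sym_mats = (\<Inter>i. \<Inter>j. {X :: real^'n^'n. X $ j $ i = X $ i $ j})"
    by (auto simp: sym_mats_def transpose_def vec_eq_iff)
  also have "closed \<dots>" by (intro closed_INT ballI closed_Collect_eq continuous_intros)
  finally show ?thesis .
qed

lemma superjet_sym_mats: "(p, X) \<in> superjet S u x \<Longrightarrow> X \<in> sym_mats"
  by (simp add: superjet_def)

lemma tendsto_of_norm_le_inverse_Suc:
  fixes f :: "nat \<Rightarrow> 'a::real_normed_vector"
  assumes "\<And>n. norm (f n - a) \<le> inverse (real (Suc n))"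
  shows "f \<longlonglongrightarrow> a"
  by (rule LIM_zero_cancel, rule Lim_null_comparison[OF always_eventually LIMSEQ_inverse_real_of_nat])
     (use assms in blast)

text \<open>With \<open>\<rho>\<close> tending to zero the matrices stay bounded, so a subsequence
  converges and the extra term in the upper bound disappears. The points converge because they are
  their centres plus the gradients divided by \<open>l\<close>.\<close>

theorem (in doubled_maximum) theorem_on_sums:
  assumes S: "S \<subseteq> K"
  obtains xs ps Xs X ys qs Ys Y where
    "\<And>n. (ps n, Xs n) \<in> superjet S u1 (xs n)" "xs \<longlonglongrightarrow> x0" "(\<lambda>n. u1 (xs n)) \<longlonglongrightarrow> u1 x0"
    "ps \<longlonglongrightarrow> \<alpha> *\<^sub>R (x0 - y0)" "Xs \<longlonglongrightarrow> X" "X \<in> sym_mats"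
    "\<And>n. (qs n, Ys n) \<in> superjet S u2 (ys n)" "ys \<longlonglongrightarrow> y0" "(\<lambda>n. u2 (ys n)) \<longlonglongrightarrow> u2 y0"
    "qs \<longlonglongrightarrow> - (\<alpha> *\<^sub>R (x0 - y0))" "Ys \<longlonglongrightarrow> Y" "Y \<in> sym_mats"
    "\<And>h k. - (3 * \<alpha>) * ((norm h)\<^sup>2 + (norm k)\<^sup>2) \<le> (X *v h) \<bullet> h + (Y *v k) \<bullet> k"
    "\<And>h k. (X *v h) \<bullet> h + (Y *v k) \<bullet> k \<le> 3 * \<alpha> * (norm (h - k))\<^sup>2"
proof -
  define \<rho> where "\<rho> n = inverse (real (Suc n))" for n
  have \<rho>: "\<rho> n > 0" "\<rho> n \<le> 1" for n by (auto simp: \<rho>_def inverse_le_1_iff)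
  define Q where "Q n \<xi> \<zeta> x y p q X Y \<longleftrightarrow>
    norm (\<xi> - \<xi>0) \<le> \<rho> n \<and> norm (\<zeta> - \<zeta>0) \<le> \<rho> n \<and> norm (p - l *\<^sub>R e0) \<le> \<rho> n \<and> norm (q + l *\<^sub>R e0) \<le> \<rho> n \<and>
    l *\<^sub>R (x - \<xi>) = p \<and> l *\<^sub>R (y - \<zeta>) = q \<and>
    U1 \<xi> = u1 x - l / 2 * (norm (x - \<xi>))\<^sup>2 \<and> U2 \<zeta> = u2 y - l / 2 * (norm (y - \<zeta>))\<^sup>2 \<and>
    (p, X) \<in> superjet S u1 x \<and> (q, Y) \<in> superjet S u2 y \<and>
    (\<forall>h k. - l * ((norm h)\<^sup>2 + (norm k)\<^sup>2) \<le> (X *v h) \<bullet> h + (Y *v k) \<bullet> k) \<and>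
    (\<forall>h k. (X *v h) \<bullet> h + (Y *v k) \<bullet> k \<le> l * (norm (h - k))\<^sup>2 + \<rho> n * ((norm h)\<^sup>2 + (norm k)\<^sup>2))" for n \<xi> \<zeta> x y p q X Y
  have "\<exists>\<xi> \<zeta> x y p q X Y. Q n \<xi> \<zeta> x y p q X Y" for n
    by (rule superjets_near[OF S \<rho>(1)[of n]]) (unfold Q_def, blast)
  then obtain \<xi> \<zeta> x y p q X Y where Q: "\<And>n. Q n (\<xi> n) (\<zeta> n) (x n) (y n) (p n) (q n) (X n) (Y n)"
    by metis
  have jets: "(p n, X n) \<in> superjet S u1 (x n)" "(q n, Y n) \<in> superjet S u2 (y n)" for n
    using Q[of n] by (auto simp: Q_def)
  have lo: "- l * ((norm h)\<^sup>2 + (norm k)\<^sup>2) \<le> (X n *v h) \<bullet> h + (Y n *v k) \<bullet> k"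
    and up: "(X n *v h) \<bullet> h + (Y n *v k) \<bullet> k \<le> l * (norm (h - k))\<^sup>2 + \<rho> n * ((norm h)\<^sup>2 + (norm k)\<^sup>2)" for n h k
    using Q[of n] unfolding Q_def by blast+
  have \<xi>: "\<xi> \<longlonglongrightarrow> \<xi>0" and \<zeta>: "\<zeta> \<longlonglongrightarrow> \<zeta>0" and p: "p \<longlonglongrightarrow> l *\<^sub>R e0" and q: "q \<longlonglongrightarrow> - (l *\<^sub>R e0)"
    using Q by (auto intro!: tendsto_of_norm_le_inverse_Suc simp: Q_def \<rho>_def)
  have xq: "x n = \<xi> n + (1 / l) *\<^sub>R p n" "y n = \<zeta> n + (1 / l) *\<^sub>R q n" for n
  proof -
    have "p n = l *\<^sub>R (x n - \<xi> n)" "q n = l *\<^sub>R (y n - \<zeta> n)" using Q[of n] by (simp_all add: Q_def)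
    then show "x n = \<xi> n + (1 / l) *\<^sub>R p n" "y n = \<zeta> n + (1 / l) *\<^sub>R q n" using l_pos by simp_all
  qed
  \<comment> \<open>Semicontinuity alone would not give convergence of the values of
    \<open>u1\<close> and \<open>u2\<close>. It comes from the continuity of the sup-convolutions,
    which attain their suprema at these points.\<close>
  have uq: "u1 (x n) = U1 (\<xi> n) + l / 2 * (norm ((1 / l) *\<^sub>R p n))\<^sup>2"
    "u2 (y n) = U2 (\<zeta> n) + l / 2 * (norm ((1 / l) *\<^sub>R q n))\<^sup>2" for n
    using Q[of n] xq[of n] unfolding Q_def by (simp_all add: algebra_simps)
  have el: "l *\<^sub>R e0 = \<alpha> *\<^sub>R (x0 - y0)" by (simp add: l_def e0_def)
  have "x \<longlonglongrightarrow> \<xi>0 + (1 / l) *\<^sub>R (l *\<^sub>R e0)" unfolding xq(1)[abs_def] by (intro tendsto_intros \<xi> p)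
  then have x: "x \<longlonglongrightarrow> x0" using l_pos by (simp add: \<xi>0_def)
  have "y \<longlonglongrightarrow> \<zeta>0 + (1 / l) *\<^sub>R (- (l *\<^sub>R e0))" unfolding xq(2)[abs_def] by (intro tendsto_intros \<zeta> q)
  then have y: "y \<longlonglongrightarrow> y0" using l_pos by (simp add: \<zeta>0_def)
  have U: "(\<lambda>n. U1 (\<xi> n)) \<longlonglongrightarrow> U1 \<xi>0" "(\<lambda>n. U2 (\<zeta> n)) \<longlonglongrightarrow> U2 \<zeta>0"
    using continuous_on_tendsto_compose[OF continuous_on_sup_convolution[OF K K_ne u1 l_pos] \<xi>]
      continuous_on_tendsto_compose[OF continuous_on_sup_convolution[OF K K_ne u2 l_pos] \<zeta>] by auto
  have "(\<lambda>n. u1 (x n)) \<longlonglongrightarrow> U1 \<xi>0 + l / 2 * (norm ((1 / l) *\<^sub>R (l *\<^sub>R e0)))\<^sup>2"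
    unfolding uq by (intro tendsto_intros U p)
  then have ux: "(\<lambda>n. u1 (x n)) \<longlonglongrightarrow> u1 x0" using l_pos by (simp add: convolved_at)
  have "(\<lambda>n. u2 (y n)) \<longlonglongrightarrow> U2 \<zeta>0 + l / 2 * (norm ((1 / l) *\<^sub>R (- (l *\<^sub>R e0))))\<^sup>2"
    unfolding uq by (intro tendsto_intros U q)
  then have uy: "(\<lambda>n. u2 (y n)) \<longlonglongrightarrow> u2 y0" using l_pos by (simp add: convolved_at)
  have "norm (X n) \<le> real CARD('n) * (real CARD('n) * (l + 1))" for n
  proof (rule sym_mats_norm_le[OF superjet_sym_mats[OF jets(1)]])
    fix h :: "real^'n"
    have "\<rho> n * (norm h)\<^sup>2 \<le> 1 * (norm h)\<^sup>2" using \<rho>(2) by (intro mult_right_mono) auto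
    show "\<bar>(X n *v h) \<bullet> h\<bar> \<le> (l + 1) * (norm h)\<^sup>2"
    proof -
      have "- (l * (norm h)\<^sup>2) \<le> (X n *v h) \<bullet> h" "(X n *v h) \<bullet> h \<le> l * (norm h)\<^sup>2 + \<rho> n * (norm h)\<^sup>2"
        using lo[of h 0 n] up[of n h 0] by simp_all
      moreover have "0 \<le> (norm h)\<^sup>2" by simp
      ultimately show ?thesis using \<open>\<rho> n * (norm h)\<^sup>2 \<le> 1 * (norm h)\<^sup>2\<close> unfolding distrib_right by linarith
    qed
  qed
  moreover have "norm (Y n) \<le> real CARD('n) * (real CARD('n) * (l + 1))" for n
  proof (rule sym_mats_norm_le[OF superjet_sym_mats[OF jets(2)]])
    fix h :: "real^'n"
    have "\<rho> n * (norm h)\<^sup>2 \<le> 1 * (norm h)\<^sup>2" using \<rho>(2) by (intro mult_right_mono) auto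
    show "\<bar>(Y n *v h) \<bullet> h\<bar> \<le> (l + 1) * (norm h)\<^sup>2"
    proof -
      have "- (l * (norm h)\<^sup>2) \<le> (Y n *v h) \<bullet> h" "(Y n *v h) \<bullet> h \<le> l * (norm h)\<^sup>2 + \<rho> n * (norm h)\<^sup>2"
        using lo[of 0 h n] up[of n 0 h] by simp_all
      moreover have "0 \<le> (norm h)\<^sup>2" by simp
      ultimately show ?thesis using \<open>\<rho> n * (norm h)\<^sup>2 \<le> 1 * (norm h)\<^sup>2\<close> unfolding distrib_right by linarith
    qed
  qed
  ultimately have "bounded (range (\<lambda>n. (X n, Y n)))"
    unfolding bounded_iff by (auto intro!: exI order_trans[OF norm_Pair_le add_mono])
  then obtain Z r where r: "strict_mono (r :: nat \<Rightarrow> nat)" "((\<lambda>n. (X n, Y n)) \<circ> r) \<longlonglongrightarrow> Z"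
    using bounded_imp_convergent_subsequence by blast
  obtain X' Y' where Z: "Z = (X', Y')" by (cases Z)
  have X': "(X \<circ> r) \<longlonglongrightarrow> X'" and Y': "(Y \<circ> r) \<longlonglongrightarrow> Y'"
    using tendsto_fst[OF r(2)] tendsto_snd[OF r(2)] by (simp_all add: Z o_def)
  have form: "(\<lambda>n. ((X \<circ> r) n *v h) \<bullet> h + ((Y \<circ> r) n *v k) \<bullet> k) \<longlonglongrightarrow> (X' *v h) \<bullet> h + (Y' *v k) \<bullet> k" for h k
  proof (intro tendsto_intros)
    show "(\<lambda>n. (X \<circ> r) n *v h) \<longlonglongrightarrow> X' *v h"
      by (rule bounded_linear.tendsto[OF _ X'])
         (auto intro!: linear_conv_bounded_linear[THEN iffD1] linearI simp: matrix_vector_mult_add_rdistrib scaleR_matrix_vector_assoc)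
    show "(\<lambda>n. (Y \<circ> r) n *v k) \<longlonglongrightarrow> Y' *v k"
      by (rule bounded_linear.tendsto[OF _ Y'])
         (auto intro!: linear_conv_bounded_linear[THEN iffD1] linearI simp: matrix_vector_mult_add_rdistrib scaleR_matrix_vector_assoc)
  qed
  have \<rho>0: "(\<lambda>n. \<rho> (r n)) \<longlonglongrightarrow> 0"
    using LIMSEQ_subseq_LIMSEQ[OF LIMSEQ_inverse_real_of_nat r(1)] by (simp add: \<rho>_def o_def)
  show thesis
  proof (rule that[of "p \<circ> r" "X \<circ> r" "x \<circ> r" X' "q \<circ> r" "Y \<circ> r" "y \<circ> r" Y'])
    show "- (3 * \<alpha>) * ((norm h)\<^sup>2 + (norm k)\<^sup>2) \<le> (X' *v h) \<bullet> h + (Y' *v k) \<bullet> k" for h k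
      using lo[of h k] by (intro LIMSEQ_le_const[OF form]) (auto simp: l_def)
    show "(X' *v h) \<bullet> h + (Y' *v k) \<bullet> k \<le> 3 * \<alpha> * (norm (h - k))\<^sup>2" for h k
    proof -
      have "(\<lambda>n. l * (norm (h - k))\<^sup>2 + \<rho> (r n) * ((norm h)\<^sup>2 + (norm k)\<^sup>2)) \<longlonglongrightarrow> l * (norm (h - k))\<^sup>2 + 0 * ((norm h)\<^sup>2 + (norm k)\<^sup>2)"
        by (intro tendsto_intros \<rho>0)
      from LIMSEQ_le[OF form this] up show ?thesis by (auto simp: l_def)
    qed
    show "X' \<in> sym_mats" "Y' \<in> sym_mats"
      using closed_sequentially[OF closed_sym_mats _ X'] closed_sequentially[OF closed_sym_mats _ Y']
        superjet_sym_mats[OF jets(1)] superjet_sym_mats[OF jets(2)] by auto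
    show "(\<lambda>n. u1 ((x \<circ> r) n)) \<longlonglongrightarrow> u1 x0" "(\<lambda>n. u2 ((y \<circ> r) n)) \<longlonglongrightarrow> u2 y0"
      using LIMSEQ_subseq_LIMSEQ[OF ux r(1)] LIMSEQ_subseq_LIMSEQ[OF uy r(1)] by (simp_all add: o_def)
  qed (use LIMSEQ_subseq_LIMSEQ[OF _ r(1)] p q x y jets X' Y' el in \<open>simp_all add: o_def\<close>)
qed

section \<open>The comparison principle\<close>

lemma sum_UNIV_Plus:
  fixes f :: "'m::finite + 'n::finite \<Rightarrow> 'a::comm_monoid_add"
  shows "(\<Sum>i\<in>UNIV. f i) = (\<Sum>i\<in>UNIV. f (Inl i)) + (\<Sum>i\<in>UNIV. f (Inr i))"
  by (simp add: UNIV_Plus_UNIV[symmetric] sum.Plus del: UNIV_Plus_UNIV)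

lemma block_mat_form:
  fixes A B C D :: "real^'n^'n" and \<eta> :: "real^('n + 'n)"
  defines "h \<equiv> (\<chi> i. \<eta> $ Inl i) :: real^'n" and "k \<equiv> (\<chi> i. \<eta> $ Inr i) :: real^'n"
  shows "(block_mat A B C D *v \<eta>) \<bullet> \<eta> = (A *v h) \<bullet> h + (B *v k) \<bullet> h + (C *v h) \<bullet> k + (D *v k) \<bullet> k"
proof -
  have "(block_mat A B C D *v \<eta>) $ Inl i = (A *v h) $ i + (B *v k) $ i"
    "(block_mat A B C D *v \<eta>) $ Inr i = (C *v h) $ i + (D *v k) $ i" for i
    by (simp_all add: matrix_vector_mult_def block_mat_def sum_UNIV_Plus h_def k_def)
  then have "(block_mat A B C D *v \<eta>) \<bullet> \<eta>
     = (\<Sum>i\<in>UNIV. ((A *v h) $ i + (B *v k) $ i) * h $ i) + (\<Sum>i\<in>UNIV. ((C *v h) $ i + (D *v k) $ i) * k $ i)"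
    by (simp add: inner_vec_def sum_UNIV_Plus h_def k_def)
  then show ?thesis by (simp add: inner_vec_def sum.distrib distrib_right)
qed

lemma mat_le_block_lower:
  fixes X Z :: "real^'n^'n"
  assumes "\<And>h k. - c * ((norm h)\<^sup>2 + (norm k)\<^sup>2) \<le> (X *v h) \<bullet> h + (Z *v k) \<bullet> k"
  shows "(- c) *\<^sub>R block_mat (mat 1) 0 0 (mat 1) \<preceq> block_mat X 0 0 Z"
  using assms unfolding mat_le_def scaleR_matrix_vector_assoc[symmetric] inner_scaleR_left block_mat_form
  by (simp add: power2_norm_eq_inner)

lemma mat_le_block_upper:
  fixes X Z :: "real^'n^'n"
  assumes "\<And>h k. (X *v h) \<bullet> h + (Z *v k) \<bullet> k \<le> c * (norm (h - k))\<^sup>2"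
  shows "block_mat X 0 0 Z \<preceq> c *\<^sub>R block_mat (mat 1) (- mat 1) (- mat 1) (mat 1)"
proof -
  have neg: "(- mat 1) *v k = - (k :: real^'n)" for k
    using scaleR_mat1_vector_mult[of "-1" k] by simp
  have "(X *v h) \<bullet> h + (Z *v k) \<bullet> k \<le> c * ((mat 1 *v h) \<bullet> h + (- mat 1 *v k) \<bullet> h + (- mat 1 *v h) \<bullet> k + (mat 1 *v k) \<bullet> k)" for h k
    using assms[of h k] unfolding neg
    by (simp add: power2_norm_eq_inner inner_simps inner_commute algebra_simps)
  then show ?thesis
    unfolding mat_le_def scaleR_matrix_vector_assoc[symmetric] inner_scaleR_left block_mat_form
    by (simp only: matrix_vector_mult_0 inner_zero_left add_0_right) blast
qed

section \<open>Penalization in the doubled variables\<close>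

lemma usc_on_LIMSEQ:
  fixes f :: "'a::metric_space \<Rightarrow> real"
  assumes "usc_on K f" "a \<in> K" "x \<longlonglongrightarrow> a" "\<And>n. x n \<in> K" "f a < c"
  shows "\<forall>\<^sub>F n in sequentially. f (x n) < c"
proof -
  obtain d where d: "d > 0" "\<And>y. y \<in> K \<Longrightarrow> dist y a < d \<Longrightarrow> f y < c"
    using usc_on_dist[OF assms(1,2,5)] by metis
  from tendstoD[OF assms(3) d(1)] show ?thesis by eventually_elim (use d assms(4) in blast)
qed

text \<open>Upper bounds on \<open>f\<close> and \<open>g\<close> bound the penalty, so limit points
  lie on the diagonal. There \<open>f z + g z\<close> cannot exceed the maximum, and upper
  semicontinuity squeezes the penalty to zero. That it vanishes, beyond being bounded, is what the
  modulus in the structure condition needs.\<close>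

lemma penalization_limit:
  fixes K :: "'a::euclidean_space set"
  assumes K: "compact K" and f: "usc_on K f" and g: "usc_on K g" and m: "m \<in> K"
    and mmax: "\<And>z. z \<in> K \<Longrightarrow> f z + g z \<le> f m + g m"
    and xy: "\<And>n. x n \<in> K" "\<And>n. y n \<in> K" and \<alpha>: "\<And>n. \<alpha> n > 0" "filterlim \<alpha> at_top sequentially"
    and max: "\<And>n. f m + g m \<le> f (x n) + g (y n) - \<alpha> n / 2 * (norm (x n - y n))\<^sup>2"
  obtains r z where "strict_mono (r :: nat \<Rightarrow> nat)" "z \<in> K" "f m + g m \<le> f z + g z"
    "(x \<circ> r) \<longlonglongrightarrow> z" "(y \<circ> r) \<longlonglongrightarrow> z" "(\<lambda>n. \<alpha> (r n) * (norm (x (r n) - y (r n)))\<^sup>2) \<longlonglongrightarrow> 0"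
proof -
  have ne: "K \<noteq> {}" using m by auto
  obtain a where a: "\<And>z. z \<in> K \<Longrightarrow> f z \<le> f a" using usc_on_attains_sup[OF K ne f] by blast
  obtain b where b: "\<And>z. z \<in> K \<Longrightarrow> g z \<le> g b" using usc_on_attains_sup[OF K ne g] by blast
  define C where "C = f a + g b - (f m + g m)"
  have C: "\<alpha> n / 2 * (norm (x n - y n))\<^sup>2 \<le> C" for n
    using a[OF xy(1)[of n]] b[OF xy(2)[of n]] max[of n] by (simp add: C_def)
  obtain w r where r: "w \<in> K \<times> K" "strict_mono (r :: nat \<Rightarrow> nat)" "((\<lambda>n. (x n, y n)) \<circ> r) \<longlonglongrightarrow> w"
    using compact_Times[OF K K, unfolded compact_def, rule_format, of "\<lambda>n. (x n, y n)"] xy by auto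
  obtain z z' where w: "w = (z, z')" by (cases w)
  have z: "z \<in> K" and xz: "(x \<circ> r) \<longlonglongrightarrow> z" and yz: "(y \<circ> r) \<longlonglongrightarrow> z'"
    using r(1) tendsto_fst[OF r(3)] tendsto_snd[OF r(3)] by (simp_all add: w o_def)
  have "(\<lambda>n. (norm (x n - y n))\<^sup>2) \<longlonglongrightarrow> 0"
  proof (rule tendsto_sandwich[OF _ _ tendsto_const])
    show "\<forall>\<^sub>F n in sequentially. (norm (x n - y n))\<^sup>2 \<le> (2 * C) * inverse (\<alpha> n)"
      using C \<alpha>(1) by (intro always_eventually allI) (simp add: field_simps)
    show "(\<lambda>n. (2 * C) * inverse (\<alpha> n)) \<longlonglongrightarrow> 0"
      by (rule tendsto_mult_right_zero, rule tendsto_inverse_0_at_top[OF \<alpha>(2)])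
  qed auto
  then have "(\<lambda>n. (norm (x (r n) - y (r n)))\<^sup>2) \<longlonglongrightarrow> 0"
    using LIMSEQ_subseq_LIMSEQ[OF _ r(2)] by (fastforce simp: o_def)
  moreover have "(\<lambda>n. (norm ((x \<circ> r) n - (y \<circ> r) n))\<^sup>2) \<longlonglongrightarrow> (norm (z - z'))\<^sup>2"
    by (intro tendsto_intros xz yz)
  ultimately have "(norm (z - z'))\<^sup>2 = 0" using LIMSEQ_unique by (fastforce simp: o_def)
  then have zz: "z' = z" by simp
  have near: "\<forall>\<^sub>F n in sequentially. \<alpha> (r n) / 2 * (norm (x (r n) - y (r n)))\<^sup>2 + (f m + g m) < f z + g z + e" if "e > 0" for e
  proof -
    have "\<forall>\<^sub>F n in sequentially. f ((x \<circ> r) n) < f z + e / 2" "\<forall>\<^sub>F n in sequentially. g ((y \<circ> r) n) < g z + e / 2"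
      using usc_on_LIMSEQ[OF f z xz] usc_on_LIMSEQ[OF g z yz[unfolded zz]] xy that by auto
    then show ?thesis
    proof eventually_elim
      case (elim n)
      then show ?case using max[of "r n"] by simp
    qed
  qed
  have "f m + g m \<le> f z + g z"
  proof (rule field_le_epsilon)
    fix e :: real assume "e > 0"
    from eventually_happens'[OF _ near[OF this]] obtain n
      where "\<alpha> (r n) / 2 * (norm (x (r n) - y (r n)))\<^sup>2 + (f m + g m) < f z + g z + e" by auto
    moreover have "0 \<le> \<alpha> (r n) / 2 * (norm (x (r n) - y (r n)))\<^sup>2" using \<alpha>(1)[of "r n"] by simp
    ultimately show "f m + g m \<le> f z + g z + e" by linarith
  qed
  moreover have "(\<lambda>n. \<alpha> (r n) * (norm (x (r n) - y (r n)))\<^sup>2) \<longlonglongrightarrow> 0"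
  proof (rule LIMSEQ_I)
    fix e :: real assume "e > 0"
    then have "\<forall>\<^sub>F n in sequentially. \<alpha> (r n) / 2 * (norm (x (r n) - y (r n)))\<^sup>2 + (f m + g m) < f z + g z + e / 2"
      by (intro near) simp
    then have "\<forall>\<^sub>F n in sequentially. norm (\<alpha> (r n) * (norm (x (r n) - y (r n)))\<^sup>2 - 0) < e"
    proof eventually_elim
      case (elim n)
      have "0 \<le> \<alpha> (r n) * (norm (x (r n) - y (r n)))\<^sup>2" using \<alpha>(1)[of "r n"] by simp
      then show ?case using elim mmax[OF z] by simp
    qed
    then show "\<exists>N. \<forall>n\<ge>N. norm (\<alpha> (r n) * (norm (x (r n) - y (r n)))\<^sup>2 - 0) < e"
      by (simp add: eventually_sequentially)
  qed
  ultimately show thesis using that[of r z] r(2) z xz yz zz by simp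
qed

lemma lsc_on_uminus: "lsc_on S f \<Longrightarrow> usc_on S (\<lambda>x. - f x)"
  unfolding lsc_on_def usc_on_def
proof (intro ballI allI impI)
  fix x a assume *: "\<forall>x\<in>S. \<forall>a. a < f x \<longrightarrow> (\<forall>\<^sub>F y in at x within S. a < f y)" "x \<in> S" "- f x < a"
  then have "\<forall>\<^sub>F y in at x within S. - a < f y" by simp
  then show "\<forall>\<^sub>F y in at x within S. - f y < a" by eventually_elim simp
qed

text \<open>Continuity of \<open>F\<close> is relative to points of \<open>\<Omega>\<close> and
  symmetric matrices, so eventual membership in \<open>\<Omega>\<close> is part of the argument; it
  is returned too because the viscosity inequalities hold only there.\<close>

lemma viscosity_equation_limit:
  fixes F :: "real^'n \<Rightarrow> real \<Rightarrow> real^'n \<Rightarrow> real^'n^'n \<Rightarrow> real"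
  assumes F: "continuous_on (\<Omega> \<times> UNIV \<times> UNIV \<times> sym_mats) (\<lambda>(x, r, p, X). F x r p X)"
    and \<Omega>: "open \<Omega>" "x \<in> \<Omega>" and X: "X \<in> sym_mats" "\<And>n. Xs n \<in> sym_mats"
    and lim: "xs \<longlonglongrightarrow> x" "rs \<longlonglongrightarrow> r" "ps \<longlonglongrightarrow> p" "Xs \<longlonglongrightarrow> X"
  shows "(\<lambda>n. F (xs n) (rs n) (ps n) (Xs n)) \<longlonglongrightarrow> F x r p X" "\<forall>\<^sub>F n in sequentially. xs n \<in> \<Omega>"
proof -
  show ev: "\<forall>\<^sub>F n in sequentially. xs n \<in> \<Omega>" by (rule topological_tendstoD[OF lim(1) \<Omega>])
  have "(\<lambda>n. (xs n, rs n, ps n, Xs n)) \<longlonglongrightarrow> (x, r, p, X)" by (intro tendsto_Pair lim)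
  from continuous_on_tendsto_compose[OF F this] show "(\<lambda>n. F (xs n) (rs n) (ps n) (Xs n)) \<longlonglongrightarrow> F x r p X"
    using ev \<Omega> X by (auto elim!: eventually_mono)
qed

theorem theorem3p3:
  fixes \<Omega> :: "(real ^ 'n) set"
    and F :: "real ^ 'n \<Rightarrow> real \<Rightarrow> real ^ 'n \<Rightarrow> real ^ 'n ^ 'n \<Rightarrow> real"
    and om :: "ennreal \<Rightarrow> ennreal"
    and u v :: "real ^ 'n \<Rightarrow> real"
    and \<gamma> :: real
  assumes "bounded \<Omega>" and "open \<Omega>"
    and "continuous_on (\<Omega> \<times> UNIV \<times> UNIV \<times> sym_mats) (\<lambda>(x, r, p, X). F x r p X)"
    and "proper_on \<Omega> F"
    and "\<gamma> > 0"
    and "\<And>r s x p X. r \<ge> s \<Longrightarrow> x \<in> \<Omega> \<Longrightarrow> X \<in> sym_mats \<Longrightarrow>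
           \<gamma> * (r - s) \<le> F x r p X - F x s p X"
    and "(om \<longlongrightarrow> 0) (at_right 0)"
    and "\<And>\<alpha> x y r X Y. \<alpha> > 0 \<Longrightarrow> x \<in> \<Omega> \<Longrightarrow> y \<in> \<Omega> \<Longrightarrow> X \<in> sym_mats \<Longrightarrow> Y \<in> sym_mats \<Longrightarrow>
           (- (3 * \<alpha>)) *\<^sub>R block_mat (mat 1) 0 0 (mat 1) \<preceq> block_mat X 0 0 (- Y) \<Longrightarrow>
           block_mat X 0 0 (- Y) \<preceq> (3 * \<alpha>) *\<^sub>R block_mat (mat 1) (- mat 1) (- mat 1) (mat 1) \<Longrightarrow>
           ereal (F y r (\<alpha> *\<^sub>R (x - y)) Y - F x r (\<alpha> *\<^sub>R (x - y)) X)
             \<le> enn2ereal (om (ennreal (\<alpha> * (norm (x - y))\<^sup>2 + norm (x - y))))"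
    and "usc_on (closure \<Omega>) u" and "viscosity_subsolution F \<Omega> u"
    and "lsc_on (closure \<Omega>) v" and "viscosity_supersolution F \<Omega> v"
    and "\<And>x. x \<in> frontier \<Omega> \<Longrightarrow> u x \<le> v x"
  shows "\<And>x. x \<in> closure \<Omega> \<Longrightarrow> u x \<le> v x"
proof (rule ccontr)
  note bdd = assms(1) and opn = assms(2) and cont = assms(3) and proper = assms(4) and \<gamma> = assms(5)
    and incr = assms(6) and om = assms(7) and estimate = assms(8)
  fix x1 assume x1: "x1 \<in> closure \<Omega>" "\<not> u x1 \<le> v x1"
  define K where "K = closure \<Omega>"
  define w where "w x = - v x" for x
  have K: "compact K" using bdd by (simp add: K_def compact_closure)
  have ne: "K \<noteq> {}" using x1 by (auto simp: K_def)
  have S: "\<Omega> \<subseteq> K" by (simp add: K_def closure_subset)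
  have u: "usc_on K u" using assms(9) by (simp add: K_def)
  have w: "usc_on K w" using lsc_on_uminus[OF assms(11)] by (simp add: K_def w_def[abs_def])
  obtain m where m: "m \<in> K" "\<And>z. z \<in> K \<Longrightarrow> u z + w z \<le> u m + w m"
    using usc_on_attains_sup[OF K ne usc_on_add[OF u w]] by blast
  define \<theta> where "\<theta> = u m + w m"
  have \<theta>: "\<theta> > 0" using m(2)[of x1] x1 by (simp add: \<theta>_def w_def K_def)
  define \<alpha> where "\<alpha> n = real (Suc n)" for n
  have \<alpha>: "\<alpha> n > 0" for n by (simp add: \<alpha>_def)
  have "\<exists>x y. x \<in> K \<and> y \<in> K \<and> (\<forall>x'\<in>K. \<forall>y'\<in>K. u x' + w y' - \<alpha> n / 2 * (norm (x' - y'))\<^sup>2 \<le> u x + w y - \<alpha> n / 2 * (norm (x - y))\<^sup>2)" for n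
  proof -
    have "usc_on (K \<times> K) (\<lambda>z. u (fst z) + w (snd z) + - (\<alpha> n / 2 * (norm (fst z - snd z))\<^sup>2))"
      by (intro usc_on_add usc_on_compose[OF u] usc_on_compose[OF w] continuous_on_imp_usc_on continuous_intros) auto
    moreover have "K \<times> K \<noteq> {}" using ne by simp
    ultimately obtain q where q: "q \<in> K \<times> K" "\<And>q'. q' \<in> K \<times> K \<Longrightarrow>
        u (fst q') + w (snd q') + - (\<alpha> n / 2 * (norm (fst q' - snd q'))\<^sup>2)
        \<le> u (fst q) + w (snd q) + - (\<alpha> n / 2 * (norm (fst q - snd q))\<^sup>2)"
      using usc_on_attains_sup[OF compact_Times[OF K K]] by blast
    show ?thesis
    proof (intro exI conjI ballI)
      show "fst q \<in> K" "snd q \<in> K" using q(1) by auto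
      fix x' y' assume "x' \<in> K" "y' \<in> K"
      then show "u x' + w y' - \<alpha> n / 2 * (norm (x' - y'))\<^sup>2
        \<le> u (fst q) + w (snd q) - \<alpha> n / 2 * (norm (fst q - snd q))\<^sup>2"
        using q(2)[of "(x', y')"] by simp
    qed
  qed
  then obtain x y where xy: "\<And>n. x n \<in> K" "\<And>n. y n \<in> K"
    and max: "\<And>n x' y'. x' \<in> K \<Longrightarrow> y' \<in> K \<Longrightarrow> u x' + w y' - \<alpha> n / 2 * (norm (x' - y'))\<^sup>2 \<le> u (x n) + w (y n) - \<alpha> n / 2 * (norm (x n - y n))\<^sup>2"
    by metis
  have ge: "\<theta> \<le> u (x n) + w (y n) - \<alpha> n / 2 * (norm (x n - y n))\<^sup>2" for n
    using max[OF m(1) m(1), of n] by (simp add: \<theta>_def)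
  have \<alpha>top: "filterlim \<alpha> at_top sequentially"
    unfolding \<alpha>_def[abs_def] by (intro filterlim_compose[OF filterlim_real_sequentially filterlim_Suc])
  obtain r z where r: "strict_mono (r :: nat \<Rightarrow> nat)" and z: "z \<in> K" "u m + w m \<le> u z + w z"
    and lim: "(x \<circ> r) \<longlonglongrightarrow> z" "(y \<circ> r) \<longlonglongrightarrow> z" "(\<lambda>n. \<alpha> (r n) * (norm (x (r n) - y (r n)))\<^sup>2) \<longlonglongrightarrow> 0"
    by (rule penalization_limit[OF K u w m xy \<alpha> \<alpha>top ge[unfolded \<theta>_def]]) (assumption, rule that)
  have "z \<notin> frontier \<Omega>" using assms(13)[of z] z(2) \<theta> by (auto simp: w_def \<theta>_def)
  then have z\<Omega>: "z \<in> \<Omega>" using z(1) opn by (auto simp: frontier_def K_def interior_open)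
  \<comment> \<open>\<open>\<gamma> * \<theta>\<close> is the level to beat: by \<open>main\<close>
    below it bounds the left-hand side of the structure condition from below.\<close>
  have "ennreal (\<gamma> * \<theta>) > 0" using \<gamma> \<theta> by simp
  then have "\<forall>\<^sub>F s in at_right 0. om s < ennreal (\<gamma> * \<theta>)" by (rule order_tendstoD(2)[OF om])
  then obtain b where b: "b > 0" "\<And>s. 0 < s \<Longrightarrow> s < b \<Longrightarrow> om s < ennreal (\<gamma> * \<theta>)"
    using eventually_at_right[of "0::ennreal" 1] by auto
  \<comment> \<open>The threshold \<open>b\<close> is an extended number and may be infinite, while
    the argument of the modulus is compared as a real; any positive real not exceeding
    \<open>b\<close> serves.\<close>
  obtain \<epsilon> where \<epsilon>: "\<epsilon> > 0" "ennreal \<epsilon> \<le> b"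
  proof (cases b)
    case (real c)
    with b(1) show ?thesis by (intro that[of c]) (auto simp: less_le)
  next
    case top
    then show ?thesis by (intro that[of 1]) auto
  qed
  have "(\<lambda>n. \<alpha> (r n) * (norm (x (r n) - y (r n)))\<^sup>2 + norm ((x \<circ> r) n - (y \<circ> r) n)) \<longlonglongrightarrow> 0 + norm (z - z)"
    by (intro tendsto_intros lim)
  then have "\<forall>\<^sub>F n in sequentially. \<alpha> (r n) * (norm (x (r n) - y (r n)))\<^sup>2 + norm ((x \<circ> r) n - (y \<circ> r) n) < \<epsilon>"
    using \<epsilon>(1) by (intro order_tendstoD(2)) auto
  moreover have "\<forall>\<^sub>F n in sequentially. (x \<circ> r) n \<in> \<Omega>" "\<forall>\<^sub>F n in sequentially. (y \<circ> r) n \<in> \<Omega>"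
    using topological_tendstoD[OF lim(1) opn z\<Omega>] topological_tendstoD[OF lim(2) opn z\<Omega>] by auto
  ultimately have "\<forall>\<^sub>F n in sequentially. \<alpha> (r n) * (norm (x (r n) - y (r n)))\<^sup>2 + norm (x (r n) - y (r n)) < \<epsilon>
      \<and> x (r n) \<in> \<Omega> \<and> y (r n) \<in> \<Omega>"
    by eventually_elim simp
  \<comment> \<open>A single penalty parameter suffices, because the gap \<open>\<theta>\<close>
    does not depend on it.\<close>
  from eventually_happens'[OF _ this] obtain n0 where
    n0: "\<alpha> (r n0) * (norm (x (r n0) - y (r n0)))\<^sup>2 + norm (x (r n0) - y (r n0)) < \<epsilon>" "x (r n0) \<in> \<Omega>" "y (r n0) \<in> \<Omega>"
    by auto
  define x0 y0 a where "x0 = x (r n0)" and "y0 = y (r n0)" and "a = \<alpha> (r n0)"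
  note n0 = n0[folded x0_def y0_def a_def]
  have a: "a > 0" by (simp add: a_def \<alpha>)
  interpret doubled_maximum K u w x0 y0 a
    by unfold_locales (use K u w xy \<alpha> max in \<open>auto simp: x0_def y0_def a_def\<close>)
  define p where "p = a *\<^sub>R (x0 - y0)"
  obtain xs ps Xs X ys qs Ys Y where
    jx: "\<And>n. (ps n, Xs n) \<in> superjet \<Omega> u (xs n)" and lx: "xs \<longlonglongrightarrow> x0" "(\<lambda>n. u (xs n)) \<longlonglongrightarrow> u x0" "ps \<longlonglongrightarrow> a *\<^sub>R (x0 - y0)" "Xs \<longlonglongrightarrow> X" and X: "X \<in> sym_mats"
    and jy: "\<And>n. (qs n, Ys n) \<in> superjet \<Omega> w (ys n)" and ly: "ys \<longlonglongrightarrow> y0" "(\<lambda>n. w (ys n)) \<longlonglongrightarrow> w y0" "qs \<longlonglongrightarrow> - (a *\<^sub>R (x0 - y0))" "Ys \<longlonglongrightarrow> Y" and Y: "Y \<in> sym_mats"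
    and lo: "\<And>h k. - (3 * a) * ((norm h)\<^sup>2 + (norm k)\<^sup>2) \<le> (X *v h) \<bullet> h + (Y *v k) \<bullet> k"
    and up: "\<And>h k. (X *v h) \<bullet> h + (Y *v k) \<bullet> k \<le> 3 * a * (norm (h - k))\<^sup>2"
    by (rule theorem_on_sums[OF S]) (rule that)
  note lx = lx[folded p_def] and ly = ly[folded p_def]
  have neg: "- A \<in> sym_mats" if "A \<in> sym_mats" for A :: "real^'n^'n"
  proof -
    have "transpose (- A) = - transpose A" by (simp add: transpose_def vec_eq_iff)
    then show ?thesis using that by (simp add: sym_mats_def)
  qed
  \<comment> \<open>The pair of \<open>p\<close> and \<open>X\<close> is only a limit of jets at
    nearby points; continuity of \<open>F\<close> together with convergence of the values of
    \<open>u\<close> carries the inequality over to \<open>x0\<close>.\<close>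
  have sub: "F x0 (u x0) p X \<le> 0"
  proof (rule tendsto_upperbound)
    show "(\<lambda>n. F (xs n) (u (xs n)) (ps n) (Xs n)) \<longlonglongrightarrow> F x0 (u x0) p X"
      by (rule viscosity_equation_limit(1)[OF cont opn n0(2) X superjet_sym_mats[OF jx] lx])
    show "\<forall>\<^sub>F n in sequentially. F (xs n) (u (xs n)) (ps n) (Xs n) \<le> 0"
      using viscosity_equation_limit(2)[OF cont opn n0(2) X superjet_sym_mats[OF jx] lx]
    proof eventually_elim
      case (elim n)
      then show ?case using assms(10) jx[of n] by (auto simp: viscosity_subsolution_def)
    qed
  qed simp
  have super: "F y0 (v y0) p (- Y) \<ge> 0"
  proof (rule tendsto_lowerbound)
    have vs: "(\<lambda>n. v (ys n)) \<longlonglongrightarrow> v y0" using tendsto_minus[OF ly(2)] by (simp add: w_def)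
    have qs: "(\<lambda>n. - qs n) \<longlonglongrightarrow> p" using tendsto_minus[OF ly(3)] by simp
    note L = viscosity_equation_limit[OF cont opn n0(3) neg[OF Y] neg[OF superjet_sym_mats[OF jy]] ly(1) vs qs tendsto_minus[OF ly(4)]]
    show "(\<lambda>n. F (ys n) (v (ys n)) (- qs n) (- Ys n)) \<longlonglongrightarrow> F y0 (v y0) p (- Y)" by (rule L(1))
    show "\<forall>\<^sub>F n in sequentially. 0 \<le> F (ys n) (v (ys n)) (- qs n) (- Ys n)"
      using L(2)
    proof eventually_elim
      case (elim n)
      have "(- qs n, - Ys n) \<in> subjet \<Omega> v (ys n)"
        unfolding subjet_def using imageI[OF jy[of n], of uminus] by (simp add: w_def[abs_def])
      then show ?case using assms(12) elim by (auto simp: viscosity_supersolution_def)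
    qed
  qed simp
  have uv: "\<theta> \<le> u x0 - v y0"
  proof -
    have "0 \<le> a / 2 * (norm (x0 - y0))\<^sup>2" using a by simp
    then show ?thesis using ge[of "r n0"] unfolding x0_def y0_def a_def w_def by linarith
  qed
  \<comment> \<open>The structure condition compares both sides at one value of \<open>r\<close>, so
    \<open>u x0\<close> is lowered to \<open>v y0\<close>; strict monotonicity makes this a gain of
    at least \<open>\<gamma> * \<theta>\<close>.\<close>
  have "\<gamma> * \<theta> \<le> \<gamma> * (u x0 - v y0)" using uv \<gamma> by simp
  also have "\<dots> \<le> F x0 (u x0) p X - F x0 (v y0) p X"
    using uv \<theta> by (intro incr n0 X) simp
  also have "\<dots> \<le> F y0 (v y0) p (- Y) - F x0 (v y0) p X" using sub super by simp
  finally have main: "\<gamma> * \<theta> \<le> F y0 (v y0) p (- Y) - F x0 (v y0) p X" .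
  show False
  proof (cases "x0 = y0")
    case True
    txt \<open>The structure condition is void here because \<open>om 0\<close> is arbitrary; properness replaces it.\<close>
    have "X \<preceq> - Y"
      unfolding mat_le_def
    proof
      fix h
      have "(- Y) *v h = - (Y *v h)" by (simp add: matrix_vector_mult_def vec_eq_iff sum_negf)
      then show "(X *v h) \<bullet> h \<le> (- Y *v h) \<bullet> h" using up[of h h] by simp
    qed
    then have "F x0 (v y0) p (- Y) \<le> F x0 (v y0) p X"
      using proper n0(2) X neg[OF Y] by (simp add: proper_on_def)
    then show False using main True mult_pos_pos[OF \<gamma> \<theta>] by simp
  next
    case False
    define s where "s = a * (norm (x0 - y0))\<^sup>2 + norm (x0 - y0)"
    have s: "0 < s" "s < \<epsilon>" using False a n0(1) by (auto simp: s_def add_nonneg_pos)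
    have "ereal (F y0 (v y0) p (- Y) - F x0 (v y0) p X) \<le> enn2ereal (om (ennreal s))"
      unfolding s_def p_def
      by (rule estimate[OF a n0(2,3) X neg[OF Y]])
        (use mat_le_block_lower[OF lo] mat_le_block_upper[OF up] in simp_all)
    also have "\<dots> < enn2ereal (ennreal (\<gamma> * \<theta>))"
    proof -
      have "om (ennreal s) < ennreal (\<gamma> * \<theta>)"
      proof (rule b(2))
        show "ennreal s < b" using s \<epsilon>(2) ennreal_lessI[OF \<epsilon>(1) s(2)] by (rule_tac order.strict_trans2)
      qed (use s in simp)
      then show ?thesis by (simp add: less_ennreal.rep_eq)
    qed
    also have "\<dots> = ereal (\<gamma> * \<theta>)" using \<gamma> \<theta> by simp
    finally show False using main by simp
  qed
qed

end
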